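(* Let $n\geq 2$ and let $\Bbbk$ be any (nontrivial) commutative ring. The mesh category $Q$ over $\Bbbk$ of the repetitive quiver of $\vec{\mathbb{A}}_n$ is Hom-finite, locally bounded, has a Serre functor relative to $\Bbbk$ and has the Strong Retraction Property. More precisely, the following assertions hold. (a) Each hom $\Bbbk$-module $Q((p,i),(q,j))$ is either zero or free of dimension $1$. The latter happens if and only if the point $(q,j)$ lies in, or on the boundary of, the rectangle $R_{p,i}$ spanned by the four vertices $(p,i)$, $(1,i+1-p)$, $(n,i)$ and $(n+1-p,\,i+1-p)$, that is, if and only if $$0\leq i-j\leq p-1\quad\text{and}\quad 0\leq q-p+i-j\leq n-p .$$ (b) The Serre functor $\mathbb{S}$ is given by $\mathbb{S}(q,i)=(n+1-q,\,i+1-q)$ on objects, and on morphisms it is determined by $\mathbb{S}(a_{q,i})=(-1)^q a^*_{n-q,\,i+1-q}$ and $\mathbb{S}(a^*_{q,i})=(-1)^{n-q}a_{n-q,\,i-q}$ for $1\leq q<n$ and $i\in\mathbb{Z}$. Moreover, the arrow ideal $\mathfrak{r}$ (which is the pseudo-radical in $Q$) is nilpotent; in fact, one has $\mathfrak{r}^n=0$.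
   Context: $\vec{\mathbb{A}}_n$ is the quiver with vertices $1,\dots,n$ and arrows $a_q\colon q\to q+1$ for $1\leq q<n$. Its repetitive quiver has vertices $(q,i)$ with $1\leq q\leq n$, $i\in\mathbb{Z}$, and arrows $a_{q,i}\colon(q,i)\to(q+1,i)$ and $a^*_{q,i}\colon(q+1,i)\to(q,i-1)$ for $1\leq q<n$, $i\in\mathbb{Z}$. The quiver is drawn in the plane in the usual way, with each $a_{q,i}$ going one step down-right and each $a^*_{q,i}$ one step up-right; the rectangle $R_{p,i}$ refers to this drawing. The path category over $\Bbbk$ has the vertices as objects, and hom modules are the free $\Bbbk$-modules on the sets of paths (including trivial ones; paths are composed right to left). The mesh category $Q$ is the quotient of the path category by the two-sided ideal generated by the mesh relations, for all $i\in\mathbb{Z}$, $$\mu_{(1,i)}=a^*_{1,i+1}a_{1,i+1},\quad \mu_{(q,i)}=a_{q-1,i}a^*_{q-1,i+1}+a^*_{q,i+1}a_{q,i+1}\ (1<q<n),\quad \mu_{(n,i)}=a_{n-1,i}a^*_{n-1,i+1}.$$ The arrow ideal $\mathfrak{r}$ is the ideal of $Q$ generated by all arrows, and $\mathfrak{r}^n$ is its $n$-th power. For a small $\Bbbk$-preadditive category $Q$ (hom sets are $\Bbbk$-modules and composition is bilinear): - Hom-finite: each $Q(x,y)$ is a finitely generated projective $\Bbbk$-module. - Locally bounded: for each object $y$ the sets $\{x \mid Q(x,y)\neq 0\}$ and $\{z \mid Q(y,z)\neq 0\}$ are finite. - Serre functor relative to $\Bbbk$: a $\Bbbk$-linear autoequivalence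 $\mathbb{S}\colon Q\to Q$ together with an isomorphism $Q(x,y)\cong \operatorname{Hom}_{\Bbbk}(Q(y,\mathbb{S}(x)),\Bbbk)$ natural in $x,y$. - Strong Retraction Property: for each object $x$ the map $\Bbbk\to Q(x,x)$, $c\mapsto c\cdot\mathrm{id}_x$, has a $\Bbbk$-module retraction, and there is a collection of $\Bbbk$-submodules $\mathfrak{r}_x\subseteq Q(x,x)$ with $Q(x,x)=(\Bbbk\cdot\mathrm{id}_x)\oplus\mathfrak{r}_x$ such that $\mathfrak{r}_x\circ\mathfrak{r}_x\subseteq\mathfrak{r}_x$ for all $x$ and $Q(y,x)\circ Q(x,y)\subseteq\mathfrak{r}_x$ for all $x\neq y$. The associated pseudo-radical is the ideal with value $\mathfrak{r}_x$ at $(x,x)$ and $Q(x,y)$ at $(x,y)$ for $x\neq y$; here $\mathfrak{r}_x=\mathfrak{r}(x,x)$ for the arrow ideal $\mathfrak{r}$. *)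

theory Defs
  imports
    "HOL-Analysis.Analysis"
    "HOL-Algebra.Module"
    "HOL-Algebra.AbelCoset"
    "Graph_Theory.Arc_Walk"
begin

section \<open>Modules over a commutative ring\<close>

text \<open>
  The multiplicative fields \<open>mult\<close> and \<open>one\<close>, which HOL-Algebra module records inherit from
  ring records, play no role for a module and are left \<open>undefined\<close>.
\<close>

definition linear_map ::
  "('a, 'r) ring_scheme \<Rightarrow> ('a, 'm, 's) module_scheme \<Rightarrow> ('a, 'n, 't) module_scheme \<Rightarrow> ('m \<Rightarrow> 'n) \<Rightarrow> bool"
  where
  "linear_map k M N f \<longleftrightarrow>
     f \<in> carrier M \<rightarrow> carrier N \<and>
     (\<forall>x\<in>carrier M. \<forall>y\<in>carrier M. f (x \<oplus>\<^bsub>M\<^esub> y) = f x \<oplus>\<^bsub>N\<^esub> f y) \<and>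
     (\<forall>c\<in>carrier k. \<forall>x\<in>carrier M. f (c \<odot>\<^bsub>M\<^esub> x) = c \<odot>\<^bsub>N\<^esub> f x)"

definition linear_iso ::
  "('a, 'r) ring_scheme \<Rightarrow> ('a, 'm, 's) module_scheme \<Rightarrow> ('a, 'n, 't) module_scheme \<Rightarrow> ('m \<Rightarrow> 'n) \<Rightarrow> bool"
  where
  "linear_iso k M N f \<longleftrightarrow> linear_map k M N f \<and> bij_betw f (carrier M) (carrier N)"

definition regular_module :: "('a, 'r) ring_scheme \<Rightarrow> ('a, 'a) module" where
  "regular_module k =
     \<lparr>carrier = carrier k, mult = undefined, one = undefined, zero = \<zero>\<^bsub>k\<^esub>,
      add = (\<lambda>x y. x \<oplus>\<^bsub>k\<^esub> y), smult = (\<lambda>c x. c \<otimes>\<^bsub>k\<^esub> x)\<rparr>"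

text \<open>The module of \<open>k\<close>-linear maps from \<open>M\<close> to \<open>k\<close>.\<close>

definition dual_module ::
  "('a, 'r) ring_scheme \<Rightarrow> ('a, 'm, 's) module_scheme \<Rightarrow> ('a, 'm \<Rightarrow> 'a) module" where
  "dual_module k M =
     \<lparr>carrier = {\<phi> \<in> extensional (carrier M). linear_map k M (regular_module k) \<phi>},
      mult = undefined, one = undefined,
      zero = (\<lambda>m\<in>carrier M. \<zero>\<^bsub>k\<^esub>),
      add = (\<lambda>\<phi> \<psi>. \<lambda>m\<in>carrier M. \<phi> m \<oplus>\<^bsub>k\<^esub> \<psi> m),
      smult = (\<lambda>c \<phi>. \<lambda>m\<in>carrier M. c \<otimes>\<^bsub>k\<^esub> \<phi> m)\<rparr>"

text \<open>Free module on \<open>X\<close>: the functions of finite support, equal to zero outside \<open>X\<close>.\<close>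

definition free_module :: "('a, 'r) ring_scheme \<Rightarrow> 'x set \<Rightarrow> ('a, 'x \<Rightarrow> 'a) module" where
  "free_module k X =
     \<lparr>carrier = {f. (\<forall>p. f p \<in> carrier k) \<and> {p. f p \<noteq> \<zero>\<^bsub>k\<^esub>} \<subseteq> X \<and> finite {p. f p \<noteq> \<zero>\<^bsub>k\<^esub>}},
      mult = undefined, one = undefined,
      zero = (\<lambda>p. \<zero>\<^bsub>k\<^esub>),
      add = (\<lambda>f g p. f p \<oplus>\<^bsub>k\<^esub> g p),
      smult = (\<lambda>c f p. c \<otimes>\<^bsub>k\<^esub> f p)\<rparr>"

definition basis_elem :: "('a, 'r) ring_scheme \<Rightarrow> 'x \<Rightarrow> 'x \<Rightarrow> 'a" where
  "basis_elem k p = (\<lambda>p'. if p' = p then \<one>\<^bsub>k\<^esub> else \<zero>\<^bsub>k\<^esub>)"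

definition free_of_dim :: "('a, 'r) ring_scheme \<Rightarrow> nat \<Rightarrow> ('a, 'm, 's) module_scheme \<Rightarrow> bool" where
  "free_of_dim k d M \<longleftrightarrow> (\<exists>f. linear_iso k (free_module k {..<d}) M f)"

definition zero_module :: "('a, 'm, 's) module_scheme \<Rightarrow> bool" where
  "zero_module M \<longleftrightarrow> carrier M = {\<zero>\<^bsub>M\<^esub>}"

definition module_span :: "('a, 'r) ring_scheme \<Rightarrow> ('a, 'm, 's) module_scheme \<Rightarrow> 'm set \<Rightarrow> 'm set" where
  "module_span k M S = \<Inter>{N. submodule N k M \<and> S \<subseteq> N}"

definition finitely_generated :: "('a, 'r) ring_scheme \<Rightarrow> ('a, 'm, 's) module_scheme \<Rightarrow> bool" where
  "finitely_generated k M \<longleftrightarrow> (\<exists>B. finite B \<and> B \<subseteq> carrier M \<and> module_span k M B = carrier M)"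

text \<open>
  Projective: a direct summand of a free module. It suffices to consider free modules on subsets
  of the type of the elements of \<open>M\<close>, as \<open>M\<close> is a quotient of the free module on its carrier.
\<close>

definition projective :: "('a, 'r) ring_scheme \<Rightarrow> ('a, 'm, 's) module_scheme \<Rightarrow> bool" where
  "projective k M \<longleftrightarrow>
     (\<exists>(X :: 'm set) \<iota> \<pi>. linear_map k M (free_module k X) \<iota> \<and> linear_map k (free_module k X) M \<pi> \<and>
        (\<forall>m\<in>carrier M. \<pi> (\<iota> m) = m))"

definition quotient_module :: "('a, 'm, 's) module_scheme \<Rightarrow> 'm set \<Rightarrow> ('a, 'm set) module" where
  "quotient_module M N =
     \<lparr>carrier = a_rcosets\<^bsub>M\<^esub> N, mult = undefined, one = undefined, zero = N, add = set_add M,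
      smult = (\<lambda>c A. \<Union>a\<in>A. N +>\<^bsub>M\<^esub> (c \<odot>\<^bsub>M\<^esub> a))\<rparr>"

definition internal_direct_sum :: "('a, 'm, 's) module_scheme \<Rightarrow> 'm set \<Rightarrow> 'm set \<Rightarrow> bool" where
  "internal_direct_sum M A B \<longleftrightarrow> carrier M = A <+>\<^bsub>M\<^esub> B \<and> A \<inter> B = {\<zero>\<^bsub>M\<^esub>}"


section \<open>Small preadditive categories over a commutative ring\<close>

text \<open>
  \<open>cmp C x y z g f\<close> is the composite of \<open>f : x \<rightarrow> y\<close> followed by \<open>g : y \<rightarrow> z\<close>. Composition is
  indexed by the objects because hom modules for different pairs of objects need not be disjoint;
  for the same reason functors act on morphisms together with their source and target.
\<close>

record ('o, 'm, 'a) linear_category =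
  objects :: "'o set"
  homs :: "'o \<Rightarrow> 'o \<Rightarrow> ('a, 'm) module"
  cmp :: "'o \<Rightarrow> 'o \<Rightarrow> 'o \<Rightarrow> 'm \<Rightarrow> 'm \<Rightarrow> 'm"
  ident :: "'o \<Rightarrow> 'm"

definition mor :: "('o, 'm, 'a) linear_category \<Rightarrow> 'o \<Rightarrow> 'o \<Rightarrow> 'm set" where
  "mor C x y = carrier (homs C x y)"

locale preadditive_category =
  fixes k :: "('a, 'r) ring_scheme" and C :: "('o, 'm, 'a) linear_category"
  assumes hom_module:
      "\<lbrakk>x \<in> objects C; y \<in> objects C\<rbrakk> \<Longrightarrow> Module.module k (homs C x y)"
    and cmp_linear_left:
      "\<lbrakk>x \<in> objects C; y \<in> objects C; z \<in> objects C; f \<in> mor C x y\<rbrakk> \<Longrightarrow>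
         linear_map k (homs C y z) (homs C x z) (\<lambda>g. cmp C x y z g f)"
    and cmp_linear_right:
      "\<lbrakk>x \<in> objects C; y \<in> objects C; z \<in> objects C; g \<in> mor C y z\<rbrakk> \<Longrightarrow>
         linear_map k (homs C x y) (homs C x z) (\<lambda>f. cmp C x y z g f)"
    and cmp_assoc:
      "\<lbrakk>w \<in> objects C; x \<in> objects C; y \<in> objects C; z \<in> objects C;
        f \<in> mor C w x; g \<in> mor C x y; h \<in> mor C y z\<rbrakk> \<Longrightarrow>
         cmp C w y z h (cmp C w x y g f) = cmp C w x z (cmp C x y z h g) f"
    and ident_mor: "x \<in> objects C \<Longrightarrow> ident C x \<in> mor C x x"
    and cmp_ident_right:
      "\<lbrakk>x \<in> objects C; y \<in> objects C; f \<in> mor C x y\<rbrakk> \<Longrightarrow> cmp C x x y f (ident C x) = f"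
    and cmp_ident_left:
      "\<lbrakk>x \<in> objects C; y \<in> objects C; f \<in> mor C x y\<rbrakk> \<Longrightarrow> cmp C x y y (ident C y) f = f"

definition hom_finite :: "('a, 'r) ring_scheme \<Rightarrow> ('o, 'm, 'a) linear_category \<Rightarrow> bool" where
  "hom_finite k C \<longleftrightarrow>
     (\<forall>x\<in>objects C. \<forall>y\<in>objects C.
        finitely_generated k (homs C x y) \<and> projective k (homs C x y))"

definition locally_bounded :: "('o, 'm, 'a) linear_category \<Rightarrow> bool" where
  "locally_bounded C \<longleftrightarrow>
     (\<forall>y\<in>objects C.
        finite {x \<in> objects C. \<not> zero_module (homs C x y)} \<and>
        finite {z \<in> objects C. \<not> zero_module (homs C y z)})"


subsection \<open>Linear functors and Serre functors\<close>

record ('o, 'm, 'p, 'l) functor_data =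
  on_ob :: "'o \<Rightarrow> 'p"
  on_mor :: "'o \<Rightarrow> 'o \<Rightarrow> 'm \<Rightarrow> 'l"

definition linear_functor ::
  "('a, 'r) ring_scheme \<Rightarrow> ('o, 'm, 'a) linear_category \<Rightarrow> ('p, 'l, 'a) linear_category \<Rightarrow>
   ('o, 'm, 'p, 'l) functor_data \<Rightarrow> bool" where
  "linear_functor k C D F \<longleftrightarrow>
     on_ob F \<in> objects C \<rightarrow> objects D \<and>
     (\<forall>x\<in>objects C. \<forall>y\<in>objects C.
        linear_map k (homs C x y) (homs D (on_ob F x) (on_ob F y)) (on_mor F x y)) \<and>
     (\<forall>x\<in>objects C. on_mor F x x (ident C x) = ident D (on_ob F x)) \<and>
     (\<forall>x\<in>objects C. \<forall>y\<in>objects C. \<forall>z\<in>objects C. \<forall>f\<in>mor C x y. \<forall>g\<in>mor C y z.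
        on_mor F x z (cmp C x y z g f) =
        cmp D (on_ob F x) (on_ob F y) (on_ob F z) (on_mor F y z g) (on_mor F x y f))"

definition id_functor :: "('o, 'm, 'o, 'm) functor_data" where
  "id_functor = \<lparr>on_ob = (\<lambda>x. x), on_mor = (\<lambda>x y f. f)\<rparr>"

definition comp_functor ::
  "('p, 'l, 'q, 'n) functor_data \<Rightarrow> ('o, 'm, 'p, 'l) functor_data \<Rightarrow> ('o, 'm, 'q, 'n) functor_data" where
  "comp_functor G F =
     \<lparr>on_ob = (\<lambda>x. on_ob G (on_ob F x)),
      on_mor = (\<lambda>x y f. on_mor G (on_ob F x) (on_ob F y) (on_mor F x y f))\<rparr>"

definition iso_mor :: "('o, 'm, 'a) linear_category \<Rightarrow> 'o \<Rightarrow> 'o \<Rightarrow> 'm \<Rightarrow> bool" where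
  "iso_mor C x y f \<longleftrightarrow> f \<in> mor C x y \<and>
     (\<exists>g\<in>mor C y x. cmp C x y x g f = ident C x \<and> cmp C y x y f g = ident C y)"

definition naturally_isomorphic ::
  "('o, 'm, 'a) linear_category \<Rightarrow> ('p, 'l, 'a) linear_category \<Rightarrow>
   ('o, 'm, 'p, 'l) functor_data \<Rightarrow> ('o, 'm, 'p, 'l) functor_data \<Rightarrow> bool" where
  "naturally_isomorphic C D F G \<longleftrightarrow>
     (\<exists>\<tau>. (\<forall>x\<in>objects C. iso_mor D (on_ob F x) (on_ob G x) (\<tau> x)) \<and>
          (\<forall>x\<in>objects C. \<forall>y\<in>objects C. \<forall>f\<in>mor C x y.
             cmp D (on_ob F x) (on_ob F y) (on_ob G y) (\<tau> y) (on_mor F x y f) =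
             cmp D (on_ob F x) (on_ob G x) (on_ob G y) (on_mor G x y f) (\<tau> x)))"

definition linear_equivalence ::
  "('a, 'r) ring_scheme \<Rightarrow> ('o, 'm, 'a) linear_category \<Rightarrow> ('p, 'l, 'a) linear_category \<Rightarrow>
   ('o, 'm, 'p, 'l) functor_data \<Rightarrow> bool" where
  "linear_equivalence k C D F \<longleftrightarrow> linear_functor k C D F \<and>
     (\<exists>G. linear_functor k D C G \<and>
          naturally_isomorphic C C id_functor (comp_functor G F) \<and>
          naturally_isomorphic D D (comp_functor F G) id_functor)"

text \<open>
  The last two conjuncts are naturality of \<open>\<eta>\<close> in the contravariant variable \<open>x\<close> and in the
  covariant variable \<open>y\<close>, evaluated at an element \<open>g\<close> of \<open>C(y, S x')\<close> and \<open>C(y', S x)\<close>.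
\<close>

definition serre_functor ::
  "('a, 'r) ring_scheme \<Rightarrow> ('o, 'm, 'a) linear_category \<Rightarrow> ('o, 'm, 'o, 'm) functor_data \<Rightarrow> bool" where
  "serre_functor k C S \<longleftrightarrow> linear_equivalence k C C S \<and>
     (\<exists>\<eta>. (\<forall>x\<in>objects C. \<forall>y\<in>objects C.
             linear_iso k (homs C x y) (dual_module k (homs C y (on_ob S x))) (\<eta> x y)) \<and>
          (\<forall>x'\<in>objects C. \<forall>x\<in>objects C. \<forall>y\<in>objects C.
             \<forall>f\<in>mor C x' x. \<forall>u\<in>mor C x y. \<forall>g\<in>mor C y (on_ob S x').
             \<eta> x' y (cmp C x' x y u f) g =
             \<eta> x y u (cmp C y (on_ob S x') (on_ob S x) (on_mor S x' x f) g)) \<and>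
          (\<forall>x\<in>objects C. \<forall>y\<in>objects C. \<forall>y'\<in>objects C.
             \<forall>h\<in>mor C y y'. \<forall>u\<in>mor C x y. \<forall>g\<in>mor C y' (on_ob S x).
             \<eta> x y' (cmp C x y y' h u) g =
             \<eta> x y u (cmp C y y' (on_ob S x) g h)))"


subsection \<open>Ideals and quotients\<close>

definition cat_ideal ::
  "('a, 'r) ring_scheme \<Rightarrow> ('o, 'm, 'a) linear_category \<Rightarrow> ('o \<Rightarrow> 'o \<Rightarrow> 'm set) \<Rightarrow> bool" where
  "cat_ideal k C J \<longleftrightarrow>
     (\<forall>x\<in>objects C. \<forall>y\<in>objects C. submodule (J x y) k (homs C x y)) \<and>
     (\<forall>x\<in>objects C. \<forall>y\<in>objects C. \<forall>z\<in>objects C.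
        (\<forall>f\<in>J x y. \<forall>g\<in>mor C y z. cmp C x y z g f \<in> J x z) \<and>
        (\<forall>f\<in>mor C x y. \<forall>g\<in>J y z. cmp C x y z g f \<in> J x z))"

definition generated_ideal ::
  "('a, 'r) ring_scheme \<Rightarrow> ('o, 'm, 'a) linear_category \<Rightarrow> ('o \<Rightarrow> 'o \<Rightarrow> 'm set) \<Rightarrow> 'o \<Rightarrow> 'o \<Rightarrow> 'm set"
  where
  "generated_ideal k C S x y =
     \<Inter>{J x y | J. cat_ideal k C J \<and> (\<forall>u\<in>objects C. \<forall>v\<in>objects C. S u v \<subseteq> J u v)}"

definition ideal_prod ::
  "('a, 'r) ring_scheme \<Rightarrow> ('o, 'm, 'a) linear_category \<Rightarrow> ('o \<Rightarrow> 'o \<Rightarrow> 'm set) \<Rightarrow> ('o \<Rightarrow> 'o \<Rightarrow> 'm set) \<Rightarrow>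
   'o \<Rightarrow> 'o \<Rightarrow> 'm set" where
  "ideal_prod k C I J x z =
     module_span k (homs C x z) {cmp C x y z g f | y g f. y \<in> objects C \<and> g \<in> I y z \<and> f \<in> J x y}"

primrec ideal_power ::
  "('a, 'r) ring_scheme \<Rightarrow> ('o, 'm, 'a) linear_category \<Rightarrow> ('o \<Rightarrow> 'o \<Rightarrow> 'm set) \<Rightarrow> nat \<Rightarrow>
   'o \<Rightarrow> 'o \<Rightarrow> 'm set" where
  "ideal_power k C I 0 = mor C"
| "ideal_power k C I (Suc m) = ideal_prod k C I (ideal_power k C I m)"

definition quotient_category ::
  "('o, 'm, 'a) linear_category \<Rightarrow> ('o \<Rightarrow> 'o \<Rightarrow> 'm set) \<Rightarrow> ('o, 'm set, 'a) linear_category" where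
  "quotient_category C J =
     \<lparr>objects = objects C,
      homs = (\<lambda>x y. quotient_module (homs C x y) (J x y)),
      cmp = (\<lambda>x y z G F. \<Union>g\<in>G. \<Union>f\<in>F. J x z +>\<^bsub>homs C x z\<^esub> cmp C x y z g f),
      ident = (\<lambda>x. J x x +>\<^bsub>homs C x x\<^esub> ident C x)\<rparr>"


subsection \<open>The Strong Retraction Property\<close>

definition retraction_complement ::
  "('a, 'r) ring_scheme \<Rightarrow> ('o, 'm, 'a) linear_category \<Rightarrow> ('o \<Rightarrow> 'm set) \<Rightarrow> bool" where
  "retraction_complement k C \<rho> \<longleftrightarrow>
     (\<forall>x\<in>objects C.
        submodule (\<rho> x) k (homs C x x) \<and>
        internal_direct_sum (homs C x x) {c \<odot>\<^bsub>homs C x x\<^esub> ident C x | c. c \<in> carrier k} (\<rho> x) \<and>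
        (\<forall>f\<in>\<rho> x. \<forall>g\<in>\<rho> x. cmp C x x x g f \<in> \<rho> x) \<and>
        (\<forall>y\<in>objects C. x \<noteq> y \<longrightarrow> (\<forall>f\<in>mor C x y. \<forall>g\<in>mor C y x. cmp C x y x g f \<in> \<rho> x)))"

definition strong_retraction_property ::
  "('a, 'r) ring_scheme \<Rightarrow> ('o, 'm, 'a) linear_category \<Rightarrow> bool" where
  "strong_retraction_property k C \<longleftrightarrow>
     (\<forall>x\<in>objects C. \<exists>r. linear_map k (homs C x x) (regular_module k) r \<and>
        (\<forall>c\<in>carrier k. r (c \<odot>\<^bsub>homs C x x\<^esub> ident C x) = c)) \<and>
     (\<exists>\<rho>. retraction_complement k C \<rho>)"

definition pseudo_radical ::
  "('o, 'm, 'a) linear_category \<Rightarrow> ('o \<Rightarrow> 'm set) \<Rightarrow> 'o \<Rightarrow> 'o \<Rightarrow> 'm set" where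
  "pseudo_radical C \<rho> x y = (if x = y then \<rho> x else mor C x y)"


section \<open>Path categories\<close>

text \<open>
  Paths are arc walks, that is, lists of arrows in the order in which they are travelled; the
  composite of paths \<open>t \<circ> s\<close> (first \<open>s\<close>, then \<open>t\<close>) is thus \<open>s @ t\<close>. Composition in the path
  category is the bilinear extension of this: the coefficient of \<open>g \<circ> f\<close> at \<open>p\<close> is the sum of
  \<open>g t \<cdot> f s\<close> over all decompositions \<open>p = s @ t\<close>.
\<close>

definition path_category ::
  "('a, 'r) ring_scheme \<Rightarrow> ('v, 'e) pre_digraph \<Rightarrow> ('v, 'e list \<Rightarrow> 'a, 'a) linear_category" where
  "path_category k G =
     \<lparr>objects = verts G,
      homs = (\<lambda>x y. free_module k {p. pre_digraph.awalk G x p y}),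
      cmp = (\<lambda>x y z g f p. \<Oplus>\<^bsub>k\<^esub>i\<in>{..length p}. g (drop i p) \<otimes>\<^bsub>k\<^esub> f (take i p)),
      ident = (\<lambda>x. basis_elem k [])\<rparr>"


section \<open>The mesh category of the repetitive quiver of a linearly oriented quiver of type A\<close>

text \<open>\<open>Arr q i\<close> stands for $a_{q,i}$ and \<open>Arr_star q i\<close> for $a^*_{q,i}$.\<close>

datatype rep_arrow = Arr nat int | Arr_star nat int

definition rep_quiver :: "nat \<Rightarrow> (nat \<times> int, rep_arrow) pre_digraph" where
  "rep_quiver n =
     \<lparr>verts = {(q, i). 1 \<le> q \<and> q \<le> n},
      arcs = {Arr q i | q i. 1 \<le> q \<and> q < n} \<union> {Arr_star q i | q i. 1 \<le> q \<and> q < n},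
      tail = (\<lambda>e. case e of Arr q i \<Rightarrow> (q, i) | Arr_star q i \<Rightarrow> (q + 1, i)),
      head = (\<lambda>e. case e of Arr q i \<Rightarrow> (q + 1, i) | Arr_star q i \<Rightarrow> (q, i - 1))\<rparr>"

definition rep_path_category ::
  "nat \<Rightarrow> ('a, 'r) ring_scheme \<Rightarrow> (nat \<times> int, rep_arrow list \<Rightarrow> 'a, 'a) linear_category" where
  "rep_path_category n k = path_category k (rep_quiver n)"

text \<open>The mesh relation at \<open>(q, i)\<close> is a morphism from \<open>(q, i + 1)\<close> to \<open>(q, i)\<close>.\<close>

definition mesh_relation :: "nat \<Rightarrow> ('a, 'r) ring_scheme \<Rightarrow> nat \<Rightarrow> int \<Rightarrow> (rep_arrow list \<Rightarrow> 'a)" where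
  "mesh_relation n k q i =
     (if q = 1 then basis_elem k [Arr 1 (i + 1), Arr_star 1 (i + 1)]
      else if q = n then basis_elem k [Arr_star (n - 1) (i + 1), Arr (n - 1) i]
      else basis_elem k [Arr_star (q - 1) (i + 1), Arr (q - 1) i]
           \<oplus>\<^bsub>homs (rep_path_category n k) (q, i + 1) (q, i)\<^esub>
           basis_elem k [Arr q (i + 1), Arr_star q (i + 1)])"

definition mesh_relations ::
  "nat \<Rightarrow> ('a, 'r) ring_scheme \<Rightarrow> nat \<times> int \<Rightarrow> nat \<times> int \<Rightarrow> (rep_arrow list \<Rightarrow> 'a) set" where
  "mesh_relations n k x y =
     {mesh_relation n k q i | q i. 1 \<le> q \<and> q \<le> n \<and> x = (q, i + 1) \<and> y = (q, i)}"

definition mesh_ideal ::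
  "nat \<Rightarrow> ('a, 'r) ring_scheme \<Rightarrow> nat \<times> int \<Rightarrow> nat \<times> int \<Rightarrow> (rep_arrow list \<Rightarrow> 'a) set" where
  "mesh_ideal n k = generated_ideal k (rep_path_category n k) (mesh_relations n k)"

definition mesh_category ::
  "nat \<Rightarrow> ('a, 'r) ring_scheme \<Rightarrow> (nat \<times> int, (rep_arrow list \<Rightarrow> 'a) set, 'a) linear_category" where
  "mesh_category n k = quotient_category (rep_path_category n k) (mesh_ideal n k)"

text \<open>The class in the mesh category of the path consisting of the single arrow \<open>e\<close>.\<close>

definition arrow_mor :: "nat \<Rightarrow> ('a, 'r) ring_scheme \<Rightarrow> rep_arrow \<Rightarrow> (rep_arrow list \<Rightarrow> 'a) set" where
  "arrow_mor n k e =
     (let x = tail (rep_quiver n) e; y = head (rep_quiver n) e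
      in mesh_ideal n k x y +>\<^bsub>homs (rep_path_category n k) x y\<^esub> basis_elem k [e])"

definition arrow_ideal ::
  "nat \<Rightarrow> ('a, 'r) ring_scheme \<Rightarrow> nat \<times> int \<Rightarrow> nat \<times> int \<Rightarrow> (rep_arrow list \<Rightarrow> 'a) set set" where
  "arrow_ideal n k =
     generated_ideal k (mesh_category n k)
       (\<lambda>x y. {arrow_mor n k e | e. e \<in> arcs (rep_quiver n) \<and>
                 tail (rep_quiver n) e = x \<and> head (rep_quiver n) e = y})"

text \<open>
  The drawing of the repetitive quiver: the position of \<open>(q, i)\<close> is chosen such that every
  $a_{q,i}$ is the vector \<open>(1, -1)\<close> and every $a^*_{q,i}$ the vector \<open>(1, 1)\<close>.
\<close>

definition position :: "nat \<times> int \<Rightarrow> real \<times> real" where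
  "position = (\<lambda>(q, i). (real q - 2 * real_of_int i, - real q))"

lemma position_arrows:
  assumes "e \<in> arcs (rep_quiver n)"
  shows "position (head (rep_quiver n) e) - position (tail (rep_quiver n) e) =
           (case e of Arr q i \<Rightarrow> (1, -1) | Arr_star q i \<Rightarrow> (1, 1))"
  by (simp add: rep_quiver_def position_def split: rep_arrow.split)

definition rectangle :: "nat \<Rightarrow> nat \<Rightarrow> int \<Rightarrow> (real \<times> real) set" where
  "rectangle n p i =
     convex hull (position ` {(p, i), (1, i + 1 - int p), (n, i), (n + 1 - p, i + 1 - int p)})"

text \<open>
  The prescription for the Serre functor on objects and on arrows. In \<open>Arr (n - q) _\<close> and
  \<open>n + 1 - q\<close> the truncated subtraction is harmless as \<open>q \<le> n\<close>.
\<close>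

definition serre_prescription ::
  "nat \<Rightarrow> ('a, 'r) ring_scheme \<Rightarrow>
   (nat \<times> int, (rep_arrow list \<Rightarrow> 'a) set, nat \<times> int, (rep_arrow list \<Rightarrow> 'a) set) functor_data \<Rightarrow> bool"
  where
  "serre_prescription n k S \<longleftrightarrow>
     (\<forall>q i. 1 \<le> q \<and> q \<le> n \<longrightarrow> on_ob S (q, i) = (n + 1 - q, i + 1 - int q)) \<and>
     (\<forall>q i. 1 \<le> q \<and> q < n \<longrightarrow>
        on_mor S (q, i) (q + 1, i) (arrow_mor n k (Arr q i)) =
          ((\<ominus>\<^bsub>k\<^esub> \<one>\<^bsub>k\<^esub>) [^]\<^bsub>k\<^esub> q)
            \<odot>\<^bsub>homs (mesh_category n k) (n + 1 - q, i + 1 - int q) (n - q, i - int q)\<^esub>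
          arrow_mor n k (Arr_star (n - q) (i + 1 - int q)) \<and>
        on_mor S (q + 1, i) (q, i - 1) (arrow_mor n k (Arr_star q i)) =
          ((\<ominus>\<^bsub>k\<^esub> \<one>\<^bsub>k\<^esub>) [^]\<^bsub>k\<^esub> (n - q))
            \<odot>\<^bsub>homs (mesh_category n k) (n - q, i - int q) (n + 1 - q, i - int q)\<^esub>
          arrow_mor n k (Arr (n - q) (i - int q)))"

end

theory Submission
  imports Defs
begin

text \<open>
  A path with \<open>a\<close> arrows $a^*$ and \<open>b\<close> arrows $a$ that starts at \<open>(p, i)\<close> has an endpoint determined
  by \<open>a\<close> and \<open>b\<close>, and this endpoint lies in $R_{p,i}$ iff \<open>0 \<le> a \<le> p - 1\<close> and \<open>0 \<le> b \<le> n - p\<close>. The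
  mesh relations in the interior exchange neighbouring $a$ and $a^*$ at the cost of a sign, so that
  parallel paths agree up to the parity of their inversions; a path that leaves the rectangle can be
  moved into one of the two monomial relations at the boundary. Hence the mesh ideal is the kernel of
  the map that sums the coefficients of the paths with these signs inside the rectangle and vanishes
  outside, and $Q$ is the category with homs \<open>k\<close> or \<open>0\<close> in which the composite of the generators with
  counts \<open>(a, b)\<close> and then \<open>(a', b')\<close> is \<open>(-1) ^ (a b')\<close> times a generator. The Serre functor
  exchanges the two counts, and pairing with the far vertex of the rectangle yields the duality.
\<close>

section \<open>Modules\<close>

text \<open>The ring is arbitrary, so dimensions cannot be counted and 2 may be zero; each quotient
  is therefore controlled by one explicit linear functional. A grading makes this possible: both
  arrow counts are fixed by the endpoints, so parallel paths have equal length and a path splits at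
  a prescribed intermediate vertex in one place only. The exponent a b' counts the inversions
  created between the two halves of a concatenation; it is additive in each argument, which is the
  cocycle condition behind associativity. Naturality of the duality amounts to linear forms t_x on
  Q(x, S x) with t_x(g f) = t_y(S(f) g) for f from x to y and g from y to S x. Once the forms are
  chosen, this equation dictates the sign of S on every morphism. With all forms positive, each
  plain arrow would go to a starred arrow with coefficient +1. Rescaling the forms by signs whose
  consecutive quotients are (-1)^q yields the prescribed coefficients, and the parities of the
  triangular numbers are such signs.\<close>

lemma quotient_module_simps:
  "carrier (quotient_module M N) = a_rcosets\<^bsub>M\<^esub> N"
  "\<zero>\<^bsub>quotient_module M N\<^esub> = N"
  "A \<oplus>\<^bsub>quotient_module M N\<^esub> B = A <+>\<^bsub>M\<^esub> B"
  "c \<odot>\<^bsub>quotient_module M N\<^esub> A = (\<Union>a\<in>A. N +>\<^bsub>M\<^esub> (c \<odot>\<^bsub>M\<^esub> a))"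
  by (simp_all add: quotient_module_def)

lemma linear_map_zero:
  assumes "module k M" "module k N" "linear_map k M N f"
  shows "f \<zero>\<^bsub>M\<^esub> = \<zero>\<^bsub>N\<^esub>"
proof -
  interpret M: module k M by (rule assms)
  interpret N: module k N by (rule assms)
  have "f (\<zero>\<^bsub>k\<^esub> \<odot>\<^bsub>M\<^esub> \<zero>\<^bsub>M\<^esub>) = \<zero>\<^bsub>k\<^esub> \<odot>\<^bsub>N\<^esub> f \<zero>\<^bsub>M\<^esub>" "f \<zero>\<^bsub>M\<^esub> \<in> carrier N"
    using assms(3) M.zero_closed by (auto simp: linear_map_def Pi_iff simp del: M.smult_l_null M.smult_r_null)
  then show ?thesis by simp
qed

lemma free_module_simps [simp]:
  "\<zero>\<^bsub>free_module k X\<^esub> = (\<lambda>p. \<zero>\<^bsub>k\<^esub>)"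
  "f \<oplus>\<^bsub>free_module k X\<^esub> g = (\<lambda>p. f p \<oplus>\<^bsub>k\<^esub> g p)"
  "c \<odot>\<^bsub>free_module k X\<^esub> f = (\<lambda>p. c \<otimes>\<^bsub>k\<^esub> f p)"
  by (simp_all add: free_module_def)

lemma free_module_carrier_iff:
  "f \<in> carrier (free_module k X) \<longleftrightarrow>
     (\<forall>p. f p \<in> carrier k) \<and> (\<forall>p. p \<notin> X \<longrightarrow> f p = \<zero>\<^bsub>k\<^esub>) \<and> finite {p. f p \<noteq> \<zero>\<^bsub>k\<^esub>}"
  by (auto simp: free_module_def)

lemma free_module_carrier_iff_finite:
  assumes "finite X"
  shows "f \<in> carrier (free_module k X) \<longleftrightarrow>
     (\<forall>p. f p \<in> carrier k) \<and> (\<forall>p. p \<notin> X \<longrightarrow> f p = \<zero>\<^bsub>k\<^esub>)"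
proof -
  have "finite {p. f p \<noteq> \<zero>\<^bsub>k\<^esub>}" if "\<forall>p. p \<notin> X \<longrightarrow> f p = \<zero>\<^bsub>k\<^esub>"
    by (rule finite_subset[OF _ assms]) (use that in blast)
  then show ?thesis
    by (auto simp: free_module_carrier_iff)
qed

lemma (in cring) free_module_is_module: "module R (free_module R X)"
proof (rule moduleI)
  show "cring R" by (rule cring_axioms)
  have plus: "(\<lambda>p. f p \<oplus> g p) \<in> carrier (free_module R X)"
    if "f \<in> carrier (free_module R X)" "g \<in> carrier (free_module R X)" for f g :: "'c \<Rightarrow> 'a"
  proof -
    have "{p. f p \<oplus> g p \<noteq> \<zero>} \<subseteq> {p. f p \<noteq> \<zero>} \<union> {p. g p \<noteq> \<zero>}" by auto
    then have "finite {p. f p \<oplus> g p \<noteq> \<zero>}"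
      by (rule finite_subset) (use that in \<open>auto simp: free_module_carrier_iff\<close>)
    then show ?thesis using that by (auto simp: free_module_carrier_iff)
  qed
  show smult: "c \<odot>\<^bsub>free_module R X\<^esub> f \<in> carrier (free_module R X)"
    if "c \<in> carrier R" "f \<in> carrier (free_module R X)" for c and f :: "'c \<Rightarrow> 'a"
  proof -
    have "{p. c \<otimes> f p \<noteq> \<zero>} \<subseteq> {p. f p \<noteq> \<zero>}" using that by auto
    then have "finite {p. c \<otimes> f p \<noteq> \<zero>}"
      by (rule finite_subset) (use that in \<open>auto simp: free_module_carrier_iff\<close>)
    then show ?thesis using that by (auto simp: free_module_carrier_iff)
  qed
  show "abelian_group (free_module R X)"
  proof (rule abelian_groupI)
    fix f assume f: "f \<in> carrier (free_module R X)"
    then have "(\<lambda>p. \<ominus> \<one> \<otimes> f p) \<in> carrier (free_module R X)" using smult[of "\<ominus> \<one>" f] by simp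
    moreover have "\<ominus> \<one> \<otimes> f p \<oplus> f p = \<zero>" for p
      using f by (simp add: free_module_carrier_iff l_minus l_neg)
    ultimately show "\<exists>g\<in>carrier (free_module R X). g \<oplus>\<^bsub>free_module R X\<^esub> f = \<zero>\<^bsub>free_module R X\<^esub>"
      by (intro bexI[of _ "\<lambda>p. \<ominus> \<one> \<otimes> f p"]) auto
  qed (simp_all add: plus, auto simp: free_module_carrier_iff a_ac)
qed (auto simp: free_module_carrier_iff l_distr r_distr m_assoc)

lemma (in module) submodule_lincomb:
  assumes "submodule N R M" "finite S" "\<And>s. s \<in> S \<Longrightarrow> c s \<in> carrier R" "\<And>s. s \<in> S \<Longrightarrow> h s \<in> N"
  shows "(\<Oplus>\<^bsub>M\<^esub>s\<in>S. c s \<odot>\<^bsub>M\<^esub> h s) \<in> N"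
  using assms(2-)
proof (induction S)
  case empty
  then show ?case using submoduleE(1,2)[OF assms(1)] assms(1)
    by (simp add: subgroup.one_closed[OF submodule.axioms(1), OF assms(1), simplified])
next
  case (insert s S)
  then show ?case
    using submoduleE(1,4,5)[OF assms(1)] by (subst finsum_insert) (auto simp: Pi_iff subset_iff)
qed

text \<open>Ideals are submodules in the abstract sense, while their elements are handled as
  functions on paths; this connects the two kinds of sums.\<close>

lemma (in cring) finsum_free_module:
  assumes "finite S" "\<And>s. s \<in> S \<Longrightarrow> h s \<in> carrier (free_module R X)"
  shows "finsum (free_module R X) h S = (\<lambda>p. \<Oplus>s\<in>S. h s p)"
  using assms
proof (induction S)
  interpret M: module R "free_module R X" by (rule free_module_is_module)
  case empty
  show ?case by simp
next
  interpret M: module R "free_module R X" by (rule free_module_is_module)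
  case (insert s S)
  then show ?case
    by (subst M.finsum_insert) (auto simp: Pi_iff free_module_carrier_iff)
qed

section \<open>Paths in the repetitive quiver\<close>

definition paths :: "nat \<Rightarrow> nat \<times> int \<Rightarrow> nat \<times> int \<Rightarrow> rep_arrow list set" where
  "paths n x y = {p. pre_digraph.awalk (rep_quiver n) x p y}"

text \<open>Every path from \<open>x\<close> to \<open>y\<close> consists of \<open>stars x y\<close> arrows $a^*$ and \<open>plains x y\<close> arrows $a$.\<close>

definition stars :: "nat \<times> int \<Rightarrow> nat \<times> int \<Rightarrow> int" where
  "stars x y = snd x - snd y"

text \<open>A plain arrow raises the first coordinate and a starred arrow lowers both, so the plain
  arrows number the gain in the first coordinate plus the starred ones. As integers, the counts make
  sense, possibly negative, also for vertices joined by no path.\<close>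

definition plains :: "nat \<times> int \<Rightarrow> nat \<times> int \<Rightarrow> int" where
  "plains x y = int (fst y) - int (fst x) + snd x - snd y"

text \<open>The bounds force \<open>x\<close> and \<open>y\<close> to be vertices, since
  \<open>fst y\<close> is \<open>fst x\<close> plus the plain count minus the starred count.\<close>

definition reach :: "nat \<Rightarrow> nat \<times> int \<Rightarrow> nat \<times> int \<Rightarrow> bool" where
  "reach n x y \<longleftrightarrow> 0 \<le> stars x y \<and> stars x y \<le> int (fst x) - 1 \<and>
                   0 \<le> plains x y \<and> plains x y \<le> int n - int (fst x)"

primrec is_star :: "rep_arrow \<Rightarrow> bool" where
  "is_star (Arr q i) = False"
| "is_star (Arr_star q i) = True"

text \<open>The inversion number of a word in two letters, the starred one being the larger;
  exchanging two different neighbours changes it by one.\<close>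

primrec inversions :: "rep_arrow list \<Rightarrow> nat" where
  "inversions [] = 0"
| "inversions (e # p) = (if is_star e then length (filter (Not \<circ> is_star) p) else 0) + inversions p"

abbreviation vertices :: "nat \<Rightarrow> (nat \<times> int) set" where
  "vertices n \<equiv> verts (rep_quiver n)"

lemma vertices_iff: "x \<in> vertices n \<longleftrightarrow> 1 \<le> fst x \<and> fst x \<le> n"
  by (auto simp: rep_quiver_def split: prod.splits)

lemma paths_Nil [simp]: "[] \<in> paths n x y \<longleftrightarrow> x = y \<and> x \<in> vertices n"
  by (auto simp: paths_def pre_digraph.awalk_def pre_digraph.cas.simps)

lemma paths_Arr:
  "Arr q i # p \<in> paths n x y \<longleftrightarrow> 1 \<le> q \<and> q < n \<and> x = (q, i) \<and> p \<in> paths n (q + 1, i) y"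
  by (auto simp: paths_def pre_digraph.awalk_def pre_digraph.cas.simps rep_quiver_def)

lemma paths_Arr_star:
  "Arr_star q i # p \<in> paths n x y \<longleftrightarrow> 1 \<le> q \<and> q < n \<and> x = (q + 1, i) \<and> p \<in> paths n (q, i - 1) y"
  by (auto simp: paths_def pre_digraph.awalk_def pre_digraph.cas.simps rep_quiver_def)

lemmas paths_simps = paths_Nil paths_Arr paths_Arr_star

lemma paths_start: "p \<in> paths n x y \<Longrightarrow> x \<in> vertices n"
  by (auto simp: paths_def pre_digraph.awalk_def)

lemma paths_end: "p \<in> paths n x y \<Longrightarrow> y \<in> vertices n"
proof (induction p arbitrary: x)
  case (Cons e p)
  then show ?case by (cases e) (auto simp: paths_simps)
qed simp

lemma paths_append: "p \<in> paths n x y \<Longrightarrow> r \<in> paths n y z \<Longrightarrow> p @ r \<in> paths n x z"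
proof (induction p arbitrary: x)
  case (Cons e p)
  then show ?case by (cases e) (auto simp: paths_simps)
qed simp

lemma paths_count:
  assumes "p \<in> paths n x y"
  shows "int (length (filter is_star p)) = stars x y"
    and "int (length (filter (Not \<circ> is_star) p)) = plains x y"
proof -
  have "int (length (filter is_star p)) = stars x y \<and>
        int (length (filter (Not \<circ> is_star) p)) = plains x y"
    using assms
  proof (induction p arbitrary: x)
    case (Cons e p)
    show ?case
    proof (cases e)
      case (Arr q i)
      with Cons.prems Cons.IH[of "(q + 1, i)"] show ?thesis
        by (simp add: paths_simps stars_def plains_def comp_def)
    next
      case (Arr_star q i)
      with Cons.prems Cons.IH[of "(q, i - 1)"] show ?thesis
        by (simp add: paths_simps stars_def plains_def comp_def)
    qed
  qed (simp add: stars_def plains_def)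
  then show "int (length (filter is_star p)) = stars x y"
    and "int (length (filter (Not \<circ> is_star) p)) = plains x y" by auto
qed

lemma paths_length:
  assumes "p \<in> paths n x y"
  shows "int (length p) = stars x y + plains x y"
  using paths_count[OF assms] sum_length_filter_compl[of is_star p] by (simp add: comp_def)

text \<open>At most one arrow of each kind leaves a vertex, so the start and the word of kinds
  determine a path, and the length of that word is fixed by the endpoints.\<close>

lemma finite_paths: "finite (paths n x y)"
proof (rule inj_on_finite)
  show "inj_on (map is_star) (paths n x y)"
  proof (rule inj_onI)
    fix p r
    show "p \<in> paths n x y \<Longrightarrow> r \<in> paths n x y \<Longrightarrow> map is_star p = map is_star r \<Longrightarrow> p = r"
    proof (induction p arbitrary: r x)
      case (Cons e p)
      then obtain e' r' where r: "r = e' # r'" by (cases r) auto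
      show ?case using Cons.prems Cons.IH[of _ r'] unfolding r
        by (cases e; cases e') (auto simp: paths_simps)
    qed auto
  qed
  show "map is_star ` paths n x y \<subseteq> {bs. set bs \<subseteq> UNIV \<and> length bs = nat (stars x y + plains x y)}"
    using paths_length by fastforce
  show "finite {bs :: bool list. set bs \<subseteq> UNIV \<and> length bs = nat (stars x y + plains x y)}"
    by (rule finite_lists_length_eq) simp
qed

text \<open>The new inversions pair a starred arrow of \<open>p\<close> with a plain arrow of
  \<open>r\<close>. This bilinear term is the source of all composition signs.\<close>

lemma inversions_append:
  assumes "p \<in> paths n x y" "r \<in> paths n y z"
  shows "int (inversions (p @ r)) = int (inversions p) + int (inversions r) + stars x y * plains y z"
  using assms(1)
proof (induction p arbitrary: x)
  case Nil
  then show ?case by (simp add: stars_def)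
next
  case (Cons e p)
  show ?case
  proof (cases e)
    case (Arr q i)
    with Cons show ?thesis by (auto simp: paths_simps stars_def)
  next
    case (Arr_star q i)
    with Cons have p: "p \<in> paths n (q, i - 1) y" and x: "x = (q + 1, i)" by (auto simp: paths_simps)
    have "stars x y = stars (q, i - 1) y + 1" using x by (simp add: stars_def)
    then show ?thesis
      using Cons.IH[OF p] Arr_star paths_count(2)[OF assms(2)] by (simp add: comp_def algebra_simps)
  qed
qed

lemma stars_plus: "stars x y + stars y z = stars x z"
  by (simp add: stars_def)

lemma plains_plus: "plains x y + plains y z = plains x z"
  by (simp add: plains_def)

text \<open>Seen from \<open>y\<close>, the bound on starred arrows is
  \<open>fst x - 1 - stars x y + plains x y\<close>, so it falls by no more than the count itself;
  the bound on plain arrows behaves in the same way.\<close>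

lemma reach_factor:
  assumes "reach n x z" "0 \<le> stars x y" "0 \<le> plains x y" "0 \<le> stars y z" "0 \<le> plains y z"
  shows "reach n x y" "reach n y z"
  using assms by (auto simp: reach_def stars_def plains_def)

lemma reach_refl: "x \<in> vertices n \<Longrightarrow> reach n x x"
  by (auto simp: reach_def stars_def plains_def vertices_iff)

lemma reach_loop: "reach n x y \<Longrightarrow> stars x y + plains x y = 0 \<Longrightarrow> x = y"
  by (auto simp: reach_def stars_def plains_def prod_eq_iff)

text \<open>A greedy path works: a plain arrow whenever one is left and the current vertex admits
  it, otherwise a starred arrow.\<close>

lemma paths_exist:
  assumes "2 \<le> n" "x \<in> vertices n" "y \<in> vertices n" "0 \<le> stars x y" "0 \<le> plains x y"
  shows "paths n x y \<noteq> {}"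
  using assms(2-)
proof (induction "nat (stars x y + plains x y)" arbitrary: x)
  case 0
  then have "x = y" by (auto simp: stars_def plains_def prod_eq_iff)
  then show ?case using 0 paths_Nil by blast
next
  case (Suc m)
  obtain p i where x: "x = (p, i)" by force
  show ?case
  proof (cases "p < n \<and> 0 < plains x y")
    case True
    then have "paths n (p + 1, i) y \<noteq> {}"
      using Suc by (intro Suc.hyps) (auto simp: x stars_def plains_def vertices_iff)
    then obtain w where "w \<in> paths n (p + 1, i) y" by blast
    then have "Arr p i # w \<in> paths n x y" using True Suc by (auto simp: paths_simps x vertices_iff)
    then show ?thesis by blast
  next
    case False
    \<comment> \<open>If \<open>p = n\<close>, then \<open>fst y \<le> n\<close> bounds the plain
      count by the starred count, which is thus positive. If no plain arrow is left, all remaining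
      arrows are starred, and \<open>1 \<le> fst y\<close> leaves room for one.\<close>
    then have p: "2 \<le> p" "0 < stars x y"
      using Suc assms(1) by (auto simp: x stars_def plains_def vertices_iff)
    have "paths n (p - 1, i - 1) y \<noteq> {}"
      using Suc p by (intro Suc.hyps) (auto simp: x stars_def plains_def vertices_iff of_nat_diff)
    then obtain w where "w \<in> paths n (p - 1, i - 1) y" by blast
    then have "Arr_star (p - 1) i # w \<in> paths n x y"
      using p Suc by (auto simp: paths_simps x vertices_iff)
    then show ?thesis by blast
  qed
qed

section \<open>The path category and its evaluation map\<close>

text \<open>Only the parity of an exponent matters; integer exponents let the counts enter directly,
  even where they may be negative.\<close>

definition parity_sign :: "('a, 'r) ring_scheme \<Rightarrow> int \<Rightarrow> 'a" where
  "parity_sign k m = (if even m then \<one>\<^bsub>k\<^esub> else \<ominus>\<^bsub>k\<^esub> \<one>\<^bsub>k\<^esub>)"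

context cring
begin

lemma parity_sign_closed [simp, intro]: "parity_sign R m \<in> carrier R"
  by (simp add: parity_sign_def)

lemma parity_sign_0 [simp]: "parity_sign R 0 = \<one>"
  by (simp add: parity_sign_def)

lemma parity_sign_add: "parity_sign R (m + l) = parity_sign R m \<otimes> parity_sign R l"
  by (auto simp: parity_sign_def l_minus r_minus)

lemma parity_sign_mult_self [simp]: "parity_sign R m \<otimes> parity_sign R m = \<one>"
  by (auto simp: parity_sign_def l_minus r_minus)

lemma parity_sign_cancel [simp]:
  "c \<in> carrier R \<Longrightarrow> parity_sign R m \<otimes> (parity_sign R m \<otimes> c) = c"
  by (simp flip: m_assoc)

lemma parity_sign_cong: "even (m + l) \<Longrightarrow> parity_sign R m = parity_sign R l"
  by (auto simp: parity_sign_def)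

lemma parity_sign_nat: "(\<ominus> \<one>) [^] m = parity_sign R (int m)"
  by (induction m) (auto simp: parity_sign_def l_minus r_minus)

end

locale mesh = cring k for k (structure) +
  fixes n :: nat
  assumes n_ge_2: "2 \<le> n" and one_neq_zero: "\<one> \<noteq> \<zero>"
begin

abbreviation P where "P \<equiv> rep_path_category n k"

lemma homs_P [simp]: "homs P x y = free_module k (paths n x y)"
  by (simp add: rep_path_category_def path_category_def paths_def)

lemma objects_P [simp]: "objects P = vertices n"
  by (simp add: rep_path_category_def path_category_def)

lemma mor_P_iff: "f \<in> mor P x y \<longleftrightarrow> (\<forall>p. f p \<in> carrier k) \<and> (\<forall>p. p \<notin> paths n x y \<longrightarrow> f p = \<zero>)"
  by (simp add: mor_def free_module_carrier_iff_finite finite_paths)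

lemma carrier_P: "carrier (free_module k (paths n x y)) = mor P x y"
  by (simp add: mor_def)

lemma mor_P_closed: "f \<in> mor P x y \<Longrightarrow> f p \<in> carrier k"
  by (simp add: mor_P_iff)

lemma mor_P_zero: "f \<in> mor P x y \<Longrightarrow> p \<notin> paths n x y \<Longrightarrow> f p = \<zero>"
  by (simp add: mor_P_iff)

lemma basis_mor: "p \<in> paths n x y \<Longrightarrow> basis_elem k p \<in> mor P x y"
  by (auto simp: mor_P_iff basis_elem_def)

lemma basis_closed [simp, intro]: "basis_elem k p r \<in> carrier k"
  by (simp add: basis_elem_def)

text \<open>Only one term of the composition sum can be nonzero, as all paths from \<open>x\<close> to \<open>y\<close> have the
  same length.\<close>

lemma cmp_P:
  assumes f: "f \<in> mor P x y" and g: "g \<in> mor P y z"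
  shows "cmp P x y z g f p =
    (if p \<in> paths n x z then g (drop (nat (stars x y + plains x y)) p) \<otimes>
                             f (take (nat (stars x y + plains x y)) p) else \<zero>)"
proof -
  define L where "L = nat (stars x y + plains x y)"
  let ?t = "\<lambda>i. g (drop i p) \<otimes> f (take i p)"
  have t: "?t i \<in> carrier k" for i using f g by (simp add: mor_P_closed)
  have zero: "?t i = \<zero>" if "i \<noteq> L \<and> i \<le> length p \<or> p \<notin> paths n x z" for i
  proof (rule ccontr)
    assume "?t i \<noteq> \<zero>"
    then have "f (take i p) \<noteq> \<zero>" "g (drop i p) \<noteq> \<zero>"
      using f g by (auto simp: mor_P_closed)
    then have "take i p \<in> paths n x y" "drop i p \<in> paths n y z"
      using f g mor_P_zero by blast+
    then have "p \<in> paths n x z" "int (length (take i p)) = stars x y + plains x y"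
      using paths_append[of "take i p" n x y "drop i p" z] paths_length[of "take i p" n x y] by auto
    then show False using that by (auto simp: L_def)
  qed
  have "(\<Oplus>i\<in>{..length p}. ?t i) = (if p \<in> paths n x z then ?t L else \<zero>)"
  proof (cases "p \<in> paths n x z \<and> L \<le> length p")
    case True
    then have "(\<Oplus>i\<in>{..length p}. ?t i) = (\<Oplus>i\<in>{..length p}. if L = i then ?t i else \<zero>)"
      using zero t by (intro finsum_cong') auto
    also have "\<dots> = ?t L"
      using True t by (intro add.finprod_singleton) auto
    finally show ?thesis using True by simp
  next
    case False
    \<comment> \<open>If \<open>L\<close> exceeds the length of \<open>p\<close>, then
      \<open>take L p\<close> is all of \<open>p\<close>, which is too short to be a path from
      \<open>x\<close> to \<open>y\<close>.\<close>
    have "?t L = \<zero>" if "p \<in> paths n x z"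
    proof -
      have "\<not> L \<le> length p" using that False by blast
      then have "take L p = p" "L \<noteq> length p" by auto
      then have "take L p \<notin> paths n x y" using paths_length[of p n x y] by (auto simp: L_def)
      then show ?thesis using f g by (simp add: mor_P_zero mor_P_closed)
    qed
    moreover have "(\<Oplus>i\<in>{..length p}. ?t i) = (\<Oplus>i\<in>{..length p}. \<zero>)"
      using False zero by (intro finsum_cong') auto
    ultimately show ?thesis by (simp)
  qed
  then show ?thesis
    by (simp add: rep_path_category_def path_category_def L_def)
qed

lemma cmp_P_append:
  assumes "f \<in> mor P x y" "g \<in> mor P y z" "s \<in> paths n x y" "t \<in> paths n y z"
  shows "cmp P x y z g f (s @ t) = g t \<otimes> f s"
proof -
  have "length s = nat (stars x y + plains x y)" using paths_length[OF assms(3)] by simp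
  then show ?thesis using assms by (simp add: cmp_P paths_append)
qed

lemma cmp_P_zero:
  assumes "f \<in> mor P x y" "g \<in> mor P y z"
    "\<And>s t. s \<in> paths n x y \<Longrightarrow> t \<in> paths n y z \<Longrightarrow> p \<noteq> s @ t"
  shows "cmp P x y z g f p = \<zero>"
proof -
  let ?L = "nat (stars x y + plains x y)"
  have "take ?L p \<notin> paths n x y \<or> drop ?L p \<notin> paths n y z"
    using assms(3)[of "take ?L p" "drop ?L p"] append_take_drop_id[of ?L p] by metis
  then have "f (take ?L p) = \<zero> \<or> g (drop ?L p) = \<zero>"
    using assms(1,2) mor_P_zero by blast
  then show ?thesis using assms(1,2) by (auto simp: cmp_P mor_P_closed)
qed

lemma cmp_P_mor:
  assumes "f \<in> mor P x y" "g \<in> mor P y z"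
  shows "cmp P x y z g f \<in> mor P x z"
  using assms by (simp add: mor_P_iff[of _ x z] cmp_P mor_P_closed)

lemma cmp_P_basis:
  assumes "s \<in> paths n x y" "t \<in> paths n y z"
  shows "cmp P x y z (basis_elem k t) (basis_elem k s) = basis_elem k (s @ t)"
proof
  fix p
  note m = basis_mor[OF assms(1)] basis_mor[OF assms(2)]
  show "cmp P x y z (basis_elem k t) (basis_elem k s) p = basis_elem k (s @ t) p"
  proof (cases "\<exists>s' t'. s' \<in> paths n x y \<and> t' \<in> paths n y z \<and> p = s' @ t'")
    case True
    then obtain s' t' where p: "s' \<in> paths n x y" "t' \<in> paths n y z" "p = s' @ t'" by blast
    have "int (length s') = int (length s)" using paths_length p(1) assms(1) by metis
    then show ?thesis
      using cmp_P_append[OF m p(1,2)] p(3) by (auto simp: basis_elem_def)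
  next
    case False
    then show ?thesis using cmp_P_zero[OF m] assms by (auto simp: basis_elem_def)
  qed
qed

section \<open>Signed sums over parallel paths and their multiplicativity\<close>

definition path_sum :: "nat \<times> int \<Rightarrow> nat \<times> int \<Rightarrow> (rep_arrow list \<Rightarrow> 'a) \<Rightarrow> 'a" where
  "path_sum x y f = (\<Oplus>p\<in>paths n x y. parity_sign k (int (inversions p)) \<otimes> f p)"

text \<open>Modulo the mesh relations all paths from \<open>x\<close> to \<open>y\<close> agree up to the parity of their
  inversions, and they vanish unless \<open>y\<close> lies in the rectangle of \<open>x\<close>.\<close>

definition eval :: "nat \<times> int \<Rightarrow> nat \<times> int \<Rightarrow> (rep_arrow list \<Rightarrow> 'a) \<Rightarrow> 'a" where
  "eval x y f = (if reach n x y then path_sum x y f else \<zero>)"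

text \<open>The structure constant of composition: its sign is the number of inversions created by
  concatenation, and the value zero records that two steps inside their rectangles may compose to
  one outside.\<close>

definition coef :: "nat \<times> int \<Rightarrow> nat \<times> int \<Rightarrow> nat \<times> int \<Rightarrow> 'a" where
  "coef x y z = (if reach n x z then parity_sign k (stars x y * plains y z) else \<zero>)"

text \<open>The coordinates that morphisms from \<open>x\<close> to \<open>y\<close> will have in
  the mesh category.\<close>

definition scalars :: "nat \<times> int \<Rightarrow> nat \<times> int \<Rightarrow> 'a set" where
  "scalars x y = (if reach n x y then carrier k else {\<zero>})"

lemma coef_closed [simp, intro]: "coef x y z \<in> carrier k"
  by (simp add: coef_def)

lemma path_sum_closed: "f \<in> mor P x y \<Longrightarrow> path_sum x y f \<in> carrier k"
  by (auto simp: path_sum_def mor_P_closed)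

lemma eval_closed: "f \<in> mor P x y \<Longrightarrow> eval x y f \<in> carrier k"
  by (simp add: eval_def path_sum_closed)

lemma eval_scalars: "f \<in> mor P x y \<Longrightarrow> eval x y f \<in> scalars x y"
  by (simp add: eval_def path_sum_closed scalars_def)

lemma eval_add:
  assumes "f \<in> mor P x y" "g \<in> mor P x y"
  shows "eval x y (\<lambda>p. f p \<oplus> g p) = eval x y f \<oplus> eval x y g"
proof -
  have "path_sum x y (\<lambda>p. f p \<oplus> g p) =
      (\<Oplus>p\<in>paths n x y. parity_sign k (int (inversions p)) \<otimes> f p \<oplus>
                        parity_sign k (int (inversions p)) \<otimes> g p)"
    unfolding path_sum_def using assms by (intro finsum_cong') (auto simp: mor_P_closed r_distr)
  also have "\<dots> = path_sum x y f \<oplus> path_sum x y g"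
    unfolding path_sum_def using assms by (intro finsum_addf) (auto simp: mor_P_closed)
  finally show ?thesis by (simp add: eval_def)
qed

lemma eval_smult:
  assumes "c \<in> carrier k" "f \<in> mor P x y"
  shows "eval x y (\<lambda>p. c \<otimes> f p) = c \<otimes> eval x y f"
proof -
  have "path_sum x y (\<lambda>p. c \<otimes> f p) =
      (\<Oplus>p\<in>paths n x y. c \<otimes> (parity_sign k (int (inversions p)) \<otimes> f p))"
    unfolding path_sum_def using assms by (intro finsum_cong') (auto simp: mor_P_closed m_ac)
  also have "\<dots> = c \<otimes> path_sum x y f"
    unfolding path_sum_def using assms
    by (intro finsum_rdistr[symmetric]) (auto simp: mor_P_closed finite_paths)
  finally show ?thesis using assms by (simp add: eval_def)
qed

lemma eval_zero: "eval x y (\<lambda>p. \<zero>) = \<zero>"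
proof -
  have "path_sum x y (\<lambda>p. \<zero>) = (\<Oplus>p\<in>paths n x y. \<zero>)"
    unfolding path_sum_def by (intro finsum_cong') auto
  then show ?thesis by (simp add: eval_def)
qed

lemma eval_basis:
  assumes "p \<in> paths n x y" "reach n x y"
  shows "eval x y (basis_elem k p) = parity_sign k (int (inversions p))"
proof -
  have "path_sum x y (basis_elem k p) =
      (\<Oplus>r\<in>paths n x y. if p = r then parity_sign k (int (inversions r)) else \<zero>)"
    unfolding path_sum_def by (intro finsum_cong') (auto simp: basis_elem_def)
  also have "\<dots> = parity_sign k (int (inversions p))"
    using assms finite_paths by (intro add.finprod_singleton) auto
  finally show ?thesis using assms by (simp add: eval_def)
qed

text \<open>The composite is supported on the concatenations \<open>s @ t\<close>, and these are
  pairwise distinct because all \<open>s\<close> have the same length. The sum becomes a product of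
  sums, as the new inversions are the same for all pairs.\<close>

lemma path_sum_cmp:
  assumes f: "f \<in> mor P x y" and g: "g \<in> mor P y z"
  shows "path_sum x z (cmp P x y z g f) =
    parity_sign k (stars x y * plains y z) \<otimes> path_sum y z g \<otimes> path_sum x y f"
proof -
  let ?s = "\<lambda>p. parity_sign k (int (inversions p))"
  let ?h = "cmp P x y z g f"
  let ?c = "parity_sign k (stars x y * plains y z)"
  let ?A = "\<lambda>s. (@) s ` paths n y z"
  have closed: "?s p \<otimes> ?h p \<in> carrier k" for p
    using cmp_P_mor[OF f g] by (simp add: mor_P_closed)
  have "path_sum x z ?h = (\<Oplus>p\<in>(\<Union>s\<in>paths n x y. ?A s). ?s p \<otimes> ?h p)"
    unfolding path_sum_def
  proof (rule add.finprod_mono_neutral_cong_right)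
    show "?s p \<otimes> ?h p = \<zero>" if "p \<in> paths n x z - (\<Union>s\<in>paths n x y. ?A s)" for p
    proof -
      have "?h p = \<zero>" by (rule cmp_P_zero[OF f g]) (use that in auto)
      then show ?thesis by simp
    qed
  qed (auto simp: finite_paths closed intro: paths_append)
  also have "\<dots> = (\<Oplus>s\<in>paths n x y. \<Oplus>p\<in>?A s. ?s p \<otimes> ?h p)"
  proof (rule add.finprod_UN_disjoint)
    show "pairwise (\<lambda>i j. disjnt (?A i) (?A j)) (paths n x y)"
    proof (rule pairwiseI)
      fix s s' assume s: "s \<in> paths n x y" "s' \<in> paths n x y" "s \<noteq> s'"
      have "length s = length s'" using paths_length[OF s(1)] paths_length[OF s(2)] by simp
      then show "disjnt (?A s) (?A s')" using s(3) by (auto simp: disjnt_def)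
    qed
  qed (use finite_paths closed in auto)
  also have "\<dots> = (\<Oplus>s\<in>paths n x y. (?c \<otimes> path_sum y z g) \<otimes> (?s s \<otimes> f s))"
  proof (rule finsum_cong')
    fix s assume s: "s \<in> paths n x y"
    have "(\<Oplus>p\<in>?A s. ?s p \<otimes> ?h p) = (\<Oplus>t\<in>paths n y z. ?s (s @ t) \<otimes> ?h (s @ t))"
      using closed by (intro finsum_reindex) (auto simp: inj_on_def)
    also have "\<dots> = (\<Oplus>t\<in>paths n y z. (?c \<otimes> (?s s \<otimes> f s)) \<otimes> (?s t \<otimes> g t))"
    proof (rule finsum_cong')
      fix t assume t: "t \<in> paths n y z"
      have "?s (s @ t) = ?s s \<otimes> ?s t \<otimes> ?c"
        by (simp add: inversions_append[OF s t] parity_sign_add)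
      then show "?s (s @ t) \<otimes> ?h (s @ t) = (?c \<otimes> (?s s \<otimes> f s)) \<otimes> (?s t \<otimes> g t)"
        using f g by (simp add: cmp_P_append[OF f g s t] mor_P_closed m_ac)
    qed (use f g in \<open>auto simp: mor_P_closed\<close>)
    also have "\<dots> = (?c \<otimes> (?s s \<otimes> f s)) \<otimes> path_sum y z g"
      unfolding path_sum_def using f g
      by (intro finsum_rdistr[symmetric]) (auto simp: mor_P_closed finite_paths)
    finally show "(\<Oplus>p\<in>?A s. ?s p \<otimes> ?h p) = (?c \<otimes> path_sum y z g) \<otimes> (?s s \<otimes> f s)"
      using f path_sum_closed[OF g] by (simp add: mor_P_closed m_ac)
  qed (use f path_sum_closed[OF g] in \<open>auto simp: mor_P_closed\<close>)
  also have "\<dots> = (?c \<otimes> path_sum y z g) \<otimes> path_sum x y f"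
    unfolding path_sum_def[of x y] using f path_sum_closed[OF g]
    by (intro finsum_rdistr[symmetric]) (auto simp: mor_P_closed finite_paths)
  finally show ?thesis .
qed

lemma eval_cmp:
  assumes f: "f \<in> mor P x y" and g: "g \<in> mor P y z"
  shows "eval x z (cmp P x y z g f) = coef x y z \<otimes> eval y z g \<otimes> eval x y f"
proof (cases "reach n x z")
  case True
  \<comment> \<open>If one leg has no path, both sides vanish. Otherwise all four counts are
    nonnegative, and both legs inherit the rectangle condition from
    \<open>reach n x z\<close>.\<close>
  have "path_sum y z g \<otimes> path_sum x y f = eval y z g \<otimes> eval x y f"
  proof (cases "paths n x y = {} \<or> paths n y z = {}")
    case True
    have "path_sum u v h = \<zero> \<and> eval u v h = \<zero>" if "paths n u v = {}" for u v h
      using that by (simp add: path_sum_def eval_def)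
    from True this[of x y f] this[of y z g] show ?thesis
      using eval_closed[OF f] eval_closed[OF g] path_sum_closed[OF f] path_sum_closed[OF g] by auto
  next
    case False
    then obtain s t where s: "s \<in> paths n x y" and t: "t \<in> paths n y z" by blast
    have "reach n x y" "reach n y z"
      using reach_factor[OF True, of y] paths_count[OF s] paths_count[OF t] by linarith+
    then show ?thesis by (simp add: eval_def)
  qed
  then show ?thesis
    using True path_sum_cmp[OF f g] f g by (simp add: eval_def[of x z] coef_def m_assoc path_sum_closed eval_closed)
next
  case False
  then show ?thesis using f g by (simp add: eval_def[of x z] coef_def eval_closed)
qed

end

section \<open>The mesh ideal is the kernel of the evaluation map\<close>

context mesh
begin

lemma module_P: "module k (free_module k (paths n x y))"
  by (rule free_module_is_module)

text \<open>A fibre of the evaluation map: the zero fibre turns out to be the mesh ideal, and the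
  other fibres its cosets.\<close>

definition cls :: "nat \<times> int \<Rightarrow> nat \<times> int \<Rightarrow> 'a \<Rightarrow> (rep_arrow list \<Rightarrow> 'a) set" where
  "cls x y c = {f \<in> mor P x y. eval x y f = c}"

lemma submodule_kernel: "submodule (cls x y \<zero>) k (homs P x y)"
proof -
  interpret M: module k "free_module k (paths n x y)" by (rule module_P)
  have minus: "\<ominus>\<^bsub>free_module k (paths n x y)\<^esub> f = (\<lambda>p. \<ominus> \<one> \<otimes> f p)"
    if "f \<in> mor P x y" for f
    using M.smult_l_minus[of \<one> f] M.smult_one[of f] that by (simp add: carrier_P)
  show ?thesis
    unfolding homs_P
  proof (rule M.submoduleI)
    show "a \<oplus>\<^bsub>free_module k (paths n x y)\<^esub> b \<in> cls x y \<zero>"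
      if "a \<in> cls x y \<zero>" "b \<in> cls x y \<zero>" for a b
      using that by (auto simp: cls_def eval_add) (auto simp: mor_P_iff)
    show smult: "a \<odot>\<^bsub>free_module k (paths n x y)\<^esub> b \<in> cls x y \<zero>"
      if "a \<in> carrier k" "b \<in> cls x y \<zero>" for a b
      using that by (auto simp: cls_def eval_smult) (auto simp: mor_P_iff)
    show "\<ominus>\<^bsub>free_module k (paths n x y)\<^esub> a \<in> cls x y \<zero>" if "a \<in> cls x y \<zero>" for a
      using that smult[of "\<ominus> \<one>" a] by (simp add: minus cls_def)
  qed (auto simp: cls_def carrier_P eval_zero mor_P_iff)
qed

text \<open>At \<open>q = 1\<close> and \<open>q = n\<close> the single path ends outside the
  rectangle, by one starred or one plain arrow too many. In the interior the two paths have one and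
  zero inversions, so their signs cancel.\<close>

lemma mesh_relation_kernel:
  assumes "1 \<le> q" "q \<le> n"
  shows "mesh_relation n k q i \<in> cls (q, i + 1) (q, i) \<zero>"
proof -
  consider "q = 1" | "q = n" "q \<noteq> 1" | "1 < q" "q < n" using assms by linarith
  then show ?thesis
  proof cases
    case 1
    have "[Arr 1 (i + 1), Arr_star 1 (i + 1)] \<in> paths n (q, i + 1) (q, i)"
      using 1 n_ge_2 by (simp add: paths_simps vertices_iff)
    moreover have "\<not> reach n (q, i + 1) (q, i)"
      using 1 by (simp add: reach_def stars_def)
    ultimately show ?thesis
      using 1 by (simp add: mesh_relation_def cls_def basis_mor eval_def)
  next
    case 2
    have "[Arr_star (n - 1) (i + 1), Arr (n - 1) i] \<in> paths n (q, i + 1) (q, i)"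
      using 2 n_ge_2 by (simp add: paths_simps vertices_iff)
    moreover have "\<not> reach n (q, i + 1) (q, i)"
      using 2 by (simp add: reach_def plains_def)
    ultimately show ?thesis
      using 2 by (simp add: mesh_relation_def cls_def basis_mor eval_def)
  next
    case 3
    let ?u = "[Arr_star (q - 1) (i + 1), Arr (q - 1) i]"
    let ?v = "[Arr q (i + 1), Arr_star q (i + 1)]"
    have p: "?u \<in> paths n (q, i + 1) (q, i)" "?v \<in> paths n (q, i + 1) (q, i)"
      using 3 by (auto simp add: paths_simps vertices_iff)
    have r: "reach n (q, i + 1) (q, i)"
      using 3 by (simp add: reach_def stars_def plains_def)
    have "eval (q, i + 1) (q, i) (\<lambda>p. basis_elem k ?u p \<oplus> basis_elem k ?v p) =
        parity_sign k 1 \<oplus> \<one>"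
      using eval_basis[OF p(1) r] eval_basis[OF p(2) r]
        eval_add[OF basis_mor[OF p(1)] basis_mor[OF p(2)]] by simp
    then show ?thesis
      using 3 basis_mor[OF p(1)] basis_mor[OF p(2)]
      by (simp add: mesh_relation_def cls_def parity_sign_def l_neg) (simp add: mor_P_iff)
  qed
qed

lemma kernel_ideal: "cat_ideal k P (\<lambda>x y. cls x y \<zero>)"
  unfolding cat_ideal_def
  using submodule_kernel by (auto simp: cls_def cmp_P_mor eval_cmp eval_closed)

text \<open>Conversely, an ideal containing the mesh relations contains the kernel: every path can be
  moved to every other parallel path by exchanging $a^* a$ and $a a^*$, and if there is a path from
  \<open>x\<close> to \<open>y\<close> outside the rectangle of \<open>x\<close>, then one of them runs into a boundary relation.\<close>

context
  fixes I
  assumes ideal: "cat_ideal k P I"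
    and mesh: "\<And>q i. 1 \<le> q \<Longrightarrow> q \<le> n \<Longrightarrow> mesh_relation n k q i \<in> I (q, i + 1) (q, i)"
begin

lemma ideal_submodule: "x \<in> vertices n \<Longrightarrow> y \<in> vertices n \<Longrightarrow> submodule (I x y) k (homs P x y)"
  using ideal by (simp add: cat_ideal_def)

lemma ideal_add:
  assumes "x \<in> vertices n" "y \<in> vertices n" "f \<in> I x y" "g \<in> I x y"
  shows "(\<lambda>p. f p \<oplus> g p) \<in> I x y"
  using module.submoduleE(5)[OF module_P ideal_submodule[OF assms(1,2), unfolded homs_P] assms(3,4)]
  by simp

lemma ideal_zero:
  assumes "x \<in> vertices n" "y \<in> vertices n"
  shows "(\<lambda>p. \<zero>) \<in> I x y"
  using subgroup.one_closed[OF submodule.axioms(1)[OF ideal_submodule[OF assms]]] by simp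

lemma ideal_smult:
  assumes "x \<in> vertices n" "y \<in> vertices n" "f \<in> I x y" "c \<in> carrier k"
  shows "(\<lambda>p. c \<otimes> f p) \<in> I x y"
  using module.submoduleE(4)[OF module_P ideal_submodule[OF assms(1,2), unfolded homs_P] assms(4,3)]
  by simp

lemma ideal_mor: "x \<in> vertices n \<Longrightarrow> y \<in> vertices n \<Longrightarrow> f \<in> I x y \<Longrightarrow> f \<in> mor P x y"
  using module.submoduleE(1)[OF module_P ideal_submodule[unfolded homs_P]] carrier_P by blast

lemma ideal_cmp:
  assumes "x \<in> vertices n" "y \<in> vertices n" "z \<in> vertices n"
  shows "f \<in> I x y \<Longrightarrow> g \<in> mor P y z \<Longrightarrow> cmp P x y z g f \<in> I x z"
    and "f \<in> mor P x y \<Longrightarrow> g \<in> I y z \<Longrightarrow> cmp P x y z g f \<in> I x z"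
  using ideal assms by (auto simp: cat_ideal_def)

section \<open>Signed differences of parallel paths modulo an ideal containing the mesh
  relations\<close>

definition signed_diff :: "rep_arrow list \<Rightarrow> rep_arrow list \<Rightarrow> rep_arrow list \<Rightarrow> 'a" where
  "signed_diff u v = (\<lambda>p. parity_sign k (int (inversions u)) \<otimes> basis_elem k u p \<oplus>
                         parity_sign k (int (inversions v) + 1) \<otimes> basis_elem k v p)"

lemma signed_diff_closed [simp, intro]: "signed_diff u v p \<in> carrier k"
  by (simp add: signed_diff_def)

lemma parity_sign_Suc: "parity_sign k (m + 1) = \<ominus> parity_sign k m"
  by (auto simp: parity_sign_def)

lemma signed_diff_refl: "signed_diff u u = (\<lambda>p. \<zero>)"
  by (rule ext) (simp add: signed_diff_def parity_sign_Suc l_minus r_neg)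

text \<open>The additional 1 in the second exponent of \<open>signed_diff\<close> is a minus sign,
  so the contributions of \<open>v\<close> cancel and differences telescope.\<close>

lemma signed_diff_trans: "(\<lambda>p. signed_diff u v p \<oplus> signed_diff v w p) = signed_diff u w"
proof
  fix p
  show "signed_diff u v p \<oplus> signed_diff v w p = signed_diff u w p"
    by (simp add: signed_diff_def parity_sign_Suc l_minus a_assoc r_neg1)
qed

lemma signed_diff_mor: "u \<in> paths n x y \<Longrightarrow> v \<in> paths n x y \<Longrightarrow> signed_diff u v \<in> mor P x y"
  using basis_mor[of u x y] basis_mor[of v x y] by (simp add: mor_P_iff signed_diff_def)

text \<open>The paths \<open>u\<close> and \<open>v\<close> have equal counts, so prefixing
  \<open>s\<close> multiplies both of their signs by the same factor, which the outer scalar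
  supplies.\<close>

lemma cmp_basis_signed_diff:
  assumes s: "s \<in> paths n x y" and "u \<in> paths n y z" "v \<in> paths n y z"
  shows "(\<lambda>p. parity_sign k (int (inversions s) + stars x y * plains y z) \<otimes>
           cmp P x y z (signed_diff u v) (basis_elem k s) p) = signed_diff (s @ u) (s @ v)"
    (is "(\<lambda>p. ?c \<otimes> _) = _")
proof
  fix p
  note uv = assms(2,3)
  note m = basis_mor[OF s] signed_diff_mor[OF uv]
  have inv: "parity_sign k (int (inversions (s @ w))) = ?c \<otimes> parity_sign k (int (inversions w))"
    if "w \<in> paths n y z" for w
    by (simp add: inversions_append[OF s that] parity_sign_add m_ac)
  have B: "cmp P x y z (basis_elem k w) (basis_elem k s) p = basis_elem k (s @ w) p"
    if "w \<in> paths n y z" for w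
    using cmp_P_basis[OF s that] by simp
  have "cmp P x y z (signed_diff u v) (basis_elem k s) p =
      parity_sign k (int (inversions u)) \<otimes> basis_elem k (s @ u) p \<oplus>
      parity_sign k (int (inversions v) + 1) \<otimes> basis_elem k (s @ v) p"
    unfolding B[OF uv(1), symmetric] B[OF uv(2), symmetric]
      cmp_P[OF m] cmp_P[OF m(1) basis_mor[OF uv(1)]] cmp_P[OF m(1) basis_mor[OF uv(2)]]
    by (simp add: signed_diff_def l_distr m_assoc)
  then show "?c \<otimes> cmp P x y z (signed_diff u v) (basis_elem k s) p = signed_diff (s @ u) (s @ v) p"
    by (simp add: signed_diff_def parity_sign_add[of _ 1] inv[OF uv(1)] inv[OF uv(2)] r_distr m_assoc)
qed

lemma signed_diff_prefix:
  assumes "s \<in> paths n x y" "u \<in> paths n y z" "v \<in> paths n y z" "signed_diff u v \<in> I y z"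
  shows "signed_diff (s @ u) (s @ v) \<in> I x z"
proof -
  note V = paths_start[OF assms(1)] paths_end[OF assms(1)] paths_end[OF assms(2)]
  show ?thesis
    unfolding cmp_basis_signed_diff[OF assms(1-3), symmetric]
    using V assms by (intro ideal_smult ideal_cmp(2)) (auto intro: basis_mor)
qed

text \<open>The word \<open>v\<close> has exactly one inversion more than \<open>u\<close>; hence
  either signed difference is, up to a sign, the mesh relation followed by \<open>w\<close>.\<close>

lemma signed_diff_swap:
  assumes q: "1 < q" "q < n" and w: "w \<in> paths n (q, i) y"
  defines "u \<equiv> Arr q (i + 1) # Arr_star q (i + 1) # w"
    and "v \<equiv> Arr_star (q - 1) (i + 1) # Arr (q - 1) i # w"
  shows "signed_diff u v \<in> I (q, i + 1) y" "signed_diff v u \<in> I (q, i + 1) y"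
proof -
  let ?x = "(q, i + 1)" and ?z = "(q, i)"
  let ?s = "[Arr q (i + 1), Arr_star q (i + 1)]" and ?t = "[Arr_star (q - 1) (i + 1), Arr (q - 1) i]"
  have s: "?s \<in> paths n ?x ?z" and t: "?t \<in> paths n ?x ?z"
    using q by (auto simp: paths_simps vertices_iff)
  have V: "?x \<in> vertices n" "?z \<in> vertices n" "y \<in> vertices n"
    using q paths_end[OF w] by (auto simp: vertices_iff)
  let ?m = "mesh_relation n k q i"
  have m: "?m = (\<lambda>p. basis_elem k ?t p \<oplus> basis_elem k ?s p)"
    using q by (simp add: mesh_relation_def)
  have mI: "?m \<in> I ?x ?z" using mesh[of q i] q by simp
  note mm = ideal_mor[OF V(1,2) mI]
  note bw = basis_mor[OF w]
  have J: "cmp P ?x ?z y (basis_elem k w) ?m \<in> I ?x y"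
    using V mI bw by (intro ideal_cmp(1))
  have "cmp P ?x ?z y (basis_elem k w) ?m p = basis_elem k v p \<oplus> basis_elem k u p" for p
  proof -
    have "basis_elem k v p = cmp P ?x ?z y (basis_elem k w) (basis_elem k ?t) p"
      "basis_elem k u p = cmp P ?x ?z y (basis_elem k w) (basis_elem k ?s) p"
      unfolding cmp_P_basis[OF t w] cmp_P_basis[OF s w] by (simp_all add: u_def v_def)
    then show ?thesis
      unfolding cmp_P[OF mm bw] cmp_P[OF basis_mor[OF s] bw] cmp_P[OF basis_mor[OF t] bw]
      by (simp add: m r_distr)
  qed
  then have "cmp P ?x ?z y (basis_elem k w) ?m = (\<lambda>p. basis_elem k v p \<oplus> basis_elem k u p)"
    by (rule ext)
  with J have J: "(\<lambda>p. basis_elem k v p \<oplus> basis_elem k u p) \<in> I ?x y" by simp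
  have inv: "int (inversions v) = int (inversions u) + 1"
    by (simp add: u_def v_def)
  have "signed_diff u v = (\<lambda>p. parity_sign k (int (inversions u)) \<otimes> (basis_elem k v p \<oplus> basis_elem k u p))"
    by (rule ext) (simp add: signed_diff_def r_distr a_comm inv parity_sign_def)
  then show "signed_diff u v \<in> I ?x y" using ideal_smult[OF V(1,3) J] by simp
  have "signed_diff v u = (\<lambda>p. parity_sign k (int (inversions v)) \<otimes> (basis_elem k v p \<oplus> basis_elem k u p))"
    by (rule ext) (simp add: signed_diff_def r_distr a_comm inv parity_sign_def)
  then show "signed_diff v u \<in> I ?x y" using ideal_smult[OF V(1,3) J] by simp
qed

text \<open>A diamond argument: paths with the same first arrow are compared after removing it;
  otherwise both are compared with two paths that begin with the two sides of a mesh and continue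
  alike.\<close>

lemma signed_diff_ideal:
  assumes "u \<in> paths n x y" "v \<in> paths n x y"
  shows "signed_diff u v \<in> I x y"
  using assms
proof (induction "length u" arbitrary: u v x)
  case 0
  then have "u = v" using paths_length[OF 0(2)] paths_length[OF 0(3)] by simp
  then show ?case
    using ideal_zero[OF paths_start[OF 0(2)] paths_end[OF 0(2)]] by (simp add: signed_diff_refl)
next
  case (Suc m)
  note y = paths_end[OF Suc(3)] and x = paths_start[OF Suc(3)]
  have len: "length u = length v" using paths_length[OF Suc(3)] paths_length[OF Suc(4)] by simp
  obtain e u' where u: "u = e # u'" using Suc(2) by (cases u) auto
  obtain e' v' where v: "v = e' # v'" using Suc(2) len by (cases v) auto
  have same: "signed_diff (a # r) (a # r') \<in> I x y"
    if "a # r \<in> paths n x y" "a # r' \<in> paths n x y" "length r = m" for a r r'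
  proof -
    define x' where "x' = head (rep_quiver n) a"
    have a: "[a] \<in> paths n x x'" "r \<in> paths n x' y" "r' \<in> paths n x' y"
      using that by (cases a; simp add: paths_simps x'_def vertices_iff; simp add: rep_quiver_def)+
    have "signed_diff r r' \<in> I x' y" using Suc.hyps(1)[of r] that a by simp
    then show ?thesis using signed_diff_prefix[OF a] by simp
  qed
  \<comment> \<open>The bridge from \<open>u\<close> to \<open>v\<close>: the outer two of three
    differences share a first arrow and are settled by induction, and the middle one is
    assumed.\<close>
  have change: "signed_diff u v \<in> I x y"
    if "e # r \<in> paths n x y" "e' # r' \<in> paths n x y" "signed_diff (e # r) (e' # r') \<in> I x y" for r r'
  proof -
    have l: "length u' = m" "length r' = m"
      using Suc(2) len paths_length[OF Suc(3)] paths_length[OF that(2)] by (auto simp: u)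
    have 1: "signed_diff u (e # r) \<in> I x y"
      unfolding u by (rule same[OF Suc(3)[unfolded u] that(1) l(1)])
    have 2: "signed_diff (e' # r') v \<in> I x y"
      unfolding v by (rule same[OF that(2) Suc(4)[unfolded v] l(2)])
    have "signed_diff u (e' # r') \<in> I x y"
      using ideal_add[OF x y 1 that(3)] by (simp add: signed_diff_trans)
    from ideal_add[OF x y this 2] show ?thesis by (simp add: signed_diff_trans)
  qed
  obtain q j where q: "x = (q, j)" by force
  define i where "i = j - 1"
  have j: "j = i + 1" by (simp add: i_def)
  \<comment> \<open>Crossing the mesh uses one arrow of each kind, so both counts from
    \<open>(q, i)\<close> are still nonnegative and a common continuation exists.\<close>
  have mixed: "paths n (q, i) y \<noteq> {}" if "1 < q" "q < n" "1 \<le> stars x y" "1 \<le> plains x y"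
    by (rule paths_exist[OF n_ge_2 _ y])
      (use that in \<open>simp_all add: q j vertices_iff stars_def plains_def\<close>)
  show ?case
  proof (cases "e = e'")
    case True
    have "length u' = m" using Suc(2) by (simp add: u)
    then show ?thesis using same[of e u' v'] Suc(3,4) True by (simp add: u v)
  next
    case False
    have cnt: "int (length (filter is_star u)) = stars x y"
      "int (length (filter (Not \<circ> is_star) u)) = plains x y"
      "int (length (filter is_star v)) = stars x y"
      "int (length (filter (Not \<circ> is_star) v)) = plains x y"
      using paths_count[OF Suc(3)] paths_count[OF Suc(4)] by auto
    show ?thesis
    proof (cases e)
      case (Arr q' i')
      then have e: "e = Arr q (i + 1)" "1 \<le> q" "q < n" using Suc(3) by (auto simp: u paths_simps q j)
      then have e': "e' = Arr_star (q - 1) (i + 1)" "1 < q"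
        using Suc(4) False by (cases e'; auto simp: v paths_simps q j)+
      have "1 \<le> stars x y" "1 \<le> plains x y" using cnt(2,3) e(1) e'(1) by (auto simp: u v)
      then obtain w where w: "w \<in> paths n (q, i) y" using mixed e(2,3) e'(2) by blast
      show ?thesis
        by (rule change[of "Arr_star q (i + 1) # w" "Arr (q - 1) i # w"])
          (use e(2,3) e'(2) w signed_diff_swap(1)[OF e'(2) e(3) w] in
            \<open>auto simp: paths_simps q j e(1) e'(1)\<close>)
    next
      case (Arr_star q' i')
      then have e: "e = Arr_star (q - 1) (i + 1)" "1 < q" using Suc(3) by (auto simp: u paths_simps q j)
      then have e': "e' = Arr q (i + 1)" "q < n"
        using Suc(4) False by (cases e'; auto simp: v paths_simps q j)+
      have "1 \<le> stars x y" "1 \<le> plains x y" using cnt(1,4) e(1) e'(1) by (auto simp: u v)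
      then obtain w where w: "w \<in> paths n (q, i) y" using mixed e(2) e'(2) by blast
      show ?thesis
        by (rule change[of "Arr (q - 1) i # w" "Arr_star q (i + 1) # w"])
          (use e(2) e'(2) w signed_diff_swap(2)[OF e(2) e'(2) w] in
            \<open>auto simp: paths_simps q j e(1) e'(1)\<close>)
    qed
  qed
qed

section \<open>Paths outside the rectangle, and the kernel as the smallest ideal\<close>

lemma basis_ideal_if_signed_diff:
  assumes "u \<in> paths n x y" "v \<in> paths n x y" "basis_elem k v \<in> I x y"
  shows "basis_elem k u \<in> I x y"
proof -
  note V = paths_start[OF assms(1)] paths_end[OF assms(1)]
  let ?s = "\<lambda>p. parity_sign k (int (inversions p))"
  have 1: "(\<lambda>p. ?s v \<otimes> basis_elem k v p) \<in> I x y" using ideal_smult[OF V assms(3)] by simp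
  have "(\<lambda>p. signed_diff u v p \<oplus> ?s v \<otimes> basis_elem k v p) \<in> I x y"
    by (rule ideal_add[OF V signed_diff_ideal[OF assms(1,2)] 1])
  moreover have "(\<lambda>p. signed_diff u v p \<oplus> ?s v \<otimes> basis_elem k v p) = (\<lambda>p. ?s u \<otimes> basis_elem k u p)"
    by (rule ext) (simp add: signed_diff_def parity_sign_Suc l_minus a_assoc l_neg)
  ultimately have "(\<lambda>p. ?s u \<otimes> basis_elem k u p) \<in> I x y" by simp
  from ideal_smult[OF V this, of "?s u"]
  have "(\<lambda>p. ?s u \<otimes> (?s u \<otimes> basis_elem k u p)) \<in> I x y" by simp
  then show ?thesis by simp
qed

text \<open>With too many starred arrows, stepping along a starred arrow lowers count and bound
  alike, so the excess persists until \<open>q = 1\<close>, where a boundary relation can be split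
  off. Too many plain arrows lead to \<open>q = n\<close> in the same way.\<close>

lemma basis_ideal:
  assumes "u \<in> paths n x y" "\<not> reach n x y"
  shows "basis_elem k u \<in> I x y"
  using assms
proof (induction "length u" arbitrary: u x)
  case 0
  then show ?case using reach_refl[OF paths_start[OF 0(2)]] by simp
next
  case (Suc m)
  note y = paths_end[OF Suc(3)] and x = paths_start[OF Suc(3)]
  have nonneg: "0 \<le> stars x y" "0 \<le> plains x y" using paths_count[OF Suc(3)] by linarith+
  have lu: "int m + 1 = stars x y + plains x y" using Suc(2) paths_length[OF Suc(3)] by simp
  obtain q j where q: "x = (q, j)" by force
  define i where "i = j - 1"
  have j: "j = i + 1" by (simp add: i_def)
  \<comment> \<open>The path \<open>u\<close> may begin differently: it suffices that some parallel
    path lies in the ideal.\<close>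
  have step: "basis_elem k u \<in> I x y"
    if "[a] \<in> paths n x x'" "w \<in> paths n x' y" "\<not> reach n x' y" for a w x'
  proof -
    have aw: "a # w \<in> paths n x y" using paths_append[OF that(1,2)] by simp
    have "length w = m" using paths_length[OF aw] lu by simp
    then have "basis_elem k w \<in> I x' y" using Suc.hyps(1)[of w x'] that by simp
    then have "cmp P x x' y (basis_elem k w) (basis_elem k [a]) \<in> I x y"
      using that x y paths_end[OF that(1)] by (intro ideal_cmp(2)) (auto intro: basis_mor)
    then have "basis_elem k (a # w) \<in> I x y" by (simp add: cmp_P_basis[OF that(1,2)])
    then show ?thesis using basis_ideal_if_signed_diff[OF Suc(3) aw] by simp
  qed
  have boundary: "basis_elem k u \<in> I x y"
    if "s \<in> paths n x (q, i)" "w \<in> paths n (q, i) y" "mesh_relation n k q i = basis_elem k s" for s w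
  proof -
    have "basis_elem k s \<in> I x (q, i)"
      using mesh[of q i] x that(3) by (simp add: vertices_iff q j)
    then have "cmp P x (q, i) y (basis_elem k w) (basis_elem k s) \<in> I x y"
      using that x y paths_end[OF that(1)] by (intro ideal_cmp(1)) (auto intro: basis_mor)
    then show ?thesis
      using basis_ideal_if_signed_diff[OF Suc(3) paths_append[OF that(1,2)]] by (simp add: cmp_P_basis[OF that(1,2)])
  qed
  have V: "1 \<le> q" "q \<le> n" "1 \<le> fst y" "fst y \<le> n" using x y by (auto simp: vertices_iff q)
  have st: "stars x y = i + 1 - snd y" "plains x y = int (fst y) - int q + i + 1 - snd y"
    by (simp_all add: stars_def plains_def q j)
  consider (low) "int q \<le> stars x y" | (high) "int n - int q < plains x y"
    using Suc(4) nonneg by (force simp: reach_def q)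
  then show ?case
  proof cases
    case low
    show ?thesis
    proof (cases "q = 1")
      case True
      \<comment> \<open>From \<open>q = 1\<close>, the endpoint has positive first coordinate only
        if the plain count is at least the starred count; so both are positive, and the arrows of
        the boundary relation can be spent.\<close>
      have "paths n (q, i) y \<noteq> {}"
        by (rule paths_exist[OF n_ge_2])
          (use V low st True in \<open>simp_all add: vertices_iff stars_def plains_def\<close>)
      then obtain w where w: "w \<in> paths n (q, i) y" by blast
      show ?thesis
      proof (rule boundary[OF _ w])
        show "[Arr 1 (i + 1), Arr_star 1 (i + 1)] \<in> paths n x (q, i)"
          using n_ge_2 True by (simp add: paths_simps q j vertices_iff)
      qed (simp add: True mesh_relation_def)
    next
      case False
      have "paths n (q - 1, i) y \<noteq> {}"
        by (rule paths_exist[OF n_ge_2])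
          (use V low st False nonneg in \<open>auto simp: vertices_iff stars_def plains_def of_nat_diff\<close>)
      then obtain w where w: "w \<in> paths n (q - 1, i) y" by blast
      show ?thesis
      proof (rule step[OF _ w])
        show "[Arr_star (q - 1) (i + 1)] \<in> paths n x (q - 1, i)"
          using V False by (auto simp: paths_simps q j vertices_iff)
        show "\<not> reach n (q - 1, i) y"
          using low V False st by (simp add: reach_def stars_def)
      qed
    qed
  next
    case high
    show ?thesis
    proof (cases "q = n")
      case True
      have "paths n (q, i) y \<noteq> {}"
        by (rule paths_exist[OF n_ge_2])
          (use V high st True in \<open>simp_all add: vertices_iff stars_def plains_def\<close>)
      then obtain w where w: "w \<in> paths n (q, i) y" by blast
      show ?thesis
      proof (rule boundary[OF _ w])
        show "[Arr_star (n - 1) (i + 1), Arr (n - 1) i] \<in> paths n x (q, i)"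
          using n_ge_2 True by (simp add: paths_simps q j vertices_iff)
      qed (use n_ge_2 in \<open>simp add: True mesh_relation_def\<close>)
    next
      case False
      have "paths n (q + 1, i + 1) y \<noteq> {}"
        by (rule paths_exist[OF n_ge_2])
          (use V high st False nonneg in \<open>simp_all add: vertices_iff stars_def plains_def\<close>)
      then obtain w where w: "w \<in> paths n (q + 1, i + 1) y" by blast
      show ?thesis
      proof (rule step[OF _ w])
        show "[Arr q (i + 1)] \<in> paths n x (q + 1, i + 1)"
          using V False by (simp add: paths_simps q j vertices_iff)
        show "\<not> reach n (q + 1, i + 1) y"
          using high V False st by (simp add: reach_def plains_def)
      qed
    qed
  qed
qed

lemma ideal_lincomb:
  assumes V: "x \<in> vertices n" "y \<in> vertices n"
    and "\<And>p. p \<in> paths n x y \<Longrightarrow> c p \<in> carrier k" "\<And>p. p \<in> paths n x y \<Longrightarrow> h p \<in> I x y"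
  shows "(\<lambda>r. \<Oplus>p\<in>paths n x y. c p \<otimes> h p r) \<in> I x y"
proof -
  interpret M: module k "free_module k (paths n x y)" by (rule module_P)
  have I: "(\<lambda>r. c p \<otimes> h p r) \<in> carrier (free_module k (paths n x y))" if "p \<in> paths n x y" for p
    using ideal_mor[OF V ideal_smult[OF V assms(4,3)[OF that]]] by (simp add: carrier_P)
  have "(\<Oplus>\<^bsub>free_module k (paths n x y)\<^esub>p\<in>paths n x y. c p \<odot>\<^bsub>free_module k (paths n x y)\<^esub> h p) \<in> I x y"
    by (rule M.submodule_lincomb[OF ideal_submodule[OF V, unfolded homs_P] finite_paths assms(3,4)])
  then show ?thesis
    unfolding free_module_simps by (subst (asm) finsum_free_module[OF finite_paths I])
qed

text \<open>Outside the rectangle every path lies in the ideal. Inside, fix a path \<open>v\<close>: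
  a combination of the differences to \<open>v\<close> reproduces \<open>f\<close> up to a multiple
  of \<open>v\<close>, and the coefficient there is \<open>path_sum x y f\<close> up to sign, hence
  zero.\<close>

lemma kernel_subset_ideal:
  assumes V: "x \<in> vertices n" "y \<in> vertices n" and f: "f \<in> cls x y \<zero>"
  shows "f \<in> I x y"
proof -
  have fm: "f \<in> mor P x y" and f0: "eval x y f = \<zero>" using f by (auto simp: cls_def)
  have expand: "(\<Oplus>p\<in>paths n x y. f p \<otimes> basis_elem k p r) = f r" for r
  proof -
    have "(\<Oplus>p\<in>paths n x y. f p \<otimes> basis_elem k p r) = (\<Oplus>p\<in>paths n x y. if r = p then f p else \<zero>)"
      using fm by (intro finsum_cong') (auto simp: basis_elem_def mor_P_closed)
    also have "\<dots> = f r"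
    proof (cases "r \<in> paths n x y")
      case True
      then show ?thesis using fm finite_paths by (intro add.finprod_singleton) (auto simp: mor_P_closed)
    next
      case False
      then have "(\<Oplus>p\<in>paths n x y. if r = p then f p else \<zero>) = (\<Oplus>p\<in>paths n x y. \<zero>)"
        by (intro finsum_cong') auto
      then show ?thesis using False fm by (simp add: mor_P_zero)
    qed
    finally show ?thesis .
  qed
  show ?thesis
  proof (cases "reach n x y")
    case False
    have "(\<lambda>r. \<Oplus>p\<in>paths n x y. f p \<otimes> basis_elem k p r) \<in> I x y"
      using V fm basis_ideal[OF _ False] by (intro ideal_lincomb) (auto simp: mor_P_closed)
    then show ?thesis by (simp add: expand)
  next
    case True
    then obtain v where v: "v \<in> paths n x y"
      using paths_exist[OF n_ge_2 V] by (auto simp: reach_def)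
    let ?s = "\<lambda>p. parity_sign k (int (inversions p))"
    have "(\<lambda>r. \<Oplus>p\<in>paths n x y. (f p \<otimes> ?s p) \<otimes> signed_diff p v r) \<in> I x y"
      using V v fm signed_diff_ideal by (intro ideal_lincomb) (auto simp: mor_P_closed)
    moreover have "(\<Oplus>p\<in>paths n x y. (f p \<otimes> ?s p) \<otimes> signed_diff p v r) = f r" for r
    proof -
      let ?b = "parity_sign k (int (inversions v) + 1) \<otimes> basis_elem k v r"
      have "(\<Oplus>p\<in>paths n x y. (f p \<otimes> ?s p) \<otimes> signed_diff p v r) =
          (\<Oplus>p\<in>paths n x y. f p \<otimes> basis_elem k p r \<oplus> (?s p \<otimes> f p) \<otimes> ?b)"
        using fm by (intro finsum_cong')
          (auto simp: signed_diff_def mor_P_closed r_distr m_ac)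
      also have "\<dots> = f r \<oplus> (\<Oplus>p\<in>paths n x y. (?s p \<otimes> f p) \<otimes> ?b)"
        using fm by (subst finsum_addf) (auto simp: mor_P_closed expand)
      also have "(\<Oplus>p\<in>paths n x y. (?s p \<otimes> f p) \<otimes> ?b) = path_sum x y f \<otimes> ?b"
        unfolding path_sum_def using fm
        by (intro finsum_ldistr[symmetric]) (auto simp: mor_P_closed finite_paths)
      also have "path_sum x y f = \<zero>" using f0 True by (simp add: eval_def)
      finally show ?thesis using fm by (simp add: mor_P_closed)
    qed
    ultimately show ?thesis by simp
  qed
qed

end

lemma mesh_ideal_eq:
  assumes "x \<in> vertices n" "y \<in> vertices n"
  shows "mesh_ideal n k x y = cls x y \<zero>"
proof
  show "mesh_ideal n k x y \<subseteq> cls x y \<zero>"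
    unfolding mesh_ideal_def generated_ideal_def
  proof (rule Inter_lower, intro CollectI exI conjI)
    show "cat_ideal k P (\<lambda>x y. cls x y \<zero>)" by (rule kernel_ideal)
    show "\<forall>u\<in>objects P. \<forall>v\<in>objects P. mesh_relations n k u v \<subseteq> cls u v \<zero>"
      using mesh_relation_kernel by (auto simp: mesh_relations_def)
  qed simp
  show "cls x y \<zero> \<subseteq> mesh_ideal n k x y"
    unfolding mesh_ideal_def generated_ideal_def
  proof clarify
    fix f I assume f: "f \<in> cls x y \<zero>" and I: "cat_ideal k P I"
      and mesh: "\<forall>u\<in>objects P. \<forall>v\<in>objects P. mesh_relations n k u v \<subseteq> I u v"
    have "mesh_relation n k q i \<in> I (q, i + 1) (q, i)" if "1 \<le> q" "q \<le> n" for q i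
    proof -
      have "mesh_relation n k q i \<in> mesh_relations n k (q, i + 1) (q, i)"
        using that by (auto simp: mesh_relations_def)
      moreover have "(q, i + 1) \<in> objects P" "(q, i) \<in> objects P"
        using that by (auto simp: vertices_iff)
      ultimately show ?thesis using mesh by blast
    qed
    then show "f \<in> I x y" using kernel_subset_ideal[OF I _ assms f] by blast
  qed
qed

end

section \<open>The mesh category in terms of scalars\<close>

context mesh
begin

abbreviation Q where "Q \<equiv> mesh_category n k"

lemma scalars_closed: "c \<in> scalars x y \<Longrightarrow> c \<in> carrier k"
  by (auto simp: scalars_def split: if_splits)

lemma scalars_zero [simp, intro]: "\<zero> \<in> scalars x y"
  by (simp add: scalars_def)

lemma scalars_add [intro]: "c \<in> scalars x y \<Longrightarrow> d \<in> scalars x y \<Longrightarrow> c \<oplus> d \<in> scalars x y"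
  by (auto simp: scalars_def split: if_splits)

lemma scalars_smult [intro]: "r \<in> carrier k \<Longrightarrow> c \<in> scalars x y \<Longrightarrow> r \<otimes> c \<in> scalars x y"
  by (auto simp: scalars_def split: if_splits)

lemma scalars_one [intro]: "x \<in> vertices n \<Longrightarrow> \<one> \<in> scalars x x"
  by (simp add: scalars_def reach_refl)

lemma scalars_cmp [intro]:
  "c \<in> carrier k \<Longrightarrow> d \<in> carrier k \<Longrightarrow> coef x y z \<otimes> d \<otimes> c \<in> scalars x z"
  by (auto simp: scalars_def coef_def)

lemma eval_surj:
  assumes V: "x \<in> vertices n" "y \<in> vertices n" and c: "c \<in> scalars x y"
  obtains f where "f \<in> cls x y c"
proof (cases "reach n x y")
  case True
  then obtain p where p: "p \<in> paths n x y"
    using paths_exist[OF n_ge_2 V] by (auto simp: reach_def)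
  let ?s = "parity_sign k (int (inversions p))"
  have "(\<lambda>r. (c \<otimes> ?s) \<otimes> basis_elem k p r) \<in> mor P x y"
    using basis_mor[OF p] scalars_closed[OF c] by (simp add: mor_P_iff)
  moreover have "eval x y (\<lambda>r. (c \<otimes> ?s) \<otimes> basis_elem k p r) = c"
    using eval_smult[OF _ basis_mor[OF p], of "c \<otimes> ?s"] eval_basis[OF p True] scalars_closed[OF c]
    by (simp add: m_assoc)
  ultimately show ?thesis using that by (auto simp: cls_def)
next
  case False
  then have "(\<lambda>p. \<zero>) \<in> cls x y c"
    using c by (simp add: cls_def eval_zero scalars_def) (simp add: mor_P_iff)
  then show ?thesis by (rule that)
qed

lemma cls_inj:
  assumes "x \<in> vertices n" "y \<in> vertices n" "c \<in> scalars x y" "d \<in> scalars x y"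
  shows "cls x y c = cls x y d \<longleftrightarrow> c = d"
  using eval_surj[OF assms(1-3)] by (auto simp: cls_def)

lemma coset_cls:
  assumes V: "x \<in> vertices n" "y \<in> vertices n" and f: "f \<in> mor P x y"
  shows "mesh_ideal n k x y +>\<^bsub>homs P x y\<^esub> f = cls x y (eval x y f)"
  unfolding mesh_ideal_eq[OF V]
proof (intro equalityI subsetI)
  fix g assume "g \<in> cls x y \<zero> +>\<^bsub>homs P x y\<^esub> f"
  then obtain h where h: "h \<in> cls x y \<zero>" "g = (\<lambda>p. h p \<oplus> f p)" by (auto simp: a_r_coset_def')
  then show "g \<in> cls x y (eval x y f)"
    using f eval_closed[OF f] by (auto simp: cls_def eval_add) (simp add: mor_P_iff)
next
  fix g assume g: "g \<in> cls x y (eval x y f)"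
  let ?h = "\<lambda>p. g p \<oplus> \<ominus> \<one> \<otimes> f p"
  have gm: "g \<in> mor P x y" and m: "(\<lambda>p. \<ominus> \<one> \<otimes> f p) \<in> mor P x y"
    using f g by (auto simp: mor_P_iff cls_def)
  have "eval x y ?h = \<zero>"
    using eval_add[OF gm m] eval_smult[OF _ f, of "\<ominus> \<one>"] g eval_closed[OF f]
    by (simp add: cls_def l_minus r_neg)
  then have "?h \<in> cls x y \<zero>" using gm m by (simp add: cls_def) (simp add: mor_P_iff)
  moreover have "g = (\<lambda>p. ?h p \<oplus> f p)"
    using f gm by (simp add: fun_eq_iff mor_P_closed l_minus a_assoc l_neg)
  ultimately show "g \<in> cls x y \<zero> +>\<^bsub>homs P x y\<^esub> f" by (auto simp: a_r_coset_def')
qed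

lemma objects_Q [simp]: "objects Q = vertices n"
  by (simp add: mesh_category_def quotient_category_def)

lemma homs_Q: "homs Q x y = quotient_module (homs P x y) (mesh_ideal n k x y)"
  by (simp add: mesh_category_def quotient_category_def)

lemma carrier_Q:
  assumes V: "x \<in> vertices n" "y \<in> vertices n"
  shows "carrier (homs Q x y) = cls x y ` scalars x y"
proof -
  have "carrier (homs Q x y) = (\<lambda>f. mesh_ideal n k x y +>\<^bsub>homs P x y\<^esub> f) ` mor P x y"
    unfolding homs_Q quotient_module_simps A_RCOSETS_def' by (auto simp: carrier_P)
  also have "\<dots> = (\<lambda>f. cls x y (eval x y f)) ` mor P x y"
    using coset_cls[OF V] by simp
  also have "\<dots> = cls x y ` scalars x y"
  proof
    show "cls x y ` scalars x y \<subseteq> (\<lambda>f. cls x y (eval x y f)) ` mor P x y"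
    proof
      fix A assume "A \<in> cls x y ` scalars x y"
      then obtain c where c: "c \<in> scalars x y" "A = cls x y c" by blast
      from eval_surj[OF V c(1)] obtain f where "f \<in> cls x y c" .
      then show "A \<in> (\<lambda>f. cls x y (eval x y f)) ` mor P x y" using c by (auto simp: cls_def)
    qed
  qed (auto intro: eval_scalars)
  finally show ?thesis .
qed

lemma mor_Q: "x \<in> vertices n \<Longrightarrow> y \<in> vertices n \<Longrightarrow> mor Q x y = cls x y ` scalars x y"
  by (simp add: mor_def carrier_Q)

lemma zero_Q: "x \<in> vertices n \<Longrightarrow> y \<in> vertices n \<Longrightarrow> \<zero>\<^bsub>homs Q x y\<^esub> = cls x y \<zero>"
  by (simp add: homs_Q quotient_module_simps mesh_ideal_eq)

lemma add_Q:
  assumes V: "x \<in> vertices n" "y \<in> vertices n" and c: "c \<in> scalars x y" and d: "d \<in> scalars x y"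
  shows "cls x y c \<oplus>\<^bsub>homs Q x y\<^esub> cls x y d = cls x y (c \<oplus> d)"
proof -
  obtain f where f: "f \<in> cls x y c" using eval_surj[OF V c] .
  note cd = scalars_closed[OF c] scalars_closed[OF d]
  have "cls x y c <+>\<^bsub>homs P x y\<^esub> cls x y d = cls x y (c \<oplus> d)"
  proof (intro equalityI subsetI)
    fix h assume "h \<in> cls x y c <+>\<^bsub>homs P x y\<^esub> cls x y d"
    then obtain a b where "a \<in> cls x y c" "b \<in> cls x y d" "h = (\<lambda>p. a p \<oplus> b p)"
      by (auto simp: set_add_def')
    then show "h \<in> cls x y (c \<oplus> d)" by (auto simp: cls_def eval_add) (simp add: mor_P_iff)
  next
    fix h assume h: "h \<in> cls x y (c \<oplus> d)"
    let ?g = "\<lambda>p. h p \<oplus> \<ominus> \<one> \<otimes> f p"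
    have fm: "f \<in> mor P x y" and hm: "h \<in> mor P x y" and m: "(\<lambda>p. \<ominus> \<one> \<otimes> f p) \<in> mor P x y"
      using f h by (auto simp: mor_P_iff cls_def)
    have "eval x y ?g = d"
      using eval_add[OF hm m] eval_smult[OF _ fm, of "\<ominus> \<one>"] f h cd
      by (simp add: cls_def l_minus a_comm[of c d] a_assoc r_neg)
    then have "?g \<in> cls x y d" using hm m by (simp add: cls_def) (simp add: mor_P_iff)
    moreover have "h = (\<lambda>p. f p \<oplus> ?g p)"
    proof
      fix p show "h p = f p \<oplus> ?g p"
        using mor_P_closed[OF fm] mor_P_closed[OF hm]
        by (simp add: l_minus a_lcomm[of "f p" "h p"] r_neg)
    qed
    ultimately show "h \<in> cls x y c <+>\<^bsub>homs P x y\<^esub> cls x y d"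
      using f by (auto simp: set_add_def')
  qed
  then show ?thesis by (simp only: homs_Q quotient_module_simps)
qed

lemma smult_Q:
  assumes V: "x \<in> vertices n" "y \<in> vertices n" and c: "c \<in> scalars x y" and r: "r \<in> carrier k"
  shows "r \<odot>\<^bsub>homs Q x y\<^esub> cls x y c = cls x y (r \<otimes> c)"
proof -
  obtain f where f: "f \<in> cls x y c" using eval_surj[OF V c] .
  have "mesh_ideal n k x y +>\<^bsub>homs P x y\<^esub> (r \<odot>\<^bsub>homs P x y\<^esub> a) = cls x y (r \<otimes> c)" if "a \<in> cls x y c" for a
  proof -
    have a: "a \<in> mor P x y" "eval x y a = c" using that by (auto simp: cls_def)
    then have "(\<lambda>p. r \<otimes> a p) \<in> mor P x y" using r by (simp add: mor_P_iff)
    then show ?thesis using coset_cls[OF V] eval_smult[OF r a(1)] a(2) by simp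
  qed
  then show ?thesis
    unfolding homs_Q quotient_module_simps using f by (auto simp del: homs_P)
qed

lemma cmp_Q:
  assumes V: "x \<in> vertices n" "y \<in> vertices n" "z \<in> vertices n"
    and c: "c \<in> scalars x y" and d: "d \<in> scalars y z"
  shows "cmp Q x y z (cls y z d) (cls x y c) = cls x z (coef x y z \<otimes> d \<otimes> c)"
proof -
  obtain f where f: "f \<in> cls x y c" using eval_surj[OF V(1,2) c] .
  obtain g where g: "g \<in> cls y z d" using eval_surj[OF V(2,3) d] .
  have "mesh_ideal n k x z +>\<^bsub>homs P x z\<^esub> cmp P x y z b a = cls x z (coef x y z \<otimes> d \<otimes> c)"
    if "a \<in> cls x y c" "b \<in> cls y z d" for a b
    using that by (subst coset_cls[OF V(1,3)]) (auto simp: cls_def cmp_P_mor eval_cmp)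
  then show ?thesis
    unfolding mesh_category_def quotient_category_def using f g by (auto simp del: homs_P)
qed

lemma ident_Q:
  assumes "x \<in> vertices n"
  shows "ident Q x = cls x x \<one>"
proof -
  have p: "[] \<in> paths n x x" using assms by simp
  have "ident Q x = mesh_ideal n k x x +>\<^bsub>homs P x x\<^esub> basis_elem k []"
    by (simp add: mesh_category_def quotient_category_def rep_path_category_def path_category_def)
  then show ?thesis
    using coset_cls[OF assms assms basis_mor[OF p]] eval_basis[OF p reach_refl[OF assms]] by simp
qed

lemma arrow_mor_eq:
  assumes "e \<in> arcs (rep_quiver n)" "tail (rep_quiver n) e = x" "head (rep_quiver n) e = y"
  shows "arrow_mor n k e = cls x y \<one>"
proof -
  have p: "[e] \<in> paths n x y"
    using assms by (cases e) (auto simp: paths_simps vertices_iff rep_quiver_def)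
  have "reach n x y" using assms by (cases e) (auto simp: rep_quiver_def reach_def stars_def plains_def)
  then show ?thesis
    using coset_cls[OF paths_start[OF p] paths_end[OF p] basis_mor[OF p]] eval_basis[OF p] assms
    by (simp add: arrow_mor_def)
qed

lemma arrow_mor_Arr:
  "1 \<le> q \<Longrightarrow> q < n \<Longrightarrow> arrow_mor n k (Arr q i) = cls (q, i) (q + 1, i) \<one>"
  by (rule arrow_mor_eq) (auto simp: rep_quiver_def)

lemma arrow_mor_Arr_star:
  "1 \<le> q \<Longrightarrow> q < n \<Longrightarrow> arrow_mor n k (Arr_star q i) = cls (q + 1, i) (q, i - 1) \<one>"
  by (rule arrow_mor_eq) (auto simp: rep_quiver_def)

text \<open>The coordinate of a morphism, inverse to \<open>cls x y\<close> on
  \<open>scalars x y\<close> by \<open>cls_inj\<close>.\<close>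

definition val :: "nat \<times> int \<Rightarrow> nat \<times> int \<Rightarrow> (rep_arrow list \<Rightarrow> 'a) set \<Rightarrow> 'a" where
  "val x y A = (THE c. c \<in> scalars x y \<and> cls x y c = A)"

lemma val_cls:
  "x \<in> vertices n \<Longrightarrow> y \<in> vertices n \<Longrightarrow> c \<in> scalars x y \<Longrightarrow> val x y (cls x y c) = c"
  unfolding val_def using cls_inj[of x y _ c] by (intro the_equality) auto

text \<open>All operations act on coordinates, so the module laws are inherited from
  \<open>k\<close>.\<close>

lemma module_Q:
  assumes V: "x \<in> vertices n" "y \<in> vertices n"
  shows "module k (homs Q x y)"
proof -
  note simps = carrier_Q[OF V] zero_Q[OF V] add_Q[OF V] smult_Q[OF V]
  have "abelian_group (homs Q x y)"
  proof (rule abelian_groupI)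
    fix A assume "A \<in> carrier (homs Q x y)"
    then obtain c where c: "c \<in> scalars x y" "A = cls x y c" by (auto simp: simps)
    have "\<ominus> \<one> \<otimes> c \<in> scalars x y" using c by auto
    moreover have "\<ominus> \<one> \<otimes> c \<oplus> c = \<zero>" using scalars_closed[OF c(1)] by (simp add: l_minus l_neg)
    ultimately show "\<exists>B\<in>carrier (homs Q x y). B \<oplus>\<^bsub>homs Q x y\<^esub> A = \<zero>\<^bsub>homs Q x y\<^esub>"
      using c by (intro bexI[of _ "cls x y (\<ominus> \<one> \<otimes> c)"]) (simp_all add: simps)
  qed (auto simp: simps scalars_closed scalars_add a_assoc a_comm[OF scalars_closed scalars_closed])
  then show ?thesis
    by (intro moduleI cring_axioms) (auto simp: simps scalars_closed scalars_add scalars_smult l_distr r_distr m_assoc)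
qed

lemma coef_ident_left: "reach n x y \<Longrightarrow> coef x y y = \<one>"
  by (simp add: coef_def plains_def)

lemma coef_ident_right: "reach n x y \<Longrightarrow> coef x x y = \<one>"
  by (simp add: coef_def stars_def)

text \<open>If \<open>z\<close> is not reached from \<open>w\<close> via \<open>x\<close> and \<open>y\<close>, then both sides vanish, as
  the rectangles are compatible with factorisations.\<close>

lemma coef_assoc:
  assumes "reach n w x" "reach n x y" "reach n y z"
  shows "coef w y z \<otimes> coef w x y = coef w x z \<otimes> coef x y z"
proof (cases "reach n w z")
  case True
  have nn: "0 \<le> stars w x" "0 \<le> plains w x" "0 \<le> stars x y" "0 \<le> plains x y"
    "0 \<le> stars y z" "0 \<le> plains y z" using assms by (auto simp: reach_def)
  have "reach n w y" "reach n x z"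
    using reach_factor(1)[OF True, of y] reach_factor(2)[OF True, of x] nn
      stars_plus[of w x y] plains_plus[of w x y] stars_plus[of x y z] plains_plus[of x y z]
    by auto
  \<comment> \<open>Both sides count the pairs of a starred arrow in an earlier leg and a plain
    arrow in a later one.\<close>
  moreover have "stars w y * plains y z + stars w x * plains x y =
      stars w x * plains x z + stars x y * plains y z"
    unfolding stars_plus[of w x y, symmetric] plains_plus[of x y z, symmetric]
    by (simp add: algebra_simps)
  ultimately show ?thesis using True by (simp add: coef_def flip: parity_sign_add)
next
  case False
  then show ?thesis by (simp add: coef_def)
qed

lemma scalars_cases: "c \<in> scalars x y \<Longrightarrow> c = \<zero> \<or> reach n x y"
  by (auto simp: scalars_def split: if_splits)

text \<open>Composition and the functors below all multiply the coordinate by a constant.\<close>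

lemma linear_map_QI:
  assumes V: "x \<in> vertices n" "y \<in> vertices n" "z \<in> vertices n" "w \<in> vertices n" and m: "m \<in> carrier k"
    and maps: "\<And>c. c \<in> scalars x y \<Longrightarrow> m \<otimes> c \<in> scalars z w"
    and eq: "\<And>c. c \<in> scalars x y \<Longrightarrow> F (cls x y c) = cls z w (m \<otimes> c)"
  shows "linear_map k (homs Q x y) (homs Q z w) F"
  unfolding linear_map_def
  using m scalars_closed
  by (auto simp: V carrier_Q add_Q smult_Q eq maps scalars_add scalars_smult r_distr m_lcomm)

lemma preadditive_Q: "preadditive_category k Q"
proof (rule preadditive_category.intro)
  fix x y z f
  assume V: "x \<in> objects Q" "y \<in> objects Q" "z \<in> objects Q" and f: "f \<in> mor Q x y"
  then obtain c where c: "c \<in> scalars x y" "f = cls x y c" by (auto simp: mor_Q)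
  show "linear_map k (homs Q y z) (homs Q x z) (\<lambda>g. cmp Q x y z g f)"
    by (rule linear_map_QI[where m = "coef x y z \<otimes> c"])
      (use V c scalars_closed scalars_cmp[of c _ x y z] in \<open>auto simp: cmp_Q m_ac\<close>)
next
  fix x y z g
  assume V: "x \<in> objects Q" "y \<in> objects Q" "z \<in> objects Q" and g: "g \<in> mor Q y z"
  then obtain c where c: "c \<in> scalars y z" "g = cls y z c" by (auto simp: mor_Q)
  show "linear_map k (homs Q x y) (homs Q x z) (\<lambda>f. cmp Q x y z g f)"
    by (rule linear_map_QI[where m = "coef x y z \<otimes> c"])
      (use V c scalars_closed[OF c(1)] in \<open>auto simp: cmp_Q intro: scalars_closed\<close>)
next
  fix w x y z f g h
  assume V: "w \<in> objects Q" "x \<in> objects Q" "y \<in> objects Q" "z \<in> objects Q"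
    and "f \<in> mor Q w x" "g \<in> mor Q x y" "h \<in> mor Q y z"
  then obtain c d e where c: "c \<in> scalars w x" "f = cls w x c" "d \<in> scalars x y" "g = cls x y d"
    "e \<in> scalars y z" "h = cls y z e" by (auto simp: mor_Q)
  note cl = c(1,3,5)[THEN scalars_closed]
  have "coef w y z \<otimes> e \<otimes> (coef w x y \<otimes> d \<otimes> c) = (coef w y z \<otimes> coef w x y) \<otimes> (e \<otimes> d \<otimes> c)"
    using cl by (simp add: m_ac)
  also have "\<dots> = (coef w x z \<otimes> coef x y z) \<otimes> (e \<otimes> d \<otimes> c)"
  \<comment> \<open>The cocycle identity needs all three legs to be reached, which nonzero
    coordinates guarantee.\<close>
  proof (cases "c = \<zero> \<or> d = \<zero> \<or> e = \<zero>")
    case True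
    then show ?thesis using cl by auto
  next
    case False
    then show ?thesis
      using coef_assoc[of w x y z] c(1,3,5) by (auto dest!: scalars_cases)
  qed
  also have "\<dots> = coef w x z \<otimes> (coef x y z \<otimes> e \<otimes> d) \<otimes> c" using cl by (simp add: m_ac)
  finally show "cmp Q w y z h (cmp Q w x y g f) = cmp Q w x z (cmp Q x y z h g) f"
    using V c cl by (simp add: cmp_Q scalars_cmp)
next
  fix x y f
  assume V: "x \<in> objects Q" "y \<in> objects Q" and "f \<in> mor Q x y"
  then obtain c where c: "c \<in> scalars x y" "f = cls x y c" by (auto simp: mor_Q)
  note cl = scalars_closed[OF c(1)]
  show "cmp Q x x y f (ident Q x) = f" "cmp Q x y y (ident Q y) f = f"
    using V c cl scalars_cases[OF c(1)]
    by (auto simp: ident_Q cmp_Q scalars_one coef_ident_left coef_ident_right)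
qed (auto simp: module_Q ident_Q mor_Q scalars_one)

end

section \<open>Finiteness properties, the arrow ideal and its powers\<close>

context mesh
begin

text \<open>A generator of \<open>scalars x y\<close> in either case, so that arguments about cyclic
  modules need not distinguish the two.\<close>

definition unit_scalar :: "nat \<times> int \<Rightarrow> nat \<times> int \<Rightarrow> 'a" where
  "unit_scalar x y = (if reach n x y then \<one> else \<zero>)"

lemma unit_scalar_scalars [intro]: "unit_scalar x y \<in> scalars x y"
  by (simp add: unit_scalar_def scalars_def)

lemma scalars_unit: "c \<in> scalars x y \<Longrightarrow> c \<otimes> unit_scalar x y = c"
  by (auto simp: unit_scalar_def scalars_def split: if_splits)

lemma zero_module_Q_iff:
  assumes V: "x \<in> vertices n" "y \<in> vertices n"
  shows "zero_module (homs Q x y) \<longleftrightarrow> \<not> reach n x y"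
proof
  assume "zero_module (homs Q x y)"
  then have "cls x y ` scalars x y = {cls x y \<zero>}"
    by (simp add: zero_module_def carrier_Q[OF V] zero_Q[OF V])
  then have "cls x y (unit_scalar x y) = cls x y \<zero>" by blast
  then have "unit_scalar x y = \<zero>" by (subst (asm) cls_inj[OF V]) auto
  then show "\<not> reach n x y" using one_neq_zero by (auto simp: unit_scalar_def)
next
  assume "\<not> reach n x y"
  then show "zero_module (homs Q x y)"
    by (simp add: zero_module_def carrier_Q[OF V] zero_Q[OF V] scalars_def)
qed

lemma free_of_dim_Q_iff:
  assumes V: "x \<in> vertices n" "y \<in> vertices n"
  shows "free_of_dim k 1 (homs Q x y) \<longleftrightarrow> reach n x y"
proof
  let ?F = "free_module k {..<1::nat}"
  have F: "f \<in> carrier ?F \<longleftrightarrow> (\<forall>p. f p \<in> carrier k) \<and> (\<forall>p. p \<noteq> 0 \<longrightarrow> f p = \<zero>)" for f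
    by (subst free_module_carrier_iff_finite) auto
  note F = this this[unfolded One_nat_def]
  show "reach n x y" if "free_of_dim k 1 (homs Q x y)"
  proof (rule ccontr)
    assume "\<not> reach n x y"
    then have c: "carrier (homs Q x y) = {cls x y \<zero>}" by (simp add: carrier_Q[OF V] scalars_def)
    from that obtain f where "linear_iso k ?F (homs Q x y) f" by (auto simp: free_of_dim_def)
    then have "inj_on f (carrier ?F)" "f ` carrier ?F = {cls x y \<zero>}"
      by (auto simp: linear_iso_def bij_betw_def c)
    \<comment> \<open>An isomorphism onto a one-element module would identify these two elements,
      which the nontriviality of \<open>k\<close> separates.\<close>
    moreover have m: "(\<lambda>_. \<zero>) \<in> carrier ?F" "basis_elem k 0 \<in> carrier ?F"
      by (auto simp: F basis_elem_def)
    ultimately have "(\<lambda>_. \<zero>) = basis_elem k (0::nat)"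
      by (metis image_eqI inj_on_def singletonD)
    then have "\<zero> = basis_elem k (0::nat) 0" by metis
    then show False using one_neq_zero by (simp add: basis_elem_def)
  qed
  show "free_of_dim k 1 (homs Q x y)" if r: "reach n x y"
  proof -
    have s: "scalars x y = carrier k" using r by (simp add: scalars_def)
    have "linear_map k ?F (homs Q x y) (\<lambda>f. cls x y (f 0))"
      unfolding linear_map_def by (auto simp: F carrier_Q[OF V] add_Q[OF V] smult_Q[OF V] s)
    moreover have "bij_betw (\<lambda>f. cls x y (f 0)) (carrier ?F) (carrier (homs Q x y))"
    proof (rule bij_betwI')
      fix f g assume fg: "f \<in> carrier ?F" "g \<in> carrier ?F"
      have "f = g" if "f 0 = g 0"
      proof
        fix p show "f p = g p" using fg that by (cases "p = 0") (auto simp: F)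
      qed
      then show "cls x y (f 0) = cls x y (g 0) \<longleftrightarrow> f = g"
        using fg by (subst cls_inj[OF V]) (auto simp: F s)
    next
      fix f assume "f \<in> carrier ?F"
      then show "cls x y (f 0) \<in> carrier (homs Q x y)" by (auto simp: F carrier_Q[OF V] s)
    next
      fix A assume "A \<in> carrier (homs Q x y)"
      then obtain c where "c \<in> carrier k" "A = cls x y c" by (auto simp: carrier_Q[OF V] s)
      then show "\<exists>f\<in>carrier ?F. A = cls x y (f 0)"
        by (intro bexI[of _ "\<lambda>p. if p = 0 then c else \<zero>"]) (auto simp: F)
    qed
    ultimately show ?thesis by (auto simp: free_of_dim_def linear_iso_def)
  qed
qed

lemma submodule_carrier_Q:
  "x \<in> vertices n \<Longrightarrow> y \<in> vertices n \<Longrightarrow> submodule (carrier (homs Q x y)) k (homs Q x y)"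
  by (rule module.carrier_is_submodule) (rule module_Q)

lemma submodule_zero_Q:
  assumes "x \<in> vertices n" "y \<in> vertices n"
  shows "submodule {\<zero>\<^bsub>homs Q x y\<^esub>} k (homs Q x y)"
proof -
  interpret M: module k "homs Q x y" by (rule module_Q[OF assms])
  show ?thesis by (rule M.submoduleI) auto
qed

lemma submodule_Q_zero:
  "submodule N k (homs Q x y) \<Longrightarrow> \<zero>\<^bsub>homs Q x y\<^esub> \<in> N"
  using subgroup.one_closed[OF submodule.axioms(1), of N k "homs Q x y"] by simp

lemma hom_finite_Q: "hom_finite k Q"
  unfolding hom_finite_def objects_Q
proof (intro ballI conjI)
  fix x y assume V: "x \<in> vertices n" "y \<in> vertices n"
  let ?b = "cls x y (unit_scalar x y)"
  show "finitely_generated k (homs Q x y)"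
    unfolding finitely_generated_def
  proof (intro exI conjI)
    show "{?b} \<subseteq> carrier (homs Q x y)" by (auto simp: carrier_Q[OF V])
    show "module_span k (homs Q x y) {?b} = carrier (homs Q x y)"
    proof
      show "module_span k (homs Q x y) {?b} \<subseteq> carrier (homs Q x y)"
        unfolding module_span_def using submodule_carrier_Q[OF V]
        by (intro Inter_lower) (auto simp: carrier_Q[OF V])
      show "carrier (homs Q x y) \<subseteq> module_span k (homs Q x y) {?b}"
        unfolding module_span_def
      proof (intro subsetI InterI, clarify)
        fix A N assume "A \<in> carrier (homs Q x y)" and N: "submodule N k (homs Q x y)" "{?b} \<subseteq> N"
        then obtain c where c: "c \<in> scalars x y" "A = cls x y c" by (auto simp: carrier_Q[OF V])
        have "c \<odot>\<^bsub>homs Q x y\<^esub> ?b \<in> N"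
          using submodule.smult_closed[OF N(1) scalars_closed[OF c(1)]] N(2) by blast
        also have "c \<odot>\<^bsub>homs Q x y\<^esub> ?b = A"
          using smult_Q[OF V unit_scalar_scalars scalars_closed[OF c(1)]] c by (simp add: scalars_unit)
        finally show "A \<in> N" .
      qed
    qed
  qed simp
  show "projective k (homs Q x y)"
    unfolding projective_def
  proof (intro exI conjI)
    \<comment> \<open>In \<open>projective\<close> the index set of the free module consists of
      elements of the type of the morphisms; the generator itself serves as the index.\<close>
    let ?X = "if reach n x y then {?b} else {}"
    let ?i = "\<lambda>A p. if p = ?b then val x y A else \<zero>"
    let ?p = "\<lambda>f. cls x y (f ?b)"
    have X: "f \<in> carrier (free_module k ?X) \<longleftrightarrow> (\<forall>p. f p \<in> carrier k) \<and> (\<forall>p. p \<noteq> ?b \<longrightarrow> f p = \<zero>) \<and>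
        f ?b \<in> scalars x y" for f
    proof (cases "reach n x y")
      case True
      then show ?thesis by (subst free_module_carrier_iff_finite) (auto simp: scalars_def)
    next
      case False
      have "(\<forall>p. f p = \<zero>) \<longleftrightarrow> (\<forall>p. p \<noteq> ?b \<longrightarrow> f p = \<zero>) \<and> f ?b = \<zero>" by metis
      with False show ?thesis by (subst free_module_carrier_iff_finite) (auto simp: scalars_def)
    qed
    show "linear_map k (homs Q x y) (free_module k ?X) ?i"
      unfolding linear_map_def
    proof (intro conjI ballI funcsetI)
      fix A assume "A \<in> carrier (homs Q x y)"
      then show "?i A \<in> carrier (free_module k ?X)"
        unfolding X by (auto simp: carrier_Q[OF V] val_cls[OF V] scalars_closed)
    next
      fix A B assume "A \<in> carrier (homs Q x y)" "B \<in> carrier (homs Q x y)"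
      then show "?i (A \<oplus>\<^bsub>homs Q x y\<^esub> B) = ?i A \<oplus>\<^bsub>free_module k ?X\<^esub> ?i B"
        by (auto simp: carrier_Q[OF V] val_cls[OF V] add_Q[OF V] scalars_add fun_eq_iff)
    next
      fix c A assume "c \<in> carrier k" "A \<in> carrier (homs Q x y)"
      then show "?i (c \<odot>\<^bsub>homs Q x y\<^esub> A) = c \<odot>\<^bsub>free_module k ?X\<^esub> ?i A"
        by (auto simp: carrier_Q[OF V] val_cls[OF V] smult_Q[OF V] scalars_smult fun_eq_iff)
    qed
    show "linear_map k (free_module k ?X) (homs Q x y) ?p"
      unfolding linear_map_def
    proof (intro conjI ballI funcsetI)
      fix f assume "f \<in> carrier (free_module k ?X)"
      then show "?p f \<in> carrier (homs Q x y)" unfolding X by (simp add: carrier_Q[OF V])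
    next
      fix f g assume "f \<in> carrier (free_module k ?X)" "g \<in> carrier (free_module k ?X)"
      then show "?p (f \<oplus>\<^bsub>free_module k ?X\<^esub> g) = ?p f \<oplus>\<^bsub>homs Q x y\<^esub> ?p g"
        unfolding X by (simp add: add_Q[OF V])
    next
      fix c f assume "c \<in> carrier k" "f \<in> carrier (free_module k ?X)"
      then show "?p (c \<odot>\<^bsub>free_module k ?X\<^esub> f) = c \<odot>\<^bsub>homs Q x y\<^esub> ?p f"
        unfolding X by (simp add: smult_Q[OF V])
    qed
    show "\<forall>A\<in>carrier (homs Q x y). ?p (?i A) = A"
      by (auto simp: carrier_Q[OF V] val_cls[OF V])
  qed
qed

lemma locally_bounded_Q: "locally_bounded Q"
  unfolding locally_bounded_def objects_Q
proof (intro ballI conjI)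
  fix y assume y: "y \<in> vertices n"
  show "finite {x \<in> vertices n. \<not> zero_module (homs Q x y)}"
  proof (rule finite_subset)
    show "{x \<in> vertices n. \<not> zero_module (homs Q x y)} \<subseteq> {1..n} \<times> {snd y..snd y + int n}"
      using y by (clarsimp simp: zero_module_Q_iff) (auto simp: vertices_iff reach_def stars_def)
  qed simp
  show "finite {z \<in> vertices n. \<not> zero_module (homs Q y z)}"
  proof (rule finite_subset)
    show "{z \<in> vertices n. \<not> zero_module (homs Q y z)} \<subseteq> {1..n} \<times> {snd y - int n..snd y}"
      using y by (clarsimp simp: zero_module_Q_iff) (auto simp: vertices_iff reach_def stars_def)
  qed simp
qed

section \<open>The arrow ideal as pseudo-radical\<close>

lemma reach_antisym:
  assumes "reach n x y" "reach n y x"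
  shows "x = y"
  using assms by (auto simp: reach_def stars_def plains_def prod_eq_iff)

text \<open>The counts from \<open>y\<close> to \<open>x\<close> are the negatives of those from
  \<open>x\<close> to \<open>y\<close>, so distinct vertices never reach each other and one of the
  factors is zero.\<close>

lemma cmp_Q_loop:
  assumes "x \<in> vertices n" "y \<in> vertices n" "x \<noteq> y" "f \<in> mor Q x y" "g \<in> mor Q y x"
  shows "cmp Q x y x g f = \<zero>\<^bsub>homs Q x x\<^esub>"
proof -
  obtain c d where c: "c \<in> scalars x y" "f = cls x y c" and d: "d \<in> scalars y x" "g = cls y x d"
    using assms by (auto simp: mor_Q)
  have "c = \<zero> \<or> d = \<zero>"
    using scalars_cases[OF c(1)] scalars_cases[OF d(1)] assms(3) reach_antisym[of x y] by blast
  then have "coef x y x \<otimes> d \<otimes> c = \<zero>" using scalars_closed[OF c(1)] scalars_closed[OF d(1)] by auto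
  then show ?thesis using assms c d by (simp add: cmp_Q zero_Q)
qed

lemma cmp_Q_zero:
  assumes "x \<in> vertices n" "y \<in> vertices n" "z \<in> vertices n" "f \<in> mor Q x y" "g \<in> mor Q y z"
    "f = \<zero>\<^bsub>homs Q x y\<^esub> \<or> g = \<zero>\<^bsub>homs Q y z\<^esub>"
  shows "cmp Q x y z g f = \<zero>\<^bsub>homs Q x z\<^esub>"
proof -
  obtain c d where c: "c \<in> scalars x y" "f = cls x y c" and d: "d \<in> scalars y z" "g = cls y z d"
    using assms by (auto simp: mor_Q)
  have "c = \<zero> \<or> d = \<zero>" using assms(6) c d assms(1-3) by (auto simp: zero_Q cls_inj)
  then have "coef x y z \<otimes> d \<otimes> c = \<zero>" using scalars_closed[OF c(1)] scalars_closed[OF d(1)] by auto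
  then show ?thesis using assms c d by (simp add: cmp_Q zero_Q)
qed

lemma cmp_Q_mor:
  assumes "x \<in> vertices n" "y \<in> vertices n" "z \<in> vertices n" "f \<in> mor Q x y" "g \<in> mor Q y z"
  shows "cmp Q x y z g f \<in> mor Q x z"
proof -
  obtain c d where c: "c \<in> scalars x y" "f = cls x y c" and d: "d \<in> scalars y z" "g = cls y z d"
    using assms by (auto simp: mor_Q)
  show ?thesis
    using scalars_cmp[OF scalars_closed[OF c(1)] scalars_closed[OF d(1)]] assms(1-3) c d
    by (simp add: mor_Q cmp_Q)
qed

text \<open>A plain first arrow lowers the plain count together with its bound and relaxes the bound
  on starred arrows. When no plain arrow is left, a starred one lowers the other count together with
  its bound.\<close>

lemma first_arrow:
  assumes r: "reach n x y" and ne: "x \<noteq> y" and y: "y \<in> vertices n"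
  obtains e h where "e \<in> arcs (rep_quiver n)" "tail (rep_quiver n) e = x" "head (rep_quiver n) e = h"
    "h \<in> vertices n" "reach n h y" "stars h y + plains h y + 1 = stars x y + plains x y"
proof (cases "0 < plains x y")
  case True
  obtain p i where x: "x = (p, i)" by force
  show ?thesis
    by (rule that[of "Arr p i" "(p + 1, i)"])
      (use r True y in \<open>auto simp: x rep_quiver_def reach_def stars_def plains_def\<close>)
next
  case False
  obtain p i where x: "x = (p, i)" by force
  have "plains x y = 0" using False r by (simp add: reach_def)
  moreover have "stars x y \<noteq> 0" using reach_loop[OF r] ne calculation by auto
  ultimately have s: "0 < stars x y" "2 \<le> p" "p \<le> n"
    using r y by (auto simp: x reach_def stars_def plains_def vertices_iff)
  show ?thesis
    by (rule that[of "Arr_star (p - 1) i" "(p - 1, i - 1)"])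
      (use r s y in \<open>auto simp: x rep_quiver_def reach_def stars_def plains_def of_nat_diff\<close>)
qed

lemma factor_arrow:
  assumes V: "x \<in> vertices n" "y \<in> vertices n" and r: "reach n x y" and ne: "x \<noteq> y"
    and c: "c \<in> scalars x y"
  obtains e h d where "e \<in> arcs (rep_quiver n)" "tail (rep_quiver n) e = x"
    "head (rep_quiver n) e = h" "h \<in> vertices n" "stars h y + plains h y + 1 = stars x y + plains x y"
    "reach n h y" "d \<in> scalars h y" "arrow_mor n k e \<in> mor Q x h"
    "cls x y c = cmp Q x h y (cls h y d) (arrow_mor n k e)"
proof -
  obtain e h where e: "e \<in> arcs (rep_quiver n)" "tail (rep_quiver n) e = x"
    "head (rep_quiver n) e = h" "h \<in> vertices n" "reach n h y"
    "stars h y + plains h y + 1 = stars x y + plains x y"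
    using first_arrow[OF r ne V(2)] .
  \<comment> \<open>The structure constant is a sign here, so multiplying by it once more cancels it
    in the composite.\<close>
  let ?d = "coef x h y \<otimes> c"
  have d: "?d \<in> scalars h y" using scalars_closed[OF c] e(5) by (simp add: scalars_def)
  have "reach n x h" using e(1-3) by (cases e) (auto simp: rep_quiver_def reach_def stars_def plains_def)
  then have one: "\<one> \<in> scalars x h" by (simp add: scalars_def)
  have "coef x h y \<otimes> ?d \<otimes> \<one> = c"
    using r scalars_closed[OF c] by (simp add: coef_def)
  then have "cls x y c = cmp Q x h y (cls h y ?d) (arrow_mor n k e)"
    using cmp_Q[OF V(1) e(4) V(2) one d] by (simp add: arrow_mor_eq[OF e(1-3)])
  then show ?thesis
    using that[OF e(1-4,6,5) d] one V e by (auto simp: arrow_mor_eq[OF e(1-3)] mor_Q)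
qed

text \<open>Off the diagonal every nonzero morphism factors through a first arrow. On the diagonal
  nothing survives, since loops through another vertex are zero.\<close>

lemma arrow_ideal_eq:
  assumes V: "x \<in> vertices n" "y \<in> vertices n"
  shows "arrow_ideal n k x y = (if x = y then {\<zero>\<^bsub>homs Q x y\<^esub>} else mor Q x y)"
proof
  let ?r = "\<lambda>x y. if x = y then {\<zero>\<^bsub>homs Q x y\<^esub>} else mor Q x y"
  let ?S = "\<lambda>x y. {arrow_mor n k e | e. e \<in> arcs (rep_quiver n) \<and>
                 tail (rep_quiver n) e = x \<and> head (rep_quiver n) e = y}"
  have zmor: "\<zero>\<^bsub>homs Q u v\<^esub> \<in> mor Q u v" if "u \<in> vertices n" "v \<in> vertices n" for u v
    using that by (auto simp: mor_Q zero_Q)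
  have rmor: "f \<in> mor Q u v" if "f \<in> ?r u v" "u \<in> vertices n" "v \<in> vertices n" for u v f
    using that zmor[OF that(2,3)] by (cases "u = v") simp_all
  have ideal: "cat_ideal k Q ?r"
    unfolding cat_ideal_def objects_Q
  proof (intro conjI ballI)
    fix u v assume "u \<in> vertices n" "v \<in> vertices n"
    then show "submodule (?r u v) k (homs Q u v)"
      using submodule_zero_Q[of u v] submodule_carrier_Q[of u v] by (cases "u = v") (simp_all add: mor_def)
  next
    fix u v w f g assume a: "u \<in> vertices n" "v \<in> vertices n" "w \<in> vertices n" "f \<in> ?r u v" "g \<in> mor Q v w"
    note f = rmor[OF a(4,1,2)]
    \<comment> \<open>If the composite is an endomorphism, either its factor from the ideal is an
      endomorphism and hence zero, or the composite runs around a loop.\<close>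
    have "cmp Q u v w g f = \<zero>\<^bsub>homs Q u w\<^esub>" if "u = w"
    proof (cases "u = v")
      case True
      with a(4) have "f = \<zero>\<^bsub>homs Q u v\<^esub>" by simp
      then show ?thesis using cmp_Q_zero[OF a(1-3) f a(5)] by blast
    next
      case False
      then show ?thesis using cmp_Q_loop[OF a(1,2) False f] a(5) that by blast
    qed
    then show "cmp Q u v w g f \<in> ?r u w" using cmp_Q_mor[OF a(1-3) f a(5)] by auto
  next
    fix u v w f g assume a: "u \<in> vertices n" "v \<in> vertices n" "w \<in> vertices n" "f \<in> mor Q u v" "g \<in> ?r v w"
    note g = rmor[OF a(5,2,3)]
    have "cmp Q u v w g f = \<zero>\<^bsub>homs Q u w\<^esub>" if "u = w"
    proof (cases "v = w")
      case True
      with a(5) have "g = \<zero>\<^bsub>homs Q v w\<^esub>" by simp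
      then show ?thesis using cmp_Q_zero[OF a(1-4) g] by blast
    next
      case False
      then show ?thesis using cmp_Q_loop[OF a(1,2) _ a(4)] g that by blast
    qed
    then show "cmp Q u v w g f \<in> ?r u w" using cmp_Q_mor[OF a(1-4) g] by auto
  qed
  show "arrow_ideal n k x y \<subseteq> ?r x y"
  proof -
    have S: "\<forall>u\<in>objects Q. \<forall>v\<in>objects Q. ?S u v \<subseteq> ?r u v"
    proof (intro ballI subsetI)
      fix u v f assume uv: "u \<in> objects Q" "v \<in> objects Q" and "f \<in> ?S u v"
      then obtain e where e: "e \<in> arcs (rep_quiver n)" "tail (rep_quiver n) e = u"
        "head (rep_quiver n) e = v" "f = arrow_mor n k e" by blast
      have "u \<noteq> v" "reach n u v"
        using e(1-3) by (cases e; auto simp: rep_quiver_def reach_def stars_def plains_def)+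
      moreover have "f \<in> mor Q u v"
        using uv \<open>reach n u v\<close> by (auto simp: e(4) arrow_mor_eq[OF e(1-3)] mor_Q scalars_def)
      ultimately show "f \<in> ?r u v" by simp
    qed
    show ?thesis
      unfolding arrow_ideal_def generated_ideal_def
      by (rule Inter_lower, rule CollectI, rule exI[of _ ?r], intro conjI refl ideal S)
  qed
  show "?r x y \<subseteq> arrow_ideal n k x y"
    unfolding arrow_ideal_def generated_ideal_def
  proof (intro subsetI InterI)
    fix f J assume f: "f \<in> ?r x y"
      and "J \<in> {I x y | I. cat_ideal k Q I \<and> (\<forall>u\<in>objects Q. \<forall>v\<in>objects Q. ?S u v \<subseteq> I u v)}"
    then obtain I where J: "J = I x y" and I: "cat_ideal k Q I"
      and S: "\<forall>u\<in>objects Q. \<forall>v\<in>objects Q. ?S u v \<subseteq> I u v" by blast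
    have zero: "\<zero>\<^bsub>homs Q x y\<^esub> \<in> I x y"
      using I V by (intro submodule_Q_zero) (simp add: cat_ideal_def)
    show "f \<in> J"
      unfolding J
    proof (cases "x \<noteq> y \<and> reach n x y")
      case True
      then obtain c where c: "c \<in> scalars x y" "f = cls x y c" using f V by (auto simp: mor_Q)
      obtain e h d where e: "e \<in> arcs (rep_quiver n)" "tail (rep_quiver n) e = x"
        "head (rep_quiver n) e = h" "h \<in> vertices n" "d \<in> scalars h y" "arrow_mor n k e \<in> mor Q x h"
        "cls x y c = cmp Q x h y (cls h y d) (arrow_mor n k e)"
        using factor_arrow[OF V conjunct2[OF True] conjunct1[OF True] c(1)] .
      have "arrow_mor n k e \<in> ?S x h" using e(1-3) by blast
      then have "arrow_mor n k e \<in> I x h" using S V(1) e(4) unfolding objects_Q by blast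
      moreover have "cls h y d \<in> mor Q h y" using V e by (simp add: mor_Q)
      ultimately have "cmp Q x h y (cls h y d) (arrow_mor n k e) \<in> I x y"
        using I V e(4) unfolding cat_ideal_def objects_Q by blast
      then show "f \<in> I x y" using c(2) e(7) by simp
    next
      case False
      have "f = \<zero>\<^bsub>homs Q x y\<^esub>"
      proof (cases "x = y")
        case neq: False
        then have "\<not> reach n x y" "f \<in> mor Q x y" using f False by auto
        then show ?thesis using V by (auto simp: mor_Q zero_Q scalars_def)
      qed (use f in simp)
      then show "f \<in> I x y" using zero by simp
    qed
  qed
qed

lemma retraction_complement_arrow_ideal: "retraction_complement k Q (\<lambda>x. arrow_ideal n k x x)"
  unfolding retraction_complement_def objects_Q
proof (intro ballI conjI impI)
  fix x assume x: "x \<in> vertices n"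
  have zero: "\<zero>\<^bsub>homs Q x x\<^esub> \<in> mor Q x x" using x by (auto simp: mor_Q zero_Q)
  show "submodule (arrow_ideal n k x x) k (homs Q x x)"
    using x by (simp add: arrow_ideal_eq submodule_zero_Q)
  \<comment> \<open>Every endomorphism is a multiple of the identity, so the zero module is a
    complement.\<close>
  have "{c \<odot>\<^bsub>homs Q x x\<^esub> ident Q x | c. c \<in> carrier k} = carrier (homs Q x x)"
  proof -
    have "scalars x x = carrier k" using reach_refl[OF x] by (simp add: scalars_def)
    then show ?thesis
      using smult_Q[OF x x scalars_one[OF x]] by (auto simp: ident_Q[OF x] carrier_Q[OF x x])
  qed
  moreover have "carrier (homs Q x x) <+>\<^bsub>homs Q x x\<^esub> {\<zero>\<^bsub>homs Q x x\<^esub>} = carrier (homs Q x x)"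
  proof -
    interpret M: module k "homs Q x x" by (rule module_Q[OF x x])
    show ?thesis by (auto simp: set_add_def')
  qed
  ultimately show "internal_direct_sum (homs Q x x) {c \<odot>\<^bsub>homs Q x x\<^esub> ident Q x | c. c \<in> carrier k}
      (arrow_ideal n k x x)"
    using x zero by (auto simp: internal_direct_sum_def arrow_ideal_eq mor_def)
  show "cmp Q x x x g f \<in> arrow_ideal n k x x"
    if "f \<in> arrow_ideal n k x x" "g \<in> arrow_ideal n k x x" for f g
    using that x zero by (simp add: arrow_ideal_eq cmp_Q_zero)
  show "cmp Q x y x g f \<in> arrow_ideal n k x x"
    if "y \<in> vertices n" "x \<noteq> y" "f \<in> mor Q x y" "g \<in> mor Q y x" for y f g
    using that x by (simp add: arrow_ideal_eq cmp_Q_loop)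
qed

lemma strong_retraction_Q: "strong_retraction_property k Q"
  unfolding strong_retraction_property_def objects_Q
proof (intro conjI ballI)
  fix x assume x: "x \<in> vertices n"
  show "\<exists>r. linear_map k (homs Q x x) (regular_module k) r \<and>
        (\<forall>c\<in>carrier k. r (c \<odot>\<^bsub>homs Q x x\<^esub> ident Q x) = c)"
  proof (intro exI conjI)
    show "linear_map k (homs Q x x) (regular_module k) (val x x)"
      unfolding linear_map_def regular_module_def
      by (auto simp: carrier_Q x val_cls add_Q smult_Q scalars_closed scalars_add scalars_smult)
    show "\<forall>c\<in>carrier k. val x x (c \<odot>\<^bsub>homs Q x x\<^esub> ident Q x) = c"
      using x by (auto simp: ident_Q smult_Q scalars_one val_cls scalars_def reach_refl)
  qed
qed (use retraction_complement_arrow_ideal in blast)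

text \<open>The composites of \<open>m\<close> arrows only meet hom modules with \<open>m\<close> arrows in each path, and paths
  inside a rectangle have fewer than \<open>n\<close> arrows.\<close>

lemma ideal_power_arrow_ideal:
  assumes "x \<in> vertices n" "y \<in> vertices n" "f \<in> ideal_power k Q (arrow_ideal n k) m x y"
  shows "f \<in> mor Q x y" "f \<noteq> \<zero>\<^bsub>homs Q x y\<^esub> \<Longrightarrow> int m \<le> stars x y + plains x y"
proof -
  have "f \<in> mor Q x y \<and> (f = \<zero>\<^bsub>homs Q x y\<^esub> \<or> int m \<le> stars x y + plains x y)"
    using assms
  proof (induction m arbitrary: x y f)
    case 0
    then show ?case
      by (auto simp: mor_Q zero_Q reach_def dest!: scalars_cases)
  next
    case (Suc m)
    \<comment> \<open>A submodule containing the generating composites, and therefore their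
      span.\<close>
    let ?N = "if int (Suc m) \<le> stars x y + plains x y then mor Q x y else {\<zero>\<^bsub>homs Q x y\<^esub>}"
    let ?G = "{cmp Q x u y g h | u g h. u \<in> objects Q \<and> g \<in> arrow_ideal n k u y \<and>
                h \<in> ideal_power k Q (arrow_ideal n k) m x u}"
    have "submodule ?N k (homs Q x y)"
      using Suc.prems submodule_zero_Q submodule_carrier_Q by (simp add: mor_def)
    moreover have "?G \<subseteq> ?N"
    proof (intro subsetI, clarify)
      fix u g h
      assume u: "u \<in> objects Q" and g: "g \<in> arrow_ideal n k u y"
        and h: "h \<in> ideal_power k Q (arrow_ideal n k) m x u"
      have V: "x \<in> vertices n" "u \<in> vertices n" "y \<in> vertices n" using u Suc.prems by auto
      have IH: "h \<in> mor Q x u" "h = \<zero>\<^bsub>homs Q x u\<^esub> \<or> int m \<le> stars x u + plains x u"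
        using Suc.IH[OF V(1,2) h] by auto
      have gm: "g \<in> mor Q u y" "u = y \<Longrightarrow> g = \<zero>\<^bsub>homs Q u y\<^esub>"
        using g V by (auto simp: arrow_ideal_eq mor_Q zero_Q split: if_splits)
      show "cmp Q x u y g h \<in> ?N"
      proof (cases "h = \<zero>\<^bsub>homs Q x u\<^esub> \<or> g = \<zero>\<^bsub>homs Q u y\<^esub>")
        case True
        then have "cmp Q x u y g h = \<zero>\<^bsub>homs Q x y\<^esub>" using V IH(1) gm(1) by (intro cmp_Q_zero) auto
        then show ?thesis using V by (auto simp: mor_Q zero_Q)
      next
        case False
        then have ne: "u \<noteq> y" using gm(2) by auto
        \<comment> \<open>A nonzero member of the arrow ideal joins distinct vertices, so it
          contributes at least one arrow.\<close>
        have "reach n u y" using gm(1) False V by (auto simp: mor_Q zero_Q dest!: scalars_cases)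
        then have "stars u y + plains u y \<noteq> 0" "0 \<le> stars u y" "0 \<le> plains u y"
          using reach_loop[of n u y] ne by (blast, simp_all add: reach_def)
        then have "1 \<le> stars u y + plains u y" by linarith
        then have "int (Suc m) \<le> stars x y + plains x y"
          using IH(2) False stars_plus[of x u y] plains_plus[of x u y] by auto
        then show ?thesis using cmp_Q_mor[OF V IH(1) gm(1)] by simp
      qed
    qed
    ultimately have "ideal_power k Q (arrow_ideal n k) (Suc m) x y \<subseteq> ?N"
      unfolding ideal_power.simps ideal_prod_def module_span_def by (intro Inter_lower) simp
    then have "f \<in> ?N" using Suc.prems(3) by blast
    then show ?case using Suc.prems(1,2) by (auto simp: mor_Q zero_Q split: if_splits)
  qed
  then show "f \<in> mor Q x y" "f \<noteq> \<zero>\<^bsub>homs Q x y\<^esub> \<Longrightarrow> int m \<le> stars x y + plains x y" by auto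
qed

lemma arrow_ideal_nilpotent:
  assumes V: "x \<in> vertices n" "y \<in> vertices n"
  shows "ideal_power k Q (arrow_ideal n k) n x y = {\<zero>\<^bsub>homs Q x y\<^esub>}"
proof
  show "ideal_power k Q (arrow_ideal n k) n x y \<subseteq> {\<zero>\<^bsub>homs Q x y\<^esub>}"
  proof
    fix f assume f: "f \<in> ideal_power k Q (arrow_ideal n k) n x y"
    show "f \<in> {\<zero>\<^bsub>homs Q x y\<^esub>}"
    proof (rule ccontr)
      assume "f \<notin> {\<zero>\<^bsub>homs Q x y\<^esub>}"
      then have l: "int n \<le> stars x y + plains x y" and ne: "f \<noteq> \<zero>\<^bsub>homs Q x y\<^esub>"
        using ideal_power_arrow_ideal(2)[OF V f] by auto
      have "reach n x y"
        using ideal_power_arrow_ideal(1)[OF V f] ne V by (auto simp: mor_Q zero_Q dest!: scalars_cases)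
      \<comment> \<open>The two upper bounds in \<open>reach\<close> add up to
        \<open>n - 1\<close>.\<close>
      then show False using l by (auto simp: reach_def)
    qed
  qed
  \<comment> \<open>A positive power is a span and so contains zero.\<close>
  obtain m where m: "n = Suc m" using n_ge_2 by (cases n) auto
  have "\<zero>\<^bsub>homs Q x y\<^esub> \<in> ideal_power k Q (arrow_ideal n k) (Suc m) x y"
    unfolding ideal_power.simps ideal_prod_def module_span_def using submodule_Q_zero by blast
  then show "{\<zero>\<^bsub>homs Q x y\<^esub>} \<subseteq> ideal_power k Q (arrow_ideal n k) n x y"
    using m by simp
qed

end

section \<open>The Serre functor\<close>

definition serre_ob :: "nat \<Rightarrow> nat \<times> int \<Rightarrow> nat \<times> int" where
  "serre_ob n x = (n + 1 - fst x, snd x + 1 - int (fst x))"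

text \<open>The second coordinate solves \<open>j + 1 - p = i\<close> for
  \<open>p = n + 1 - q\<close>.\<close>

definition serre_ob_inv :: "nat \<Rightarrow> nat \<times> int \<Rightarrow> nat \<times> int" where
  "serre_ob_inv n x = (n + 1 - fst x, snd x + int n - int (fst x))"

text \<open>The signs are forced by the trace forms on the modules $Q(x, \mathbb{S} x)$; the form at
  \<open>(q, i)\<close> carries the sign of parity \<open>triangle q\<close>, so that consecutive forms differ by \<open>(-1)^q\<close>.\<close>

definition triangle :: "nat \<Rightarrow> int" where
  "triangle q = int q * (int q - 1) div 2"

text \<open>For \<open>f\<close> from \<open>x\<close> to \<open>y\<close> with counts a, b and g
  from \<open>y\<close> to S x, put p = \<open>fst x\<close>. Then g f has exponent a (n - p - b)
  and S(f) g has exponent (p - 1 - a) a, with sum a (n - 1 - a - b). The triangular terms come from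
  the forms at the two ends.\<close>

definition serre_sign :: "nat \<Rightarrow> nat \<times> int \<Rightarrow> nat \<times> int \<Rightarrow> int" where
  "serre_sign n x y = triangle (fst x) + triangle (fst y) +
     stars x y * (int n - 1 - stars x y - plains x y)"

text \<open>The square has the parity of \<open>q\<close>, which gives the sign of S on the plain
  arrow at \<open>q\<close>.\<close>

lemma triangle_Suc: "triangle (q + 1) + triangle q = int q * int q"
proof -
  have "2 * triangle m = int m * (int m - 1)" for m by (simp add: triangle_def)
  from this[of "q + 1"] this[of q] show ?thesis by (simp add: algebra_simps)
qed

lemma serre_ob_vertices: "x \<in> vertices n \<Longrightarrow> serre_ob n x \<in> vertices n"
  by (auto simp: serre_ob_def vertices_iff)

lemma serre_ob_inv_vertices: "x \<in> vertices n \<Longrightarrow> serre_ob_inv n x \<in> vertices n"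
  by (auto simp: serre_ob_inv_def vertices_iff)

lemma serre_ob_inverse:
  assumes "x \<in> vertices n"
  shows "serre_ob n (serre_ob_inv n x) = x" "serre_ob_inv n (serre_ob n x) = x"
  using assms by (auto simp: serre_ob_def serre_ob_inv_def vertices_iff prod_eq_iff of_nat_diff)

lemma serre_ob_counts:
  assumes "x \<in> vertices n" "y \<in> vertices n"
  shows "stars (serre_ob n x) (serre_ob n y) = plains x y"
    and "plains (serre_ob n x) (serre_ob n y) = stars x y"
    and "stars y (serre_ob n x) = int (fst x) - 1 - stars x y"
    and "plains y (serre_ob n x) = int n - int (fst x) - plains x y"
  using assms by (auto simp: serre_ob_def vertices_iff stars_def plains_def of_nat_diff)

lemma fst_eq_counts: "int (fst y) = int (fst x) + plains x y - stars x y"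
  by (simp add: stars_def plains_def)

text \<open>The counts from \<open>y\<close> to the far vertex are complementary to those from
  \<open>x\<close> to \<open>y\<close>, so lower bounds turn into upper bounds and conversely; this
  gives the second equivalence. The first holds because S exchanges the counts together with their
  bounds.\<close>

lemma reach_serre_ob:
  assumes "x \<in> vertices n" "y \<in> vertices n"
  shows "reach n (serre_ob n x) (serre_ob n y) \<longleftrightarrow> reach n x y"
    and "reach n y (serre_ob n x) \<longleftrightarrow> reach n x y"
    and "reach n x (serre_ob n x)"
proof -
  have f: "int (fst (serre_ob n x)) = int n + 1 - int (fst x)"
    using assms by (auto simp: serre_ob_def vertices_iff of_nat_diff)
  show "reach n (serre_ob n x) (serre_ob n y) \<longleftrightarrow> reach n x y"
    unfolding reach_def serre_ob_counts[OF assms] f by auto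
  show "reach n y (serre_ob n x) \<longleftrightarrow> reach n x y"
    unfolding reach_def serre_ob_counts[OF assms] fst_eq_counts[of y x] by auto
  have "stars x x = 0" "plains x x = 0" by (simp_all add: stars_def plains_def)
  then show "reach n x (serre_ob n x)"
    using assms(1) unfolding reach_def serre_ob_counts[OF assms(1,1)] by (auto simp: vertices_iff)
qed

section \<open>Functors that rescale coordinates by signs\<close>

context mesh
begin

definition twist :: "(nat \<times> int \<Rightarrow> nat \<times> int) \<Rightarrow> (nat \<times> int \<Rightarrow> nat \<times> int \<Rightarrow> 'a) \<Rightarrow>
  (nat \<times> int, (rep_arrow list \<Rightarrow> 'a) set, nat \<times> int, (rep_arrow list \<Rightarrow> 'a) set) functor_data" where
  "twist F s = \<lparr>on_ob = F, on_mor = (\<lambda>x y A. cls (F x) (F y) (s x y \<otimes> val x y A))\<rparr>"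

lemma twist_simps [simp]:
  "on_ob (twist F s) = F"
  "on_mor (twist F s) = (\<lambda>x y A. cls (F x) (F y) (s x y \<otimes> val x y A))"
  by (simp_all add: twist_def)

text \<open>Functoriality means that \<open>s\<close> is a cochain whose coboundary compares the
  cocycle \<open>coef\<close> with its pullback along \<open>F\<close>.\<close>

lemma linear_functor_twist:
  assumes F: "\<And>x. x \<in> vertices n \<Longrightarrow> F x \<in> vertices n"
    and reach: "\<And>x y. x \<in> vertices n \<Longrightarrow> y \<in> vertices n \<Longrightarrow> reach n (F x) (F y) \<longleftrightarrow> reach n x y"
    and s: "\<And>x y. s x y \<in> carrier k"
    and one: "\<And>x. x \<in> vertices n \<Longrightarrow> s x x = \<one>"
    and coef: "\<And>x y z. x \<in> vertices n \<Longrightarrow> y \<in> vertices n \<Longrightarrow> z \<in> vertices n \<Longrightarrow>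
      reach n x y \<Longrightarrow> reach n y z \<Longrightarrow> reach n x z \<Longrightarrow>
      s x z \<otimes> coef x y z = coef (F x) (F y) (F z) \<otimes> s y z \<otimes> s x y"
  shows "linear_functor k Q Q (twist F s)"
  unfolding linear_functor_def objects_Q twist_simps
proof (intro conjI ballI)
  have scal: "scalars (F x) (F y) = scalars x y" if "x \<in> vertices n" "y \<in> vertices n" for x y
    using reach[OF that] by (simp add: scalars_def)
  show "F \<in> vertices n \<rightarrow> vertices n" using F by blast
  show "linear_map k (homs Q x y) (homs Q (F x) (F y)) (\<lambda>A. cls (F x) (F y) (s x y \<otimes> val x y A))"
    if "x \<in> vertices n" "y \<in> vertices n" for x y
  proof (rule linear_map_QI[where m = "s x y"])
    fix c assume c: "c \<in> scalars x y"
    show "s x y \<otimes> c \<in> scalars (F x) (F y)" using scalars_smult[OF s c] scal[OF that] by simp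
    show "cls (F x) (F y) (s x y \<otimes> val x y (cls x y c)) = cls (F x) (F y) (s x y \<otimes> c)"
      using c that by (simp add: val_cls)
  qed (use that F s in auto)
  show "cls (F x) (F x) (s x x \<otimes> val x x (ident Q x)) = ident Q (F x)" if "x \<in> vertices n" for x
    using that by (simp add: ident_Q F val_cls scalars_one one)
  show "cls (F x) (F z) (s x z \<otimes> val x z (cmp Q x y z g f)) =
      cmp Q (F x) (F y) (F z) (cls (F y) (F z) (s y z \<otimes> val y z g)) (cls (F x) (F y) (s x y \<otimes> val x y f))"
    if V: "x \<in> vertices n" "y \<in> vertices n" "z \<in> vertices n" and f: "f \<in> mor Q x y" and g: "g \<in> mor Q y z"
    for x y z f g
  proof -
    obtain c d where c: "c \<in> scalars x y" "f = cls x y c" and d: "d \<in> scalars y z" "g = cls y z d"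
      using V f g by (auto simp: mor_Q)
    note cl = scalars_closed[OF c(1)] scalars_closed[OF d(1)]
    \<comment> \<open>The coboundary equation is assumed only when all three pairs are reached;
      otherwise a coordinate or both structure constants vanish.\<close>
    have "s x z \<otimes> (coef x y z \<otimes> d \<otimes> c) =
        coef (F x) (F y) (F z) \<otimes> (s y z \<otimes> d) \<otimes> (s x y \<otimes> c)"
    proof (cases "c = \<zero> \<or> d = \<zero> \<or> \<not> reach n x z")
      case True
      then show ?thesis
        using cl s[of x y] s[of y z] s[of x z] reach[OF V(1,3)] by (auto simp: coef_def)
    next
      case False
      then have r: "reach n x y" "reach n y z" "reach n x z"
        using scalars_cases[OF c(1)] scalars_cases[OF d(1)] by blast+
      have "s x z \<otimes> (coef x y z \<otimes> d \<otimes> c) = (s x z \<otimes> coef x y z) \<otimes> (d \<otimes> c)"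
        using cl s by (simp add: m_assoc)
      also have "\<dots> = (coef (F x) (F y) (F z) \<otimes> s y z \<otimes> s x y) \<otimes> (d \<otimes> c)"
        by (simp only: coef[OF V r])
      also have "\<dots> = coef (F x) (F y) (F z) \<otimes> (s y z \<otimes> d) \<otimes> (s x y \<otimes> c)"
        using cl s by (simp add: m_ac)
      finally show ?thesis .
    qed
    moreover have "s x y \<otimes> c \<in> scalars (F x) (F y)" "s y z \<otimes> d \<in> scalars (F y) (F z)"
      using scalars_smult[OF s c(1)] scalars_smult[OF s d(1)] scal V by simp_all
    ultimately show ?thesis
      using V F c d scalars_cmp[OF cl, of x y z] by (simp add: cmp_Q val_cls)
  qed
qed

abbreviation ssign :: "nat \<times> int \<Rightarrow> nat \<times> int \<Rightarrow> 'a" where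
  "ssign x y \<equiv> parity_sign k (serre_sign n x y)"

definition serre :: "(nat \<times> int, (rep_arrow list \<Rightarrow> 'a) set, nat \<times> int, (rep_arrow list \<Rightarrow> 'a) set) functor_data"
  where "serre = twist (serre_ob n) ssign"

definition serre_inv :: "(nat \<times> int, (rep_arrow list \<Rightarrow> 'a) set, nat \<times> int, (rep_arrow list \<Rightarrow> 'a) set) functor_data"
  where "serre_inv = twist (serre_ob_inv n) (\<lambda>x y. ssign (serre_ob_inv n x) (serre_ob_inv n y))"

lemma parity_sign_eqI: "m = l + 2 * t \<Longrightarrow> parity_sign k m = parity_sign k l"
  by (rule parity_sign_cong) simp

lemma serre_sign_refl: "ssign x x = \<one>"
proof -
  have "ssign x x = parity_sign k 0"
    by (rule parity_sign_eqI[of _ _ "triangle (fst x)"]) (simp add: serre_sign_def stars_def)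
  then show ?thesis by simp
qed

text \<open>S exchanges the counts, so its cocycle is the transpose of the original one. The cross
  terms of the quadratic expression make up for this modulo 2, and the triangular number of the
  middle vertex occurs twice.\<close>

lemma serre_sign_coef:
  assumes V: "x \<in> vertices n" "y \<in> vertices n" "z \<in> vertices n" and r: "reach n x z"
  shows "ssign x z \<otimes> coef x y z =
    coef (serre_ob n x) (serre_ob n y) (serre_ob n z) \<otimes> ssign y z \<otimes> ssign x y"
proof -
  let ?l = "serre_sign n x z + stars x y * plains y z"
  let ?r = "plains x y * stars y z + serre_sign n y z + serre_sign n x y"
  have "?l = ?r + 2 * (- triangle (fst y) - stars x y * stars y z - stars y z * plains x y)"
    unfolding serre_sign_def stars_plus[of x y z, symmetric] plains_plus[of x y z, symmetric]
    by (simp add: algebra_simps)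
  then have "parity_sign k ?l = parity_sign k ?r" by (rule parity_sign_eqI)
  then show ?thesis
    using r reach_serre_ob(1)[OF V(1,3)]
    by (simp add: coef_def serre_ob_counts V flip: parity_sign_add)
qed

lemma linear_functor_serre: "linear_functor k Q Q serre"
  unfolding serre_def
  by (rule linear_functor_twist)
    (simp_all add: serre_ob_vertices reach_serre_ob serre_sign_refl serre_sign_coef)

lemma linear_functor_serre_inv: "linear_functor k Q Q serre_inv"
  unfolding serre_inv_def
proof (rule linear_functor_twist)
  let ?G = "serre_ob_inv n"
  have G: "reach n (?G x) (?G y) \<longleftrightarrow> reach n x y" if "x \<in> vertices n" "y \<in> vertices n" for x y
    using reach_serre_ob(1)[of "?G x" n "?G y"] that by (simp add: serre_ob_inv_vertices serre_ob_inverse)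
  then show "reach n (?G x) (?G y) \<longleftrightarrow> reach n x y" if "x \<in> vertices n" "y \<in> vertices n" for x y
    using that by blast
  show "ssign (?G x) (?G z) \<otimes> coef x y z =
      coef (?G x) (?G y) (?G z) \<otimes> ssign (?G y) (?G z) \<otimes> ssign (?G x) (?G y)"
    if V: "x \<in> vertices n" "y \<in> vertices n" "z \<in> vertices n" and r: "reach n x z" for x y z
  proof -
    have V': "?G x \<in> vertices n" "?G y \<in> vertices n" "?G z \<in> vertices n"
      using V by (simp_all add: serre_ob_inv_vertices)
    have "ssign (?G x) (?G z) \<otimes> coef (?G x) (?G y) (?G z) =
        coef x y z \<otimes> ssign (?G y) (?G z) \<otimes> ssign (?G x) (?G y)" (is "?a \<otimes> ?b = ?c \<otimes> ?d \<otimes> ?e")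
      using serre_sign_coef[OF V'] r G[OF V(1,3)] by (simp add: serre_ob_inverse V)
    \<comment> \<open>Signs are their own inverses, so multiplying by all of \<open>?a\<close>,
      \<open>?d\<close> and \<open>?e\<close> moves them to the opposite sides.\<close>
    then have "?a \<otimes> (?a \<otimes> ?b) \<otimes> (?d \<otimes> ?e) = ?a \<otimes> (?c \<otimes> ?d \<otimes> ?e) \<otimes> (?d \<otimes> ?e)" by simp
    moreover have "?a \<otimes> (?a \<otimes> ?b) \<otimes> (?d \<otimes> ?e) = ?b \<otimes> ?d \<otimes> ?e" by (simp add: m_assoc)
    moreover have "?a \<otimes> (?c \<otimes> ?d \<otimes> ?e) \<otimes> (?d \<otimes> ?e) = ?a \<otimes> ?c" by (simp add: m_ac)
    ultimately show ?thesis by simp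
  qed
qed (simp_all add: serre_ob_inv_vertices serre_sign_refl)

text \<open>The same sign is applied twice, so the composites are identities on the nose, and
  identities can serve as the natural isomorphisms.\<close>

lemma serre_inverse:
  assumes V: "x \<in> vertices n" "y \<in> vertices n" and f: "f \<in> mor Q x y"
  shows "on_mor (comp_functor serre_inv serre) x y f = f"
    and "on_mor (comp_functor serre serre_inv) x y f = f"
proof -
  obtain c where c: "c \<in> scalars x y" "f = cls x y c" using V f by (auto simp: mor_Q)
  have s: "ssign u v \<otimes> c \<in> scalars (serre_ob n x) (serre_ob n y)" for u v
    using c reach_serre_ob(1)[OF V] by (auto simp: scalars_def)
  have r: "reach n (serre_ob_inv n x) (serre_ob_inv n y) \<longleftrightarrow> reach n x y"
    using reach_serre_ob(1)[of "serre_ob_inv n x" n "serre_ob_inv n y"] V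
    by (simp add: serre_ob_inv_vertices serre_ob_inverse)
  then have t: "ssign u v \<otimes> c \<in> scalars (serre_ob_inv n x) (serre_ob_inv n y)" for u v
    using c by (auto simp: scalars_def)
  show "on_mor (comp_functor serre_inv serre) x y f = f"
    using V c s scalars_closed[OF c(1)]
    by (simp add: comp_functor_def serre_def serre_inv_def val_cls serre_ob_vertices serre_ob_inverse)
  show "on_mor (comp_functor serre serre_inv) x y f = f"
    using V c t scalars_closed[OF c(1)]
    by (simp add: comp_functor_def serre_def serre_inv_def val_cls serre_ob_inv_vertices serre_ob_inverse)
qed

interpretation preadditive_category k Q
  by (rule preadditive_Q)

lemma iso_mor_ident: "x \<in> vertices n \<Longrightarrow> iso_mor Q x x (ident Q x)"
  unfolding iso_mor_def using ident_mor[of x] cmp_ident_left[of x x "ident Q x"] by auto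

lemma linear_equivalence_serre: "linear_equivalence k Q Q serre"
  unfolding linear_equivalence_def
proof (intro conjI exI)
  have ob: "on_ob (comp_functor serre_inv serre) x = x" "on_ob (comp_functor serre serre_inv) x = x"
    if "x \<in> vertices n" for x
    using that by (simp_all add: comp_functor_def serre_def serre_inv_def serre_ob_inverse)
  show "naturally_isomorphic Q Q id_functor (comp_functor serre_inv serre)"
    unfolding naturally_isomorphic_def
    by (rule exI[of _ "ident Q"])
      (simp add: ob id_functor_def iso_mor_ident serre_inverse cmp_ident_left cmp_ident_right)
  show "naturally_isomorphic Q Q (comp_functor serre serre_inv) id_functor"
    unfolding naturally_isomorphic_def
    by (rule exI[of _ "ident Q"])
      (simp add: ob id_functor_def iso_mor_ident serre_inverse cmp_ident_left cmp_ident_right)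
qed (rule linear_functor_serre linear_functor_serre_inv)+

section \<open>The duality pairing\<close>

definition trace_sign :: "nat \<times> int \<Rightarrow> nat \<times> int \<Rightarrow> 'a" where
  "trace_sign x y = parity_sign k (triangle (fst x)) \<otimes> coef x y (serre_ob n x)"

text \<open>The coordinate of the composite in Q(x, S x), times the sign of the form at
  \<open>x\<close>. The restriction to morphisms makes it extensional, as the members of
  \<open>dual_module\<close> are.\<close>

definition pairing :: "nat \<times> int \<Rightarrow> nat \<times> int \<Rightarrow> (rep_arrow list \<Rightarrow> 'a) set \<Rightarrow> (rep_arrow list \<Rightarrow> 'a) set \<Rightarrow> 'a"
  where "pairing x y f =
    (\<lambda>g\<in>mor Q y (serre_ob n x). trace_sign x y \<otimes> val y (serre_ob n x) g \<otimes> val x y f)"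

lemma trace_sign_closed [simp, intro]: "trace_sign x y \<in> carrier k"
  by (simp add: trace_sign_def)

lemma trace_sign_square: "x \<in> vertices n \<Longrightarrow> trace_sign x y \<otimes> trace_sign x y = \<one>"
  using reach_serre_ob(3)[of x n] by (simp add: trace_sign_def coef_def m_ac)

lemma pairing_cls:
  assumes "x \<in> vertices n" "y \<in> vertices n" "c \<in> scalars x y" "d \<in> scalars y (serre_ob n x)"
  shows "pairing x y (cls x y c) (cls y (serre_ob n x) d) = trace_sign x y \<otimes> d \<otimes> c"
  using assms by (simp add: pairing_def mor_Q serre_ob_vertices val_cls)

lemma scalars_serre_ob:
  "x \<in> vertices n \<Longrightarrow> y \<in> vertices n \<Longrightarrow> scalars y (serre_ob n x) = scalars x y"
  by (simp add: scalars_def reach_serre_ob)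

text \<open>The module is cyclic, so a functional is determined by its value \<open>a\<close> at the
  class of \<open>unit_scalar x y\<close>.\<close>

lemma dual_Q:
  assumes V: "x \<in> vertices n" "y \<in> vertices n"
  shows "\<phi> \<in> carrier (dual_module k (homs Q x y)) \<longleftrightarrow> \<phi> \<in> extensional (mor Q x y) \<and>
    (\<exists>a\<in>carrier k. \<forall>c\<in>scalars x y. \<phi> (cls x y c) = c \<otimes> a)"
proof -
  have "linear_map k (homs Q x y) (regular_module k) \<phi> \<longleftrightarrow>
      (\<exists>a\<in>carrier k. \<forall>c\<in>scalars x y. \<phi> (cls x y c) = c \<otimes> a)" (is "?L \<longleftrightarrow> ?R")
  proof
    assume L: ?L
    have "\<phi> (cls x y c) = c \<otimes> \<phi> (cls x y (unit_scalar x y))" if c: "c \<in> scalars x y" for c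
    proof -
      have "\<phi> (c \<odot>\<^bsub>homs Q x y\<^esub> cls x y (unit_scalar x y)) = c \<otimes> \<phi> (cls x y (unit_scalar x y))"
        using L scalars_closed[OF c] unit_scalar_scalars[of x y]
        by (simp add: linear_map_def regular_module_def carrier_Q[OF V])
      then show ?thesis
        using smult_Q[OF V unit_scalar_scalars scalars_closed[OF c]] by (simp add: scalars_unit[OF c])
    qed
    moreover have "\<phi> (cls x y (unit_scalar x y)) \<in> carrier k"
      using L unit_scalar_scalars[of x y]
      by (auto simp: linear_map_def regular_module_def carrier_Q[OF V] Pi_iff)
    ultimately show ?R by blast
  next
    assume ?R
    then obtain a where "a \<in> carrier k" "\<And>c. c \<in> scalars x y \<Longrightarrow> \<phi> (cls x y c) = c \<otimes> a" by blast
    then show ?L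
      using scalars_closed[of _ x y]
      by (simp add: linear_map_def regular_module_def carrier_Q[OF V] Pi_iff add_Q[OF V] smult_Q[OF V]
          scalars_add scalars_smult l_distr m_assoc)
  qed
  then show ?thesis by (simp add: dual_module_def mor_def)
qed

lemma pairing_iso:
  assumes V: "x \<in> vertices n" "y \<in> vertices n"
  shows "linear_iso k (homs Q x y) (dual_module k (homs Q y (serre_ob n x))) (pairing x y)"
proof -
  let ?S = "serre_ob n x"
  have V': "y \<in> vertices n" "?S \<in> vertices n" using V by (simp_all add: serre_ob_vertices)
  note scal = scalars_serre_ob[OF V]
  have ext: "pairing x y A \<in> extensional (mor Q y ?S)" for A by (simp add: pairing_def)
  have eqI: "\<phi> = \<psi>"
    if "\<phi> \<in> extensional (mor Q y ?S)" "\<psi> \<in> extensional (mor Q y ?S)"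
      "\<And>d. d \<in> scalars x y \<Longrightarrow> \<phi> (cls y ?S d) = \<psi> (cls y ?S d)" for \<phi> \<psi> :: "_ \<Rightarrow> 'a"
    using that by (intro extensionalityI[of \<phi> "mor Q y ?S" \<psi>]) (auto simp: mor_Q[OF V'] scal)
  have closed: "pairing x y A \<in> carrier (dual_module k (homs Q y ?S))" if "A \<in> carrier (homs Q x y)" for A
  proof -
    obtain c where c: "c \<in> scalars x y" "A = cls x y c" using \<open>A \<in> _\<close> by (auto simp: carrier_Q[OF V])
    note cc = scalars_closed[OF c(1)]
    have "pairing x y A (cls y ?S d) = d \<otimes> (trace_sign x y \<otimes> c)" if "d \<in> scalars y ?S" for d
      using pairing_cls[OF V c(1) that] c(2) cc scalars_closed[OF that] by (simp add: m_ac)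
    then show ?thesis unfolding dual_Q[OF V'] using ext cc by blast
  qed
  have "linear_map k (homs Q x y) (dual_module k (homs Q y ?S)) (pairing x y)"
    unfolding linear_map_def
  proof (intro conjI ballI funcsetI closed)
    fix A B assume "A \<in> carrier (homs Q x y)" "B \<in> carrier (homs Q x y)"
    then obtain c d where c: "c \<in> scalars x y" "A = cls x y c" and d: "d \<in> scalars x y" "B = cls x y d"
      by (auto simp: carrier_Q[OF V])
    show "pairing x y (A \<oplus>\<^bsub>homs Q x y\<^esub> B) =
        pairing x y A \<oplus>\<^bsub>dual_module k (homs Q y ?S)\<^esub> pairing x y B"
    proof (rule eqI)
      fix e assume e: "e \<in> scalars x y"
      then have "cls y ?S e \<in> carrier (homs Q y ?S)" by (simp add: carrier_Q[OF V'] scal)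
      then show "pairing x y (A \<oplus>\<^bsub>homs Q x y\<^esub> B) (cls y ?S e) =
          (pairing x y A \<oplus>\<^bsub>dual_module k (homs Q y ?S)\<^esub> pairing x y B) (cls y ?S e)"
        using c d e scalars_closed[OF c(1)] scalars_closed[OF d(1)] scalars_closed[OF e]
        by (simp add: dual_module_def add_Q[OF V] pairing_cls[OF V] scal scalars_add r_distr)
    qed (use ext in \<open>auto simp: dual_module_def mor_def\<close>)
  next
    fix r A assume r: "r \<in> carrier k" and "A \<in> carrier (homs Q x y)"
    then obtain c where c: "c \<in> scalars x y" "A = cls x y c" by (auto simp: carrier_Q[OF V])
    show "pairing x y (r \<odot>\<^bsub>homs Q x y\<^esub> A) = r \<odot>\<^bsub>dual_module k (homs Q y ?S)\<^esub> pairing x y A"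
    proof (rule eqI)
      fix e assume e: "e \<in> scalars x y"
      then have "cls y ?S e \<in> carrier (homs Q y ?S)" by (simp add: carrier_Q[OF V'] scal)
      then show "pairing x y (r \<odot>\<^bsub>homs Q x y\<^esub> A) (cls y ?S e) =
          (r \<odot>\<^bsub>dual_module k (homs Q y ?S)\<^esub> pairing x y A) (cls y ?S e)"
        using c e r scalars_closed[OF c(1)] scalars_closed[OF e]
        by (simp add: dual_module_def smult_Q[OF V] pairing_cls[OF V] scal scalars_smult m_lcomm)
    qed (use ext in \<open>auto simp: dual_module_def mor_def\<close>)
  qed
  moreover have "bij_betw (pairing x y) (carrier (homs Q x y)) (carrier (dual_module k (homs Q y ?S)))"
  proof (rule bij_betwI')
    fix A B assume "A \<in> carrier (homs Q x y)" "B \<in> carrier (homs Q x y)"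
    then obtain c d where c: "c \<in> scalars x y" "A = cls x y c" and d: "d \<in> scalars x y" "B = cls x y d"
      by (auto simp: carrier_Q[OF V])
    note cl = scalars_closed[OF c(1)] scalars_closed[OF d(1)]
    have "c = d" if "pairing x y A = pairing x y B"
    proof -
      \<comment> \<open>Testing against the generator recovers the coordinate up to a sign.\<close>
      let ?u = "unit_scalar x y" and ?t = "trace_sign x y"
      have u: "?u \<in> carrier k" using unit_scalar_scalars by (rule scalars_closed)
      have "?t \<otimes> ?u \<otimes> c = ?t \<otimes> ?u \<otimes> d"
        using fun_cong[OF that, of "cls y ?S ?u"] c d unit_scalar_scalars[of x y]
        by (simp add: pairing_cls[OF V] scal)
      then have "?t \<otimes> ?t \<otimes> (c \<otimes> ?u) = ?t \<otimes> ?t \<otimes> (d \<otimes> ?u)"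
        using cl u by (simp add: m_ac)
      then show ?thesis
        using cl by (simp add: trace_sign_square[OF V(1)] scalars_unit[OF c(1)] scalars_unit[OF d(1)])
    qed
    then show "pairing x y A = pairing x y B \<longleftrightarrow> A = B" using c d by auto
  next
    fix \<phi> assume "\<phi> \<in> carrier (dual_module k (homs Q y ?S))"
    then obtain a where \<phi>: "\<phi> \<in> extensional (mor Q y ?S)" and a: "a \<in> carrier k"
      "\<And>d. d \<in> scalars x y \<Longrightarrow> \<phi> (cls y ?S d) = d \<otimes> a"
      unfolding dual_Q[OF V'] scal by blast
    \<comment> \<open>The sign is its own inverse, and the factor \<open>unit_scalar x y\<close>
      makes the coordinate zero where the hom module is zero.\<close>
    let ?c = "trace_sign x y \<otimes> a \<otimes> unit_scalar x y"
    have u: "unit_scalar x y \<in> carrier k" using unit_scalar_scalars by (rule scalars_closed)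
    have c: "?c \<in> scalars x y" using a by (intro scalars_smult unit_scalar_scalars) auto
    show "\<exists>A\<in>carrier (homs Q x y). \<phi> = pairing x y A"
    proof (rule bexI[of _ "cls x y ?c"], rule eqI[OF \<phi> ext])
      fix d assume d: "d \<in> scalars x y"
      note dc = scalars_closed[OF d]
      have "trace_sign x y \<otimes> d \<otimes> ?c = (trace_sign x y \<otimes> trace_sign x y) \<otimes> ((d \<otimes> unit_scalar x y) \<otimes> a)"
        using a(1) u dc by (simp add: m_ac)
      then have "trace_sign x y \<otimes> d \<otimes> ?c = d \<otimes> a"
        using a(1) dc by (simp add: trace_sign_square[OF V(1)] scalars_unit[OF d])
      then show "\<phi> (cls y ?S d) = pairing x y (cls x y ?c) (cls y ?S d)"
        using a(2)[OF d] pairing_cls[OF V c] d by (simp add: scal)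
    qed (use c in \<open>auto simp: carrier_Q[OF V]\<close>)
  qed (rule closed)
  ultimately show ?thesis by (simp add: linear_iso_def)
qed

text \<open>The condition that led to \<open>serre_sign\<close>, now with a further morphism from
  \<open>x\<close> to \<open>y\<close> in between: the exponents still differ by an even
  number.\<close>

lemma trace_sign_serre:
  assumes V: "x' \<in> vertices n" "x \<in> vertices n" "y \<in> vertices n" and r: "reach n x' y" and r': "reach n x y"
  shows "trace_sign x' y \<otimes> coef x' x y =
    trace_sign x y \<otimes> (coef y (serre_ob n x') (serre_ob n x) \<otimes> ssign x' x)"
proof -
  let ?l = "triangle (fst x') + stars x' y * plains y (serre_ob n x') + stars x' x * plains x y"
  let ?r = "triangle (fst x) + stars x y * plains y (serre_ob n x) +
    (stars y (serre_ob n x') * stars x' x + serre_sign n x' x)"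
  have "?l = ?r + 2 * (stars x' x * (1 - int (fst x') + stars x' x) - triangle (fst x))"
    unfolding serre_sign_def serre_ob_counts(3,4)[OF V(1,3)] serre_ob_counts(3,4)[OF V(2,3)]
      stars_plus[of x' x y, symmetric] plains_plus[of x' x y, symmetric] fst_eq_counts[of x x']
    by (simp add: algebra_simps)
  then have "parity_sign k ?l = parity_sign k ?r" by (rule parity_sign_eqI)
  then show ?thesis
    using r r' reach_serre_ob V
    by (simp add: trace_sign_def coef_def serre_ob_counts m_assoc flip: parity_sign_add)
qed

lemma serre_functor_serre: "serre_functor k Q serre"
  unfolding serre_functor_def
proof (rule conjI[OF linear_equivalence_serre], rule exI[of _ pairing], intro conjI ballI)
  have ob: "on_ob serre = serre_ob n" by (simp add: serre_def)
  show "linear_iso k (homs Q x y) (dual_module k (homs Q y (on_ob serre x))) (pairing x y)"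
    if "x \<in> objects Q" "y \<in> objects Q" for x y
    using that pairing_iso by (simp add: ob)
  show "pairing x' y (cmp Q x' x y u f) g =
      pairing x y u (cmp Q y (on_ob serre x') (on_ob serre x) (on_mor serre x' x f) g)"
    if prems: "x' \<in> objects Q" "x \<in> objects Q" "y \<in> objects Q" "f \<in> mor Q x' x" "u \<in> mor Q x y"
      "g \<in> mor Q y (on_ob serre x')" for x' x y f u g
  proof -
    have V: "x' \<in> vertices n" "x \<in> vertices n" "y \<in> vertices n" using prems by auto
    have V': "serre_ob n x' \<in> vertices n" "serre_ob n x \<in> vertices n" using V serre_ob_vertices by auto
    obtain c d e where c: "c \<in> scalars x' x" "f = cls x' x c" and d: "d \<in> scalars x y" "u = cls x y d"
      and e: "e \<in> scalars y (serre_ob n x')" "g = cls y (serre_ob n x') e"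
      using prems V V' by (auto simp: mor_Q ob)
    note cl = scalars_closed[OF c(1)] scalars_closed[OF d(1)] scalars_closed[OF e(1)]
    have sc: "ssign x' x \<otimes> c \<in> scalars (serre_ob n x') (serre_ob n x)"
      using c(1) reach_serre_ob(1)[OF V(1,2)] by (auto simp: scalars_def)
    have mor: "on_mor serre x' x (cls x' x c) = cls (serre_ob n x') (serre_ob n x) (ssign x' x \<otimes> c)"
      using V c by (simp add: serre_def val_cls)
    have "trace_sign x' y \<otimes> e \<otimes> (coef x' x y \<otimes> d \<otimes> c) =
        trace_sign x y \<otimes> (coef y (serre_ob n x') (serre_ob n x) \<otimes> (ssign x' x \<otimes> c) \<otimes> e) \<otimes> d"
    proof (cases "c = \<zero> \<or> d = \<zero> \<or> e = \<zero>")
      case True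
      then show ?thesis using cl by auto
    next
      case False
      then have r: "reach n x y" "reach n x' y"
        using scalars_cases[OF d(1)] scalars_cases[OF e(1)] reach_serre_ob(2)[OF V(1,3)] by auto
      have "trace_sign x' y \<otimes> e \<otimes> (coef x' x y \<otimes> d \<otimes> c) =
          (trace_sign x' y \<otimes> coef x' x y) \<otimes> (c \<otimes> d \<otimes> e)"
        using cl by (simp add: m_ac)
      also have "\<dots> = (trace_sign x y \<otimes> (coef y (serre_ob n x') (serre_ob n x) \<otimes> ssign x' x)) \<otimes> (c \<otimes> d \<otimes> e)"
        by (simp only: trace_sign_serre[OF V r(2,1)])
      also have "\<dots> = trace_sign x y \<otimes> (coef y (serre_ob n x') (serre_ob n x) \<otimes> (ssign x' x \<otimes> c) \<otimes> e) \<otimes> d"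
        using cl by (simp add: m_ac)
      finally show ?thesis .
    qed
    then show ?thesis
      unfolding ob c(2) d(2) e(2) mor
      using V V' c d e sc cl
      by (simp add: cmp_Q pairing_cls scalars_cmp)
  qed
  show "pairing x y' (cmp Q x y y' h u) g = pairing x y u (cmp Q y y' (on_ob serre x) g h)"
    if prems: "x \<in> objects Q" "y \<in> objects Q" "y' \<in> objects Q" "h \<in> mor Q y y'" "u \<in> mor Q x y"
      "g \<in> mor Q y' (on_ob serre x)" for x y y' h u g
  proof -
    let ?S = "serre_ob n x"
    have V: "x \<in> vertices n" "y \<in> vertices n" "y' \<in> vertices n" "?S \<in> vertices n"
      using prems serre_ob_vertices by auto
    obtain c d e where c: "c \<in> scalars y y'" "h = cls y y' c" and d: "d \<in> scalars x y" "u = cls x y d"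
      and e: "e \<in> scalars y' ?S" "g = cls y' ?S e"
      using prems V by (auto simp: mor_Q ob)
    note cl = scalars_closed[OF c(1)] scalars_closed[OF d(1)] scalars_closed[OF e(1)]
    \<comment> \<open>Naturality in this variable is associativity of the composite into S x; the
      form at \<open>x\<close> stays the same.\<close>
    have "trace_sign x y' \<otimes> e \<otimes> (coef x y y' \<otimes> c \<otimes> d) =
        trace_sign x y \<otimes> (coef y y' ?S \<otimes> e \<otimes> c) \<otimes> d"
    proof (cases "c = \<zero> \<or> d = \<zero> \<or> e = \<zero>")
      case True
      then show ?thesis using cl by auto
    next
      case False
      then have r: "reach n x y" "reach n y y'" "reach n y' ?S"
        using scalars_cases[OF c(1)] scalars_cases[OF d(1)] scalars_cases[OF e(1)] by auto
      let ?t = "parity_sign k (triangle (fst x))"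
      have "trace_sign x y' \<otimes> e \<otimes> (coef x y y' \<otimes> c \<otimes> d) =
          ?t \<otimes> (coef x y' ?S \<otimes> coef x y y') \<otimes> (c \<otimes> d \<otimes> e)"
        using cl by (simp add: trace_sign_def m_ac)
      also have "\<dots> = ?t \<otimes> (coef x y ?S \<otimes> coef y y' ?S) \<otimes> (c \<otimes> d \<otimes> e)"
        by (simp only: coef_assoc[OF r])
      also have "\<dots> = trace_sign x y \<otimes> (coef y y' ?S \<otimes> e \<otimes> c) \<otimes> d"
        using cl by (simp add: trace_sign_def m_ac)
      finally show ?thesis .
    qed
    then show ?thesis
      unfolding ob c(2) d(2) e(2)
      using V c d e cl
      by (simp add: cmp_Q pairing_cls scalars_cmp)
  qed
qed

section \<open>The values of the Serre functor on arrows determine it\<close>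

lemma serre_prescription_serre: "serre_prescription n k serre"
  unfolding serre_prescription_def
proof (intro conjI allI impI)
  fix q i assume q: "1 \<le> q \<and> q \<le> n"
  show "on_ob serre (q, i) = (n + 1 - q, i + 1 - int q)"
    by (simp add: serre_def serre_ob_def)
next
  fix q :: nat and i :: int assume q: "1 \<le> q \<and> q < n"
  then have V: "(q, i) \<in> vertices n" "(q + 1, i) \<in> vertices n" "(q, i - 1) \<in> vertices n"
    "(n + 1 - q, i + 1 - int q) \<in> vertices n" "(n - q, i - int q) \<in> vertices n"
    "(n + 1 - q, i - int q) \<in> vertices n"
    by (auto simp: vertices_iff)
  have one: "\<one> \<in> scalars (q, i) (q + 1, i)" "\<one> \<in> scalars (q + 1, i) (q, i - 1)"
    "\<one> \<in> scalars (n + 1 - q, i + 1 - int q) (n - q, i - int q)"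
    "\<one> \<in> scalars (n - q, i - int q) (n + 1 - q, i - int q)"
    using q by (auto simp: scalars_def reach_def stars_def plains_def of_nat_diff)
  have ob: "serre_ob n (q, i) = (n + 1 - q, i + 1 - int q)" "serre_ob n (Suc q, i) = (n - q, i - int q)"
    "serre_ob n (q, i - 1) = (n + 1 - q, i - int q)"
    by (auto simp: serre_ob_def)
  have nq: "1 \<le> n - q" "n - q < n" using q by auto
  have sq: "parity_sign k (int q * int q) = parity_sign k (int q)"
    by (rule parity_sign_cong) auto
  show "on_mor serre (q, i) (q + 1, i) (arrow_mor n k (Arr q i)) =
      (\<ominus> \<one>) [^] q \<odot>\<^bsub>homs Q (n + 1 - q, i + 1 - int q) (n - q, i - int q)\<^esub>
      arrow_mor n k (Arr_star (n - q) (i + 1 - int q))"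
  proof -
    have "arrow_mor n k (Arr_star (n - q) (i + 1 - int q)) =
        cls (n + 1 - q, i + 1 - int q) (n - q, i - int q) \<one>"
      using arrow_mor_Arr_star[of "n - q" "i + 1 - int q"] nq q by (simp add: Suc_diff_le)
    moreover have "serre_sign n (q, i) (q + 1, i) = int q * int q"
      using triangle_Suc[of q] by (simp add: serre_sign_def stars_def)
    ultimately show ?thesis
      using q smult_Q[OF V(4,5) one(3), of "parity_sign k (int q)"] val_cls[OF V(1,2) one(1)]
      by (simp add: serre_def ob arrow_mor_Arr parity_sign_nat sq)
  qed
  show "on_mor serre (q + 1, i) (q, i - 1) (arrow_mor n k (Arr_star q i)) =
      (\<ominus> \<one>) [^] (n - q) \<odot>\<^bsub>homs Q (n - q, i - int q) (n + 1 - q, i - int q)\<^esub>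
      arrow_mor n k (Arr (n - q) (i - int q))"
  proof -
    have "arrow_mor n k (Arr (n - q) (i - int q)) = cls (n - q, i - int q) (n + 1 - q, i - int q) \<one>"
      using arrow_mor_Arr[of "n - q" "i - int q"] nq q by (simp add: Suc_diff_le)
    \<comment> \<open>A starred arrow has counts 1 and 0, so the quadratic term is
      \<open>n - 2\<close> and the whole exponent has the parity of \<open>n - q\<close>.\<close>
    moreover have "ssign (q + 1, i) (q, i - 1) = parity_sign k (int (n - q))"
    proof (rule parity_sign_cong)
      have "serre_sign n (q + 1, i) (q, i - 1) = int q * int q + (int n - 2)"
        using triangle_Suc[of q] by (simp add: serre_sign_def stars_def plains_def)
      then show "even (serre_sign n (q + 1, i) (q, i - 1) + int (n - q))"
        using q by (auto simp: of_nat_diff)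
    qed
    ultimately show ?thesis
      using q smult_Q[OF V(5,6) one(4), of "parity_sign k (int (n - q))"] val_cls[OF V(2,3) one(2)]
      by (simp add: serre_def ob arrow_mor_Arr_star parity_sign_nat)
  qed
qed

text \<open>A linear functor is determined by its values on arrows, as each morphism between different
  objects factors through an arrow.\<close>

lemma serre_prescription_unique:
  assumes T: "linear_functor k Q Q T" "serre_prescription n k T"
    and S: "linear_functor k Q Q S" "serre_prescription n k S"
    and "x \<in> vertices n" "y \<in> vertices n" "f \<in> mor Q x y"
  shows "on_mor T x y f = on_mor S x y f"
  using assms(5-)
proof (induction "nat (stars x y + plains x y)" arbitrary: x f rule: less_induct)
  case less
  note V = less.prems(1,2)
  have TV: "on_ob T u \<in> vertices n" if "u \<in> vertices n" for u
    using T(1) that by (auto simp: linear_functor_def)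
  have ob: "on_ob T u = on_ob S u" if "u \<in> vertices n" for u
    using T(2) S(2) that by (cases u) (auto simp: serre_prescription_def vertices_iff)
  have lin: "linear_map k (homs Q x y) (homs Q (on_ob T x) (on_ob T y)) (on_mor T x y)"
      "linear_map k (homs Q x y) (homs Q (on_ob T x) (on_ob T y)) (on_mor S x y)"
    using T(1) S(1) V ob by (auto simp: linear_functor_def)
  obtain c where c: "c \<in> scalars x y" "f = cls x y c" using less.prems by (auto simp: mor_Q)
  consider "c = \<zero>" | "x = y" | "reach n x y" "x \<noteq> y" using scalars_cases[OF c(1)] by blast
  then show ?case
  proof cases
    case 1
    then have "f = \<zero>\<^bsub>homs Q x y\<^esub>" using c V by (simp add: zero_Q)
    then show ?thesis
      using linear_map_zero[OF module_Q[OF V] module_Q lin(1)]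
        linear_map_zero[OF module_Q[OF V] module_Q lin(2)] TV V by simp
  next
    case 2
    \<comment> \<open>An endomorphism is a multiple of the identity, on which linear functors with
      the same objects agree.\<close>
    have "f = c \<odot>\<^bsub>homs Q x y\<^esub> ident Q x"
      using smult_Q[OF V(1,1) scalars_one[OF V(1)] scalars_closed[OF c(1)]] 2 c scalars_closed[OF c(1)] V
      by (simp add: ident_Q)
    moreover have "ident Q x \<in> carrier (homs Q x y)"
      using V 2 by (simp add: ident_Q carrier_Q scalars_one)
    moreover have "on_mor T x y (ident Q x) = on_mor S x y (ident Q x)"
      using T(1) S(1) V 2 ob by (simp add: linear_functor_def)
    ultimately show ?thesis
      using lin scalars_closed[OF c(1)] by (simp add: linear_map_def)
  next
    case 3
    obtain e h d where e: "e \<in> arcs (rep_quiver n)" "tail (rep_quiver n) e = x"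
      "head (rep_quiver n) e = h" "h \<in> vertices n" "stars h y + plains h y + 1 = stars x y + plains x y"
      "reach n h y" "d \<in> scalars h y" "arrow_mor n k e \<in> mor Q x h"
      "cls x y c = cmp Q x h y (cls h y d) (arrow_mor n k e)"
      using factor_arrow[OF V 3 c(1)] .
    have arrow: "on_mor T x h (arrow_mor n k e) = on_mor S x h (arrow_mor n k e)"
      using T(2) S(2) e(1-3) by (cases e) (auto simp: serre_prescription_def rep_quiver_def)
    have g: "cls h y d \<in> mor Q h y" using e V by (simp add: mor_Q)
    have "nat (stars h y + plains h y) < nat (stars x y + plains x y)"
      using e(5,6) by (auto simp: reach_def)
    then have IH: "on_mor T h y (cls h y d) = on_mor S h y (cls h y d)"
      using less.hyps e(4) V(2) g by blast
    have "on_mor F x y f = cmp Q (on_ob F x) (on_ob F h) (on_ob F y) (on_mor F h y (cls h y d))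
        (on_mor F x h (arrow_mor n k e))" if "linear_functor k Q Q F" for F ::
        "(nat \<times> int, (rep_arrow list \<Rightarrow> 'a) set, nat \<times> int, (rep_arrow list \<Rightarrow> 'a) set) functor_data"
      using that V e(4,8) g unfolding c(2) e(9) linear_functor_def objects_Q by blast
    from this[OF T(1)] this[OF S(1)] show ?thesis
      using IH arrow ob V e(4) by simp
  qed
qed

end

section \<open>The rectangle in the drawing\<close>

text \<open>Interpolating along two opposite edges with parameter \<open>s\<close> and then between
  the resulting points with parameter \<open>t\<close> gives the point.\<close>

lemma convex_hull_parallelogram:
  fixes w u v :: "'a::real_vector"
  assumes "0 \<le> s" "s \<le> 1" "0 \<le> t" "t \<le> 1"
  shows "w + s *\<^sub>R u + t *\<^sub>R v \<in> convex hull {w, w + u, w + v, w + u + v}" (is "_ \<in> ?H")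
proof -
  have vert: "w \<in> ?H" "w + u \<in> ?H" "w + v \<in> ?H" "w + u + v \<in> ?H"
    by (auto intro: hull_inc)
  have "(1 - s) *\<^sub>R w + s *\<^sub>R (w + u) \<in> ?H" "(1 - s) *\<^sub>R (w + v) + s *\<^sub>R (w + u + v) \<in> ?H"
    using vert assms by (auto intro!: convexD[OF convex_convex_hull])
  then have "(1 - t) *\<^sub>R ((1 - s) *\<^sub>R w + s *\<^sub>R (w + u)) +
      t *\<^sub>R ((1 - s) *\<^sub>R (w + v) + s *\<^sub>R (w + u + v)) \<in> ?H"
    using assms by (auto intro!: convexD[OF convex_convex_hull])
  moreover have "(1 - t) *\<^sub>R ((1 - s) *\<^sub>R w + s *\<^sub>R (w + u)) +
      t *\<^sub>R ((1 - s) *\<^sub>R (w + v) + s *\<^sub>R (w + u + v)) = w + s *\<^sub>R u + t *\<^sub>R v"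
    by (simp add: algebra_simps)
  ultimately show ?thesis by simp
qed

lemma position_in_rectangle_iff:
  assumes p: "1 \<le> p" "p \<le> n"
  shows "position y \<in> rectangle n p i \<longleftrightarrow> reach n (p, i) y"
proof -
  define A B a b where "A = real p - 1" and "B = real n - real p"
    and "a = real_of_int (stars (p, i) y)" and "b = real_of_int (plains (p, i) y)"
  have AB: "0 \<le> A" "0 \<le> B" using p by (auto simp: A_def B_def)
  define w where "w = position (p, i)"
  have vertices: "position ` {(p, i), (1, i + 1 - int p), (n, i), (n + 1 - p, i + 1 - int p)} =
      {w, w + (A, A), w + (B, -B), w + (A, A) + (B, -B)}"
    using p by (auto simp: position_def w_def A_def B_def of_nat_diff)
  have y: "position y = w + (a + b, a - b)"
    by (cases y) (simp add: position_def w_def a_def b_def stars_def plains_def)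
  have reach: "reach n (p, i) y \<longleftrightarrow> 0 \<le> a \<and> a \<le> A \<and> 0 \<le> b \<and> b \<le> B"
  proof -
    have "a \<le> A \<longleftrightarrow> stars (p, i) y \<le> int p - 1" "b \<le> B \<longleftrightarrow> plains (p, i) y \<le> int n - int p"
      unfolding a_def b_def A_def B_def by linarith+
    then show ?thesis by (simp add: reach_def a_def b_def)
  qed
  show ?thesis
    unfolding reach rectangle_def vertices y
  proof
    \<comment> \<open>The sides point along (1, 1) and (1, -1). The inner products with these
      vectors double the two coordinates, hence \<open>2 * A\<close> and \<open>2 * B\<close>, and
      give four half-planes that contain the vertices.\<close>
    let ?C = "{z. (1, 1) \<bullet> z \<ge> (1, 1) \<bullet> w} \<inter> {z. (1, 1) \<bullet> z \<le> (1, 1) \<bullet> w + 2 * A} \<inter>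
      {z. (1, -1) \<bullet> z \<ge> (1, -1) \<bullet> w} \<inter> {z. (1, -1) \<bullet> z \<le> (1, -1) \<bullet> w + 2 * B}"
    assume "w + (a + b, a - b) \<in> convex hull {w, w + (A, A), w + (B, -B), w + (A, A) + (B, -B)}"
    moreover have "convex hull {w, w + (A, A), w + (B, -B), w + (A, A) + (B, -B)} \<subseteq> ?C"
    proof (rule hull_minimal)
      show "convex ?C" by (intro convex_Int convex_halfspace_le convex_halfspace_ge)
    qed (use AB in \<open>auto simp: inner_prod_def\<close>)
    ultimately have "w + (a + b, a - b) \<in> ?C" by blast
    then show "0 \<le> a \<and> a \<le> A \<and> 0 \<le> b \<and> b \<le> B" by (auto simp: inner_prod_def)
  next
    assume ab: "0 \<le> a \<and> a \<le> A \<and> 0 \<le> b \<and> b \<le> B"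
    \<comment> \<open>The rectangle degenerates if \<open>A = 0\<close> or \<open>B = 0\<close>;
      then the coordinate is zero as well, and division by zero gives the right parameter 0.\<close>
    have "(a / A) * A = a" "(b / B) * B = b" using ab by auto
    then have eq: "w + (a + b, a - b) = w + (a / A) *\<^sub>R (A, A) + (b / B) *\<^sub>R (B, -B)"
      by (simp only: scaleR_Pair real_scaleR_def mult_minus_right) (simp add: prod_eq_iff)
    have "0 \<le> a / A" "a / A \<le> 1" "0 \<le> b / B" "b / B \<le> 1"
      using ab AB by (auto simp: divide_le_eq_1)
    then show "w + (a + b, a - b) \<in> convex hull {w, w + (A, A), w + (B, -B), w + (A, A) + (B, -B)}"
      unfolding eq by (rule convex_hull_parallelogram)
  qed
qed

theorem theorem8p11:
  fixes k :: "('a, 'r) ring_scheme" and n :: nat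
  assumes "n \<ge> 2"
    and "cring k"
    and "\<one>\<^bsub>k\<^esub> \<noteq> \<zero>\<^bsub>k\<^esub>"
  defines "Q \<equiv> mesh_category n k"
    and "\<rr> \<equiv> arrow_ideal n k"
  shows
    "preadditive_category k Q \<and>
     hom_finite k Q \<and>
     locally_bounded Q \<and>
     (\<exists>S. serre_functor k Q S) \<and>
     strong_retraction_property k Q \<and>
     (\<forall>p i q j. 1 \<le> p \<and> p \<le> n \<and> 1 \<le> q \<and> q \<le> n \<longrightarrow>
        (zero_module (homs Q (p, i) (q, j)) \<or> free_of_dim k 1 (homs Q (p, i) (q, j))) \<and>
        (free_of_dim k 1 (homs Q (p, i) (q, j)) \<longleftrightarrow> position (q, j) \<in> rectangle n p i) \<and>
        (free_of_dim k 1 (homs Q (p, i) (q, j)) \<longleftrightarrow>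
           0 \<le> i - j \<and> i - j \<le> int p - 1 \<and>
           0 \<le> int q - int p + i - j \<and> int q - int p + i - j \<le> int n - int p)) \<and>
     (\<exists>S. serre_functor k Q S \<and> serre_prescription n k S \<and>
        (\<forall>T. linear_functor k Q Q T \<and> serre_prescription n k T \<longrightarrow>
           (\<forall>x\<in>objects Q. \<forall>y\<in>objects Q. \<forall>f\<in>mor Q x y. on_mor T x y f = on_mor S x y f))) \<and>
     retraction_complement k Q (\<lambda>x. \<rr> x x) \<and>
     (\<forall>x\<in>objects Q. \<forall>y\<in>objects Q. \<rr> x y = pseudo_radical Q (\<lambda>x. \<rr> x x) x y) \<and>
     (\<forall>x\<in>objects Q. \<forall>y\<in>objects Q. ideal_power k Q \<rr> n x y = {\<zero>\<^bsub>homs Q x y\<^esub>})"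
proof -
  interpret cring k by (rule assms(2))
  interpret mesh k n by unfold_locales (rule assms)+
  have homs: "\<forall>p i q j. 1 \<le> p \<and> p \<le> n \<and> 1 \<le> q \<and> q \<le> n \<longrightarrow>
        (zero_module (homs Q (p, i) (q, j)) \<or> free_of_dim k 1 (homs Q (p, i) (q, j))) \<and>
        (free_of_dim k 1 (homs Q (p, i) (q, j)) \<longleftrightarrow> position (q, j) \<in> rectangle n p i) \<and>
        (free_of_dim k 1 (homs Q (p, i) (q, j)) \<longleftrightarrow>
           0 \<le> i - j \<and> i - j \<le> int p - 1 \<and>
           0 \<le> int q - int p + i - j \<and> int q - int p + i - j \<le> int n - int p)"
  proof (intro allI impI)
    fix p q :: nat and i j :: int
    assume pq: "1 \<le> p \<and> p \<le> n \<and> 1 \<le> q \<and> q \<le> n"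
    have V: "(p, i) \<in> vertices n" "(q, j) \<in> vertices n" using pq by (simp_all add: vertices_iff)
    have "reach n (p, i) (q, j) \<longleftrightarrow> 0 \<le> i - j \<and> i - j \<le> int p - 1 \<and>
        0 \<le> int q - int p + i - j \<and> int q - int p + i - j \<le> int n - int p"
      by (simp add: reach_def stars_def plains_def)
    then show "(zero_module (homs Q (p, i) (q, j)) \<or> free_of_dim k 1 (homs Q (p, i) (q, j))) \<and>
        (free_of_dim k 1 (homs Q (p, i) (q, j)) \<longleftrightarrow> position (q, j) \<in> rectangle n p i) \<and>
        (free_of_dim k 1 (homs Q (p, i) (q, j)) \<longleftrightarrow>
           0 \<le> i - j \<and> i - j \<le> int p - 1 \<and>
           0 \<le> int q - int p + i - j \<and> int q - int p + i - j \<le> int n - int p)"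
      unfolding Q_def free_of_dim_Q_iff[OF V] zero_module_Q_iff[OF V]
      using position_in_rectangle_iff[of p n "(q, j)" i] pq by blast
  qed
  have serre: "\<exists>S. serre_functor k Q S \<and> serre_prescription n k S \<and>
      (\<forall>T. linear_functor k Q Q T \<and> serre_prescription n k T \<longrightarrow>
         (\<forall>x\<in>objects Q. \<forall>y\<in>objects Q. \<forall>f\<in>mor Q x y. on_mor T x y f = on_mor S x y f))"
    unfolding Q_def objects_Q
  proof (rule exI[of _ serre], intro conjI allI impI ballI)
    fix T x y f
    assume "linear_functor k (mesh_category n k) (mesh_category n k) T \<and> serre_prescription n k T"
      and "x \<in> vertices n" "y \<in> vertices n" "f \<in> mor (mesh_category n k) x y"
    then show "on_mor T x y f = on_mor serre x y f"
      using serre_prescription_unique[OF _ _ linear_functor_serre serre_prescription_serre] by blast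
  qed (rule serre_functor_serre serre_prescription_serre)+
  have radical: "\<forall>x\<in>objects Q. \<forall>y\<in>objects Q. \<rr> x y = pseudo_radical Q (\<lambda>x. \<rr> x x) x y"
    unfolding Q_def \<rr>_def by (auto simp: pseudo_radical_def arrow_ideal_eq)
  have power: "\<forall>x\<in>objects Q. \<forall>y\<in>objects Q. ideal_power k Q \<rr> n x y = {\<zero>\<^bsub>homs Q x y\<^esub>}"
    unfolding Q_def \<rr>_def using arrow_ideal_nilpotent by simp
  have "preadditive_category k Q" "hom_finite k Q" "locally_bounded Q" "strong_retraction_property k Q"
    "retraction_complement k Q (\<lambda>x. \<rr> x x)"
    unfolding Q_def \<rr>_def
    by (rule preadditive_Q hom_finite_Q locally_bounded_Q strong_retraction_Q
        retraction_complement_arrow_ideal)+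
  moreover have "\<exists>S. serre_functor k Q S" using serre by blast
  ultimately show ?thesis using homs serre radical power by (intro conjI)
qed

end
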